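(* Let $n \geq 2$ and $1 \leq k \leq n$ be integers. The sets of real exponents $\alpha$ for which the entrywise power functions $f_\alpha$ (on $\mathbb{P}_n^k([0,\infty))$) and $\phi_\alpha,\psi_\alpha$ (on $\mathbb{P}_n^k(\mathbb{R})$) have the five Loewner properties are as follows. **Positivity.** If $k=1$: $\mathcal{H}_{pos}(n,1)=\mathcal{H}_{pos}^\phi(n,1)=\mathcal{H}_{pos}^\psi(n,1)=\mathbb{R}$. If $2\leq k\leq n$: $\mathcal{H}_{pos}(n,k)=\mathbb{N}\cup[n-2,\infty)$, $\mathcal{H}_{pos}^\phi(n,k)=2\mathbb{N}\cup[n-2,\infty)$, $\mathcal{H}_{pos}^\psi(n,k)=(-1+2\mathbb{N})\cup[n-2,\infty)$. **Monotonicity.** If $k=1$: $\mathcal{H}_{mono}(n,1)=\mathcal{H}_{mono}^\phi(n,1)=\mathcal{H}_{mono}^\psi(n,1)=[0,\infty)$. If $2\leq k\leq n$: $\mathcal{H}_{mono}(n,k)=\mathbb{N}\cup[n-1,\infty)$, $\mathcal{H}_{mono}^\phi(n,k)=2\mathbb{N}\cup[n-1,\infty)$, $\mathcal{H}_{mono}^\psi(n,k)=(-1+2\mathbb{N})\cup[n-1,\infty)$. **Convexity.** If $k=1$: $\mathcal{H}_{conv}(n,1)=\mathcal{H}_{conv}^\phi(n,1)=\mathcal{H}_{conv}^\psi(n,1)=[1,\infty)$. If $2\leq k\leq n$: $\mathcal{H}_{conv}(n,k)=\mathbb{N}\cup[n,\infty)$, $\mathcal{H}_{conv}^\phi(n,k)=2\mathbb{N}\cup[n,\infty)$,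 $\mathcal{H}_{conv}^\psi(n,k)=(-1+2\mathbb{N})\cup[n,\infty)$. **Super-additivity.** For all $1\leq k\leq n$: $\mathcal{H}_{super}(n,k)=\mathbb{N}\cup[n,\infty)$, $\mathcal{H}_{super}^\phi(n,k)=2\mathbb{N}\cup[n,\infty)$, $\mathcal{H}_{super}^\psi(n,k)=(-1+2\mathbb{N})\cup[n,\infty)$. **Sub-additivity.** If $k=1$: $\mathcal{H}_{sub}(2,1)=(-\infty,0]\cup\{1\}$, and $\mathcal{H}_{sub}(n,1)=\{0,1\}$ for $n>2$; $\mathcal{H}_{sub}^\phi(n,1)=\emptyset$; $\mathcal{H}_{sub}^\psi(2,1)=\{0,1\}$, and $\mathcal{H}_{sub}^\psi(n,1)=\{1\}$ for $n>2$. If $2\leq k\leq n$: $\mathcal{H}_{sub}(n,k)=\{1\}$, $\mathcal{H}_{sub}^\phi(n,k)=\emptyset$, $\mathcal{H}_{sub}^\psi(n,k)=\{1\}$.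
   Context: $\mathbb{N}=\{1,2,3,\dots\}$; $2\mathbb{N}$ and $-1+2\mathbb{N}$ denote the positive even and positive odd integers. For $I\subset\mathbb{R}$, $\mathbb{P}_n(I)$ is the set of real symmetric positive semidefinite $n\times n$ matrices with all entries in $I$; $\mathbb{P}_n:=\mathbb{P}_n(\mathbb{R})$; $\mathbb{P}_n^k(I)$ is the set of matrices in $\mathbb{P}_n(I)$ of rank at most $k$. For symmetric $A,B$, write $A\geq B$ if $A-B\in\mathbb{P}_n$ (Loewner order). For a function $f$ and a matrix $A=(a_{ij})$, $f[A]:=(f(a_{ij}))$ (entrywise application). For $\alpha\in\mathbb{R}$: $f_\alpha(x):=x^\alpha$ for $x>0$; $\phi_\alpha(x):=|x|^\alpha$ and $\psi_\alpha(x):=\operatorname{sign}(x)|x|^\alpha$ for real $x\neq 0$; and $f_\alpha(0)=\phi_\alpha(0)=\psi_\alpha(0):=0$ for every $\alpha$ (including $\alpha\le 0$). For $V\subset\mathbb{P}_n(I)$, a function $f:I\to\mathbb{R}$ is: positive on $V$ if $f[A]\geq 0$ for all $A\in V$; monotone on $V$ if $f[A]\geq f[B]$ for all $A,B\in V$ with $A\geq B\geq 0$; convex on $V$ if $f[\lambda A+(1-\lambda)B]\leq\lambda f[A]+(1-\lambda)f[B]$ for all $0\leq\lambda\leq1$ and all $A,B\in V$ with $A\geq B\geq0$; super-additive on $V$ if $f[A+B]\geq f[A]+f[B]$ for all $A,B\in V$ for which $f[A+B]$ is defined; sub-additive on $V$ if $f[A+B]\leq f[A]+f[B]$ for all $A,B\in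 V$ for which $f[A+B]$ is defined. For $J\in\{pos, mono, conv, super, sub\}$ (positivity, monotonicity, convexity, super-additivity, sub-additivity), $\mathcal{H}_J(n,k)$ is the set of $\alpha\in\mathbb{R}$ such that $f_\alpha$ has property $J$ on $\mathbb{P}_n^k([0,\infty))$; $\mathcal{H}_J^\phi(n,k)$ (resp. $\mathcal{H}_J^\psi(n,k)$) is the set of $\alpha\in\mathbb{R}$ such that $\phi_\alpha$ (resp. $\psi_\alpha$) has property $J$ on $\mathbb{P}_n^k(\mathbb{R})$.
   Formalization: For n = k = 2 the sub-additivity sets of f and ψ are proved to be {0,1} instead of {1}: with f_0(0) = ψ_0(0) = 0, exponent 0 is sub-additive on all 2×2 positive semidefinite matrices, so the stated value is false there; all other cases are as stated. *)

theory Defs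
  imports Complex_Main "Jordan_Normal_Form.DL_Rank"
begin

definition psd :: "nat \<Rightarrow> real set \<Rightarrow> real mat set" where
  "psd n I = {A \<in> carrier_mat n n. transpose_mat A = A \<and> elements_mat A \<subseteq> I \<and>
     (\<forall>v \<in> carrier_vec n. 0 \<le> v \<bullet> (A *\<^sub>v v))}"

definition psd_rank :: "nat \<Rightarrow> nat \<Rightarrow> real set \<Rightarrow> real mat set" where
  "psd_rank n k I = {A \<in> psd n I. vec_space.rank n A \<le> k}"

definition loewner_le :: "nat \<Rightarrow> real mat \<Rightarrow> real mat \<Rightarrow> bool" where
  "loewner_le n A B \<longleftrightarrow> B - A \<in> psd n UNIV"

text \<open>In the following predicates \<open>f\<close> is a function on \<open>I\<close>, rendered as a total function of
  which only the values on \<open>I\<close> matter; \<open>f[A]\<close> is \<open>map_mat f A\<close>, and it is defined iff all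
  entries of \<open>A\<close> lie in \<open>I\<close>. In the sums below \<open>A + B\<close> itself need not lie in \<open>V\<close>.\<close>

definition positive_on :: "nat \<Rightarrow> real set \<Rightarrow> real mat set \<Rightarrow> (real \<Rightarrow> real) \<Rightarrow> bool" where
  "positive_on n I V f \<longleftrightarrow> (\<forall>A \<in> V. loewner_le n (0\<^sub>m n n) (map_mat f A))"

definition monotone_loewner_on :: "nat \<Rightarrow> real set \<Rightarrow> real mat set \<Rightarrow> (real \<Rightarrow> real) \<Rightarrow> bool" where
  "monotone_loewner_on n I V f \<longleftrightarrow>
     (\<forall>A \<in> V. \<forall>B \<in> V. loewner_le n B A \<longrightarrow> loewner_le n (0\<^sub>m n n) B \<longrightarrow>
        loewner_le n (map_mat f B) (map_mat f A))"

definition convex_loewner_on :: "nat \<Rightarrow> real set \<Rightarrow> real mat set \<Rightarrow> (real \<Rightarrow> real) \<Rightarrow> bool" where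
  "convex_loewner_on n I V f \<longleftrightarrow>
     (\<forall>A \<in> V. \<forall>B \<in> V. \<forall>l. 0 \<le> l \<longrightarrow> l \<le> 1 \<longrightarrow>
        loewner_le n B A \<longrightarrow> loewner_le n (0\<^sub>m n n) B \<longrightarrow>
        loewner_le n (map_mat f (l \<cdot>\<^sub>m A + (1 - l) \<cdot>\<^sub>m B))
                     (l \<cdot>\<^sub>m map_mat f A + (1 - l) \<cdot>\<^sub>m map_mat f B))"

definition super_additive_on :: "nat \<Rightarrow> real set \<Rightarrow> real mat set \<Rightarrow> (real \<Rightarrow> real) \<Rightarrow> bool" where
  "super_additive_on n I V f \<longleftrightarrow>
     (\<forall>A \<in> V. \<forall>B \<in> V. elements_mat (A + B) \<subseteq> I \<longrightarrow>
        loewner_le n (map_mat f A + map_mat f B) (map_mat f (A + B)))"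

definition sub_additive_on :: "nat \<Rightarrow> real set \<Rightarrow> real mat set \<Rightarrow> (real \<Rightarrow> real) \<Rightarrow> bool" where
  "sub_additive_on n I V f \<longleftrightarrow>
     (\<forall>A \<in> V. \<forall>B \<in> V. elements_mat (A + B) \<subseteq> I \<longrightarrow>
        loewner_le n (map_mat f (A + B)) (map_mat f A + map_mat f B))"

text \<open>The value at \<open>0\<close> is \<open>0\<close> for every exponent, also for \<open>\<alpha> \<le> 0\<close>. Only nonnegative arguments
  of \<open>f_pow\<close> are relevant.\<close>

definition f_pow :: "real \<Rightarrow> real \<Rightarrow> real" where
  "f_pow \<alpha> x = (if x = 0 then 0 else x powr \<alpha>)"

definition phi_pow :: "real \<Rightarrow> real \<Rightarrow> real" where
  "phi_pow \<alpha> x = (if x = 0 then 0 else \<bar>x\<bar> powr \<alpha>)"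

definition psi_pow :: "real \<Rightarrow> real \<Rightarrow> real" where
  "psi_pow \<alpha> x = (if x = 0 then 0 else sgn x * \<bar>x\<bar> powr \<alpha>)"

text \<open>The first argument \<open>J\<close> is one of the five properties above.\<close>

definition H_f :: "(nat \<Rightarrow> real set \<Rightarrow> real mat set \<Rightarrow> (real \<Rightarrow> real) \<Rightarrow> bool) \<Rightarrow> nat \<Rightarrow> nat \<Rightarrow> real set"
  where "H_f J n k = {\<alpha>. J n {0..} (psd_rank n k {0..}) (f_pow \<alpha>)}"

definition H_phi :: "(nat \<Rightarrow> real set \<Rightarrow> real mat set \<Rightarrow> (real \<Rightarrow> real) \<Rightarrow> bool) \<Rightarrow> nat \<Rightarrow> nat \<Rightarrow> real set"
  where "H_phi J n k = {\<alpha>. J n UNIV (psd_rank n k UNIV) (phi_pow \<alpha>)}"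

definition H_psi :: "(nat \<Rightarrow> real set \<Rightarrow> real mat set \<Rightarrow> (real \<Rightarrow> real) \<Rightarrow> bool) \<Rightarrow> nat \<Rightarrow> nat \<Rightarrow> real set"
  where "H_psi J n k = {\<alpha>. J n UNIV (psd_rank n k UNIV) (psi_pow \<alpha>)}"

definition pos_ints :: "real set" where
  "pos_ints = {real m | m :: nat. m \<ge> 1}"

definition pos_evens :: "real set" where
  "pos_evens = {real m | m :: nat. m \<ge> 1 \<and> even m}"

definition pos_odds :: "real set" where
  "pos_odds = {real m | m :: nat. odd m}"

text \<open>Exponent \<open>0\<close> gives sub-additivity of \<open>f_pow\<close> and \<open>psi_pow\<close> on all \<open>2 \<times> 2\<close> positive
  semidefinite matrices, not only on those of rank at most \<open>1\<close>
  (\<open>zero_in_H_f_sub\<close>, \<open>zero_in_H_psi_sub\<close> below). Therefore the sets for \<open>n = k = 2\<close> are \<open>{0, 1}\<close>,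
  whereas the published theorem gives \<open>{1}\<close> there. For \<open>f_pow 0\<close> the reason is that
  \<open>f[A] + f[B] - f[A + B]\<close> is the Schur product of the \<open>0\<close>-\<open>1\<close> matrices \<open>f[A]\<close> and \<open>f[B]\<close>.\<close>

lemma quadratic_form_2:
  fixes M :: "real mat"
  assumes "M \<in> carrier_mat 2 2" "v \<in> carrier_vec 2" and s: "M $$ (1,0) = M $$ (0,1)"
  shows "v \<bullet> (M *\<^sub>v v) =
    M $$ (0,0) * (v $ 0)^2 + 2 * M $$ (0,1) * v $ 0 * v $ 1 + M $$ (1,1) * (v $ 1)^2"
proof -
  have 2: "{0..<2} = {0, 1::nat}" by auto
  have "v \<bullet> (M *\<^sub>v v) = v $ 0 * (M $$ (0,0) * v $ 0 + M $$ (0,1) * v $ 1) +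
    v $ 1 * (M $$ (1,0) * v $ 0 + M $$ (1,1) * v $ 1)"
    using assms(1,2) by (simp add: scalar_prod_def 2)
  then show ?thesis by (simp only: s) (simp add: power2_eq_square algebra_simps)
qed

lemma psd_2I:
  fixes M :: "real mat"
  assumes M: "M \<in> carrier_mat 2 2" and s: "M $$ (1,0) = M $$ (0,1)"
    and d: "M $$ (0,0) \<in> {0,1}" "M $$ (1,1) \<in> {0,1}" and b: "\<bar>M $$ (0,1)\<bar> \<le> 1"
    and z: "M $$ (0,1) \<noteq> 0 \<Longrightarrow> M $$ (0,0) = 1 \<and> M $$ (1,1) = 1"
  shows "M \<in> psd 2 UNIV"
proof -
  have sym: "transpose_mat M = M"
    using M s by (intro eq_matI) (auto simp: less_2_cases_iff)
  have "0 \<le> v \<bullet> (M *\<^sub>v v)" if v: "v \<in> carrier_vec 2" for v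
  proof -
    define x y p where "x = v $ 0" "y = v $ 1" "p = M $$ (0,1)"
    have e: "v \<bullet> (M *\<^sub>v v) = M $$ (0,0) * x^2 + 2 * p * x * y + M $$ (1,1) * y^2"
      unfolding x_y_p_def by (rule quadratic_form_2[OF M v s])
    show ?thesis
    proof (cases "p = 0")
      case True
      then show ?thesis using e d by auto
    next
      case False
      then have q: "M $$ (0,0) = 1" "M $$ (1,1) = 1" using z by (auto simp: x_y_p_def)
      have "\<bar>p\<bar> \<le> 1" using b by (simp add: x_y_p_def)
      then have "p^2 \<le> 1" by (simp add: abs_square_le_1)
      then have "0 \<le> (x + p * y)^2 + (1 - p^2) * y^2" by simp
      also have "\<dots> = x^2 + 2 * p * x * y + y^2" by (simp add: power2_eq_square algebra_simps)
      finally show ?thesis using e q by simp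
    qed
  qed
  with M sym show ?thesis by (auto simp: psd_def)
qed

lemma psd_2D:
  assumes "A \<in> psd 2 I"
  shows "A \<in> carrier_mat 2 2" "A $$ (1,0) = A $$ (0,1)" "A $$ (0,0) \<ge> 0" "A $$ (1,1) \<ge> 0"
    "A $$ (0,1) \<noteq> 0 \<Longrightarrow> A $$ (0,0) > 0 \<and> A $$ (1,1) > 0"
    "i < 2 \<Longrightarrow> j < 2 \<Longrightarrow> A $$ (i,j) \<in> I"
proof -
  show A: "A \<in> carrier_mat 2 2" using assms by (auto simp: psd_def)
  have "transpose_mat A = A" using assms by (auto simp: psd_def)
  then have "transpose_mat A $$ (1,0) = A $$ (1,0)" by simp
  then show s: "A $$ (1,0) = A $$ (0,1)" using A by simp
  have q: "0 \<le> A $$ (0,0) * x^2 + 2 * A $$ (0,1) * x * y + A $$ (1,1) * y^2" for x y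
  proof -
    define v where "v = vec 2 (\<lambda>i. if i = 0 then x else y :: real)"
    have v: "v \<in> carrier_vec 2" "v $ 0 = x" "v $ 1 = y" by (auto simp: v_def)
    have "0 \<le> v \<bullet> (A *\<^sub>v v)" using assms v(1) unfolding psd_def by blast
    then show ?thesis unfolding quadratic_form_2[OF A v(1) s] v(2,3) .
  qed
  show a: "A $$ (0,0) \<ge> 0" "A $$ (1,1) \<ge> 0" using q[of 1 0] q[of 0 1] by auto
  show "A $$ (0,0) > 0 \<and> A $$ (1,1) > 0" if b: "A $$ (0,1) \<noteq> 0"
  proof (rule ccontr)
    let ?b = "A $$ (0,1)" let ?c = "A $$ (0,0)" let ?d = "A $$ (1,1)"
    assume "\<not> (?c > 0 \<and> ?d > 0)"
    then consider "?c = 0" | "?d = 0" using a by linarith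
    then show False
    proof cases
      case 1
      have "2 * ?b * (-(?d + 1) / ?b) = - 2 * (?d + 1)" using b by simp
      then show False using q[of "-(?d + 1) / ?b" 1] 1 a by simp
    next
      case 2
      have "2 * ?b * (-(?c + 1) / ?b) = - 2 * (?c + 1)" using b by simp
      then show False using q[of 1 "-(?c + 1) / ?b"] 2 a by simp
    qed
  qed
  show "i < 2 \<Longrightarrow> j < 2 \<Longrightarrow> A $$ (i,j) \<in> I"
    using assms elements_matI[OF A, of i j] by (auto simp: psd_def)
qed

lemma sub_sgn_2:
  fixes g :: "real \<Rightarrow> real"
  assumes AB: "A \<in> psd 2 I" "B \<in> psd 2 I" "elements_mat (A + B) \<subseteq> I"
    and g: "\<And>x. x \<in> I \<Longrightarrow> g x = sgn x"
  shows "map_mat g A + map_mat g B - map_mat g (A + B) \<in> psd 2 UNIV" (is "?M \<in> _")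
proof -
  note A = psd_2D[OF AB(1)] and B = psd_2D[OF AB(2)]
  have M: "?M $$ (i,j) = sgn (A $$ (i,j)) + sgn (B $$ (i,j)) - sgn (A $$ (i,j) + B $$ (i,j))"
    if ij: "i < 2" "j < 2" for i j
  proof -
    have "(A + B) $$ (i,j) \<in> elements_mat (A + B)"
      using A(1) B(1) ij by (intro elements_matI[of _ 2 2 i j]) auto
    then have "A $$ (i,j) + B $$ (i,j) \<in> I" using A(1) B(1) AB(3) ij by auto
    then show ?thesis using A(1) B(1) A(6)[OF ij] B(6)[OF ij] ij by (simp add: g)
  qed
  show ?thesis
  proof (rule psd_2I)
    show "?M \<in> carrier_mat 2 2" using A(1) B(1) by (auto intro!: minus_carrier_mat)
    have lt: "(0::nat) < 2" "(1::nat) < 2" by simp_all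
    note M' = M[OF lt(1) lt(1)] M[OF lt(1) lt(2)] M[OF lt(2) lt(1)] M[OF lt(2) lt(2)]
    show "?M $$ (1,0) = ?M $$ (0,1)" unfolding M' A(2) B(2) ..
    show "?M $$ (0,0) \<in> {0,1}" "?M $$ (1,1) \<in> {0,1}"
      unfolding M' using A(3,4) B(3,4) by (auto simp: sgn_if)
    show "\<bar>?M $$ (0,1)\<bar> \<le> 1" unfolding M' by (auto simp: sgn_if)
    assume "?M $$ (0,1) \<noteq> 0"
    then have "A $$ (0,1) \<noteq> 0 \<and> B $$ (0,1) \<noteq> 0" unfolding M' by auto
    with A(5) B(5) show "?M $$ (0,0) = 1 \<and> ?M $$ (1,1) = 1" unfolding M' by (simp add: sgn_if)
  qed
qed

lemma zero_in_H_f_sub: "0 \<in> H_f sub_additive_on 2 k"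
  unfolding H_f_def sub_additive_on_def loewner_le_def psd_rank_def
  by (auto intro!: sub_sgn_2 simp: f_pow_def)

lemma zero_in_H_psi_sub: "0 \<in> H_psi sub_additive_on 2 k"
  unfolding H_psi_def sub_additive_on_def loewner_le_def psd_rank_def
  by (auto intro!: sub_sgn_2 simp: psi_pow_def)

end

theory Submission
  imports Defs "HOL-Analysis.Convex" "HOL-Computational_Algebra.Polynomial"
    "Jordan_Normal_Form.DL_Rank_Submatrix"
begin

text \<open>
  Sufficiency. The quadratic form of \<open>f[B + t C]\<close> has derivative the form of the Schur product
  \<open>C \<circ> f'[B + t C]\<close>. Hence positivity of \<open>f'\<close> gives monotonicity of \<open>f\<close>, and monotonicity of \<open>f'\<close>
  gives convexity and super-additivity of \<open>f\<close>. Positivity for exponents at least \<open>n - 2\<close> follows by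
  the FitzGerald--Horn induction, which treats \<open>\<phi>\<close> and \<open>\<psi>\<close> together since
  each is, up to the factor \<open>\<alpha>\<close>, the derivative of the other.

  Necessity. All thresholds reduce to super-additivity on rank-one matrices: positivity in dimension
  \<open>n + 2\<close> and monotonicity in dimension \<open>n + 1\<close> imply it in dimension \<open>n\<close> (a Schur complement, as the
  power functions are multiplicative), and convexity implies monotonicity of the derivative. Write
  \<open>1\<close> for the all-ones vector. For a non-integer exponent below \<open>n\<close> take
  \<open>1 1\<^sup>T + \<epsilon> u u\<^sup>T\<close> with \<open>u = (1, 2, 4, \<dots>)\<close> up to a scalar: if the weights are the
  coefficients of a polynomial with roots \<open>2, 4, \<dots>, 2 ^ m\<close>, all terms of the binomial expansion of
  order less than \<open>\<alpha>\<close> vanish and \<open>- \<epsilon> powr \<alpha>\<close> dominates. For an integer exponent \<open>m\<close> of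
  the wrong parity use the vectors \<open>(1, \<epsilon> (1 - i))\<close>, weighted by alternating binomial
  coefficients, and \<open>(- \<epsilon>, 1)\<close>: the only surviving cross term comes from the kink of the
  power function at \<open>0\<close>.
\<close>

subsection \<open>Quadratic forms\<close>

text \<open>The derivative argument gives nothing for sub-additivity. For nonnegative entries the
  exponents below 1 are tested by the expansion at \<open>1 1\<^sup>T\<close> again, but with
  weights that annihilate the term \<open>\<epsilon> powr \<alpha>\<close>, so that the first
  surviving binomial coefficient decides: order one excludes 0 < \<alpha> < 1, order two excludes
  negative exponents once three indices are available. The nonpositive exponents that survive for n
  = 2, k = 1 rest on a determinant inequality, namely log-convexity of t \<mapsto> 1 + z powr
  \<alpha> - (1 + z) powr \<alpha> at z = exp t.

  Comparable matrices of rank one are proportional and power functions are multiplicative, so for k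
  = 1 monotonicity and convexity are scalar inequalities.

  The kink at 0 shapes the rest. The derivative formula for \<open>spow\<close> is stated for
  exponents above 1; hence positivity and monotonicity are first shown strictly above their
  thresholds, and the end points follow by letting the exponent decrease. Convexity at exponent 1,
  where |x| has no derivative at 0, needs a test matrix of its own.\<close>

definition qform :: "nat \<Rightarrow> (nat \<Rightarrow> nat \<Rightarrow> real) \<Rightarrow> (nat \<Rightarrow> real) \<Rightarrow> real" where
  "qform n F v = (\<Sum>i<n. \<Sum>j<n. v i * v j * F i j)"

text \<open>Entries are a function of two indices rather than a matrix, so that a leading block
  keeps the same \<open>F\<close> with a smaller \<open>n\<close>, and entrywise operations are
  plain function application.\<close>

definition PSD :: "nat \<Rightarrow> (nat \<Rightarrow> nat \<Rightarrow> real) \<Rightarrow> bool" where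
  "PSD n F \<longleftrightarrow> (\<forall>i<n. \<forall>j<n. F i j = F j i) \<and> (\<forall>v. 0 \<le> qform n F v)"

lemma PSD_sym: "PSD n F \<Longrightarrow> i < n \<Longrightarrow> j < n \<Longrightarrow> F i j = F j i"
  and PSD_qform: "PSD n F \<Longrightarrow> 0 \<le> qform n F v"
  by (auto simp: PSD_def)

lemma qform_cong:
  assumes "\<And>i j. i < n \<Longrightarrow> j < n \<Longrightarrow> F i j = G i j" "\<And>i. i < n \<Longrightarrow> v i = w i"
  shows "qform n F v = qform n G w"
  unfolding qform_def by (intro sum.cong refl) (auto simp: assms)

lemma PSD_cong:
  assumes "PSD n F" "\<And>i j. i < n \<Longrightarrow> j < n \<Longrightarrow> F i j = G i j"
  shows "PSD n G"
  using assms qform_cong[of n F G] by (auto simp: PSD_def)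

lemma qform_add: "qform n (\<lambda>i j. F i j + G i j) v = qform n F v + qform n G v"
  by (simp add: qform_def sum.distrib distrib_left)

lemma qform_diff: "qform n (\<lambda>i j. F i j - G i j) v = qform n F v - qform n G v"
  by (simp add: qform_def sum_subtractf right_diff_distrib)

lemma qform_scale: "qform n (\<lambda>i j. c * F i j) v = c * qform n F v"
  by (simp add: qform_def sum_distrib_left mult_ac)

lemma qform_rank1: "qform n (\<lambda>i j. x i * x j) v = (\<Sum>i<n. v i * x i)^2"
  by (simp add: qform_def power2_eq_square sum_product mult_ac)

lemma qform_hadamard_rank1:
  "qform n (\<lambda>i j. x i * x j * F i j) v = qform n F (\<lambda>i. v i * x i)"
  by (simp add: qform_def mult_ac)

lemma qform_sum: "qform n (\<lambda>i j. \<Sum>k\<in>S. F k i j) v = (\<Sum>k\<in>S. qform n (F k) v)"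
proof -
  have "qform n (\<lambda>i j. \<Sum>k\<in>S. F k i j) v = (\<Sum>i<n. \<Sum>j<n. \<Sum>k\<in>S. v i * v j * F k i j)"
    by (simp add: qform_def sum_distrib_left)
  also have "\<dots> = (\<Sum>i<n. \<Sum>k\<in>S. \<Sum>j<n. v i * v j * F k i j)"
    by (intro sum.cong refl sum.swap)
  also have "\<dots> = (\<Sum>k\<in>S. \<Sum>i<n. \<Sum>j<n. v i * v j * F k i j)" by (rule sum.swap)
  finally show ?thesis by (simp add: qform_def)
qed

lemma qform_Suc:
  "qform (Suc n) F v =
    qform n F v + (\<Sum>i<n. v i * v n * (F i n + F n i)) + v n * v n * F n n"
proof -
  have "qform (Suc n) F v = (\<Sum>i<n. (\<Sum>j<n. v i * v j * F i j) + v i * v n * F i n)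
      + ((\<Sum>j<n. v n * v j * F n j) + v n * v n * F n n)"
    by (simp add: qform_def)
  also have "\<dots> = qform n F v + (\<Sum>i<n. v i * v n * (F i n + F n i)) + v n * v n * F n n"
    by (simp add: qform_def sum.distrib algebra_simps)
  finally show ?thesis .
qed

lemma PSD_add: "PSD n F \<Longrightarrow> PSD n G \<Longrightarrow> PSD n (\<lambda>i j. F i j + G i j)"
  by (auto simp: PSD_def qform_add)

lemma PSD_scale: "PSD n F \<Longrightarrow> 0 \<le> c \<Longrightarrow> PSD n (\<lambda>i j. c * F i j)"
  by (auto simp: PSD_def qform_scale)

lemma PSD_rank1: "PSD n (\<lambda>i j. x i * x j)"
  by (auto simp: PSD_def qform_rank1)

lemma PSD_zero: "PSD n (\<lambda>i j. 0)"
  using PSD_rank1[of n "\<lambda>_. 0"] by simp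

text \<open>The weights \<open>w\<close> are carried along \<open>h\<close> and extended by zero.
  Leading blocks, pairs of indices and diagonal entries below are all instances.\<close>

lemma PSD_embed:
  assumes "PSD n F" "finite S" "inj_on h S" "h ` S \<subseteq> {..<n}"
  shows "0 \<le> (\<Sum>i\<in>S. \<Sum>j\<in>S. w i * w j * F (h i) (h j))"
proof -
  define v where "v k = (if k \<in> h ` S then w (inv_into S h k) else 0)" for k
  have v: "v (h i) = w i" if "i \<in> S" for i using that assms(3) by (simp add: v_def)
  have s: "(\<Sum>j<n. v j * G j) = (\<Sum>j\<in>S. w j * G (h j))" for G :: "nat \<Rightarrow> real"
  proof -
    have "(\<Sum>j<n. v j * G j) = (\<Sum>j\<in>h ` S. v j * G j)"
      using assms(4) by (intro sum.mono_neutral_right) (auto simp: v_def)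
    also have "\<dots> = (\<Sum>j\<in>S. w j * G (h j))"
      using assms(3) by (simp add: sum.reindex v)
    finally show ?thesis .
  qed
  have "0 \<le> qform n F v" using assms(1) by (rule PSD_qform)
  also have "\<dots> = (\<Sum>i<n. v i * (\<Sum>j<n. v j * F i j))"
    by (simp add: qform_def sum_distrib_left mult_ac)
  also have "\<dots> = (\<Sum>i\<in>S. \<Sum>j\<in>S. w i * w j * F (h i) (h j))"
    unfolding s by (simp add: sum_distrib_left mult_ac)
  finally show ?thesis .
qed

lemma PSD_mono_dim:
  assumes "PSD n F" "m \<le> n" shows "PSD m F"
proof -
  have "0 \<le> qform m F v" for v
    using PSD_embed[OF assms(1), of "{..<m}" id v] assms(2) by (auto simp: qform_def)
  then show ?thesis using assms by (auto simp: PSD_def)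
qed

lemma PSD_pair:
  assumes "PSD n F" "p < n" "q < n" "p \<noteq> q"
  shows "0 \<le> F p p * x^2 + 2 * F p q * x * y + F q q * y^2"
proof -
  have "F q p = F p q" using assms PSD_sym by metis
  then show ?thesis
    using PSD_embed[OF assms(1), of "{p,q}" id "\<lambda>i. if i = p then x else y"] assms
    by (simp add: power2_eq_square algebra_simps)
qed

lemma PSD_diag: "PSD n F \<Longrightarrow> p < n \<Longrightarrow> 0 \<le> F p p"
  using PSD_embed[of n F "{p}" id "\<lambda>_. 1"] by simp

lemma quadratic_form_2_disc:
  fixes a b c :: real
  assumes "\<And>x y. 0 \<le> a * x^2 + 2 * b * x * y + c * y^2"
  shows "b^2 \<le> a * c"
proof -
  have a: "0 \<le> a" using assms[of 1 0] by simp
  show ?thesis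
  proof (cases "a = 0")
    case True
    \<comment> \<open>With \<open>a = 0\<close> the form is linear in \<open>x\<close>; at the point
      \<open>(- (c + 1), b)\<close> the linear term outweighs \<open>c * b^2\<close> unless
      \<open>b = 0\<close>.\<close>
    have "0 \<le> - (c + 2) * b^2" using assms[of "- (c + 1)" b] True
      by (simp add: power2_eq_square algebra_simps)
    moreover have "0 \<le> c" using assms[of 0 1] by simp
    ultimately have "b^2 \<le> 0" by (smt (verit) mult_minus_left mult_pos_pos zero_le_power2)
    then show ?thesis using True by simp
  next
    case False
    \<comment> \<open>The point \<open>(- b, a)\<close> is the minimiser in \<open>x\<close> for
      \<open>y = 1\<close>, scaled by \<open>a\<close> to avoid a division.\<close>
    have "0 \<le> a * (a * c - b^2)" using assms[of "-b" a]
      by (simp add: power2_eq_square algebra_simps)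
    then show ?thesis using a False by (simp add: zero_le_mult_iff)
  qed
qed

lemma PSD_2I:
  assumes "F 1 0 = F 0 1" "0 \<le> F 0 0" "0 \<le> F 1 1" "(F 0 1)^2 \<le> F 0 0 * F 1 1"
  shows "PSD 2 F"
  unfolding PSD_def
proof (intro conjI allI impI)
  fix v
  have q: "qform 2 F v = F 0 0 * (v 0)^2 + 2 * F 0 1 * v 0 * v 1 + F 1 1 * (v 1)^2"
    using assms(1) by (simp add: qform_def numeral_2_eq_2 power2_eq_square algebra_simps)
  show "0 \<le> qform 2 F v"
  proof (cases "F 0 0 = 0")
    case True
    then show ?thesis using assms q by simp
  next
    case False
    have "F 0 0 * qform 2 F v = (F 0 0 * v 0 + F 0 1 * v 1)^2 + (F 0 0 * F 1 1 - (F 0 1)^2) * (v 1)^2"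
      unfolding q by (simp add: power2_eq_square algebra_simps)
    then have "0 \<le> F 0 0 * qform 2 F v" using assms(4) by simp
    then show ?thesis using False assms(2) by (simp add: zero_le_mult_iff)
  qed
qed (use assms(1) in \<open>auto simp: less_2_cases_iff\<close>)

lemma PSD_entry_bound:
  assumes "PSD n F" "p < n" "q < n" shows "(F p q)^2 \<le> F p p * F q q"
proof (cases "p = q")
  case False
  then show ?thesis using quadratic_form_2_disc PSD_pair[OF assms] by blast
qed (simp add: power2_eq_square)

lemma PSD_zero_col: "PSD n F \<Longrightarrow> F q q = 0 \<Longrightarrow> p < n \<Longrightarrow> q < n \<Longrightarrow> F p q = 0"
  using PSD_entry_bound[of n F p q] by simp

section \<open>Schur complements, Gram decompositions and Schur products\<close>

lemma qform_shift:
  assumes "p < n" "\<And>i j. i < n \<Longrightarrow> j < n \<Longrightarrow> F i j = F j i"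
  shows "qform n F (\<lambda>i. v i + (if i = p then c else 0)) =
    qform n F v + 2 * c * (\<Sum>i<n. v i * F i p) + c^2 * F p p"
proof -
  let ?d = "\<lambda>i. if i = p then c else 0"
  have d: "(\<Sum>i<n. ?d i * g i) = c * g p" for g :: "nat \<Rightarrow> real"
  proof -
    have "(\<Sum>i<n. ?d i * g i) = (\<Sum>i<n. if i = p then c * g i else 0)"
      by (intro sum.cong) auto
    then show ?thesis using assms(1) by simp
  qed
  have "qform n F (\<lambda>i. v i + ?d i) = qform n F v + (\<Sum>i<n. v i * (\<Sum>j<n. ?d j * F i j))
     + (\<Sum>i<n. ?d i * (\<Sum>j<n. v j * F i j)) + (\<Sum>i<n. ?d i * (\<Sum>j<n. ?d j * F i j))"
    unfolding qform_def sum_distrib_left sum.distrib[symmetric]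
    by (intro sum.cong refl) (simp add: algebra_simps)
  also have "\<dots> = qform n F v + (\<Sum>i<n. v i * (c * F i p)) + c * (\<Sum>j<n. v j * F p j) + c * (c * F p p)"
    by (simp only: d)
  also have "(\<Sum>j<n. v j * F p j) = (\<Sum>j<n. v j * F j p)"
    using assms by (intro sum.cong) auto
  finally show ?thesis by (simp add: sum_distrib_left power2_eq_square mult_ac)
qed

text \<open>Completing the square: the form of the difference at \<open>v\<close> is the minimum of
  the form of \<open>F\<close> over all changes of the coordinate \<open>p\<close> of
  \<open>v\<close>.\<close>

lemma PSD_schur_complement:
  assumes "PSD n F" "p < n" "F p p > 0"
  shows "PSD n (\<lambda>i j. F i j - (F i p / sqrt (F p p)) * (F j p / sqrt (F p p)))"
proof -
  let ?G = "\<lambda>i j. F i j - (F i p / sqrt (F p p)) * (F j p / sqrt (F p p))"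
  have "0 \<le> qform n ?G v" for v
  proof -
    let ?L = "\<Sum>i<n. v i * F i p"
    have "(\<Sum>i<n. v i * (F i p / sqrt (F p p))) = ?L / sqrt (F p p)"
      by (simp add: sum_divide_distrib)
    then have "qform n ?G v = qform n F v - (?L / sqrt (F p p))^2"
      by (simp only: qform_diff qform_rank1)
    also have "\<dots> = qform n F (\<lambda>i. v i + (if i = p then - ?L / F p p else 0))"
      using assms(3) by (subst qform_shift[OF assms(2) PSD_sym[OF assms(1)]])
        (simp_all add: power_divide power2_eq_square)
    finally show ?thesis using PSD_qform[OF assms(1)] by simp
  qed
  moreover have "?G i j = ?G j i" if "i < n" "j < n" for i j
    using PSD_sym[OF assms(1) that] by simp
  ultimately show ?thesis by (auto simp: PSD_def)
qed

text \<open>Peeling off the rank-one matrix through the last column leaves zeros in row and column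
  \<open>n\<close>, so the remainder is a form in dimension \<open>n\<close>. A zero pivot forces
  its whole column to vanish, which is why \<open>x\<close> may be 0 there.\<close>

lemma PSD_gram:
  assumes "PSD n F"
  shows "\<exists>(m::nat) z. \<forall>i<n. \<forall>j<n. F i j = (\<Sum>k<m. z k i * z k j)"
  using assms
proof (induction n arbitrary: F)
  case 0
  then show ?case by auto
next
  case (Suc n)
  define x where "x i = (if F n n = 0 then 0 else F i n / sqrt (F n n))" for i
  define G where "G i j = F i j - x i * x j" for i j
  have nn: "0 \<le> F n n" using PSD_diag[OF Suc.prems] by simp
  have G: "PSD (Suc n) G"
  proof (cases "F n n = 0")
    case True
    then show ?thesis by (intro PSD_cong[OF Suc.prems]) (simp add: G_def x_def)
  next
    case False
    then show ?thesis using nn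
      by (intro PSD_cong[OF PSD_schur_complement[OF Suc.prems, of n]]) (auto simp: G_def x_def)
  qed
  have Gn: "G i n = 0" if "i \<le> n" for i
    using PSD_zero_col[OF Suc.prems, of n i] nn that by (auto simp: G_def x_def)
  have Gn': "G n i = 0" if "i \<le> n" for i
    using PSD_sym[OF G, of i n] Gn[OF that] that by simp
  obtain m :: nat and z where z: "\<forall>i<n. \<forall>j<n. G i j = (\<Sum>k<m. z k i * z k j)"
    using Suc.IH[OF PSD_mono_dim[OF G]] by auto
  define y where "y k i = (if k = m then x i else if i < n then z k i else 0)" for k i
  have "F i j = (\<Sum>k<Suc m. y k i * y k j)" if "i < Suc n" "j < Suc n" for i j
  proof -
    have "(\<Sum>k<m. y k i * y k j) = G i j"
      using z Gn[of i] Gn'[of j] that by (cases "i = n"; cases "j = n") (auto simp: y_def)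
    then show ?thesis by (simp add: G_def y_def)
  qed
  then show ?case by blast
qed

text \<open>Schur product theorem. Writing one factor as a sum of rank-one matrices turns the form
  of the product into a sum of forms of \<open>G\<close> at the rescaled weights
  \<open>v i * z k i\<close>.\<close>

lemma PSD_hadamard:
  assumes "PSD n F" "PSD n G" shows "PSD n (\<lambda>i j. F i j * G i j)"
proof -
  obtain m :: nat and z where z: "\<forall>i<n. \<forall>j<n. F i j = (\<Sum>k<m. z k i * z k j)"
    using PSD_gram[OF assms(1)] by blast
  have "qform n (\<lambda>i j. F i j * G i j) v = qform n (\<lambda>i j. \<Sum>k<m. z k i * z k j * G i j) v" for v
    by (intro qform_cong) (auto simp: z sum_distrib_right)
  then show ?thesis using assms
    by (auto simp: PSD_def qform_sum qform_hadamard_rank1 intro!: sum_nonneg)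
qed

section \<open>Loewner properties passed from a derivative to its primitive\<close>

definition POS :: "nat \<Rightarrow> (real \<Rightarrow> real) \<Rightarrow> bool" where
  "POS n g \<longleftrightarrow> (\<forall>F. PSD n F \<longrightarrow> PSD n (\<lambda>i j. g (F i j)))"

definition MONO :: "nat \<Rightarrow> (real \<Rightarrow> real) \<Rightarrow> bool" where
  "MONO n g \<longleftrightarrow> (\<forall>F G. PSD n F \<longrightarrow> PSD n (\<lambda>i j. G i j - F i j) \<longrightarrow>
     PSD n (\<lambda>i j. g (G i j) - g (F i j)))"

definition CONV :: "nat \<Rightarrow> (real \<Rightarrow> real) \<Rightarrow> bool" where
  "CONV n g \<longleftrightarrow> (\<forall>F G l. PSD n F \<longrightarrow> PSD n (\<lambda>i j. G i j - F i j) \<longrightarrow> 0 \<le> l \<longrightarrow> l \<le> 1 \<longrightarrow>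
     PSD n (\<lambda>i j. l * g (G i j) + (1 - l) * g (F i j) - g (l * G i j + (1 - l) * F i j)))"

definition SUPER :: "nat \<Rightarrow> (real \<Rightarrow> real) \<Rightarrow> bool" where
  "SUPER n g \<longleftrightarrow> (\<forall>F G. PSD n F \<longrightarrow> PSD n G \<longrightarrow>
     PSD n (\<lambda>i j. g (F i j + G i j) - (g (F i j) + g (G i j))))"

lemma DERIV_qform:
  assumes "\<And>i j. i < n \<Longrightarrow> j < n \<Longrightarrow> ((\<lambda>t. F t i j) has_real_derivative D i j) (at t)"
  shows "((\<lambda>t. qform n (F t) v) has_real_derivative qform n D v) (at t)"
  unfolding qform_def by (intro DERIV_sum DERIV_cmult) (auto intro: assms)

lemma qform_nondecreasing:
  fixes a b :: real
  assumes "a \<le> b"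
    and "\<And>t i j. i < n \<Longrightarrow> j < n \<Longrightarrow> ((\<lambda>t. F t i j) has_real_derivative D t i j) (at t)"
    and "\<And>t. a \<le> t \<Longrightarrow> t \<le> b \<Longrightarrow> 0 \<le> qform n (D t) v"
  shows "qform n (F a) v \<le> qform n (F b) v"
  using assms DERIV_qform[of n F "D _" _ v]
  by (intro DERIV_nonneg_imp_nondecreasing[of a b "\<lambda>t. qform n (F t) v"]) blast+

lemma MONO_deriv:
  assumes d: "\<And>x. (g has_real_derivative g' x) (at x)" and pos: "POS n g'"
  shows "MONO n g"
  unfolding MONO_def
proof (intro allI impI)
  fix F G assume F: "PSD n F" and D: "PSD n (\<lambda>i j. G i j - F i j)"
  let ?H = "\<lambda>t i j. F i j + t * (G i j - F i j)"
  have "0 \<le> qform n (\<lambda>i j. g (G i j) - g (F i j)) v" for v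
  proof -
    have "qform n (\<lambda>i j. g (?H 0 i j)) v \<le> qform n (\<lambda>i j. g (?H 1 i j)) v"
    proof (rule qform_nondecreasing)
      show "((\<lambda>t. g (?H t i j)) has_real_derivative (G i j - F i j) * g' (?H t i j)) (at t)" for t i j
        by (rule DERIV_cong[OF DERIV_chain2[OF d]]) (auto intro!: derivative_eq_intros)
      fix t :: real assume t: "0 \<le> t"
      have "PSD n (?H t)" by (intro PSD_add F PSD_scale D t)
      then have "PSD n (\<lambda>i j. g' (?H t i j))" using pos by (auto simp: POS_def)
      then show "0 \<le> qform n (\<lambda>i j. (G i j - F i j) * g' (?H t i j)) v"
        using D by (intro PSD_qform PSD_hadamard)
    qed simp
    then show ?thesis by (simp add: qform_diff)
  qed
  moreover have "g (G i j) - g (F i j) = g (G j i) - g (F j i)" if "i < n" "j < n" for i j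
    using PSD_sym[OF F that] PSD_sym[OF D that] by simp
  ultimately show "PSD n (\<lambda>i j. g (G i j) - g (F i j))" by (auto simp: PSD_def)
qed

lemma SUPER_deriv:
  assumes d: "\<And>x. (g has_real_derivative g' x) (at x)" and mono: "MONO n g'" and g0: "g 0 = 0"
  shows "SUPER n g"
  unfolding SUPER_def
proof (intro allI impI)
  fix F G assume F: "PSD n F" and G: "PSD n G"
  let ?H = "\<lambda>t i j. F i j + t * G i j"
  have "0 \<le> qform n (\<lambda>i j. g (F i j + G i j) - (g (F i j) + g (G i j))) v" for v
  proof -
    \<comment> \<open>Subtracting \<open>g (t * G i j)\<close> makes the derivative a Schur product
      of \<open>G\<close> with a difference of values of \<open>g'\<close>, to which monotonicity
      applies. The left end is the form of \<open>g[F]\<close> because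
      \<open>g 0 = 0\<close>.\<close>
    have "qform n (\<lambda>i j. g (F i j + 0 * G i j) - g (0 * G i j)) v \<le>
      qform n (\<lambda>i j. g (F i j + 1 * G i j) - g (1 * G i j)) v"
    proof (rule qform_nondecreasing)
      show "((\<lambda>t. g (F i j + t * G i j) - g (t * G i j)) has_real_derivative
        G i j * (g' (F i j + t * G i j) - g' (t * G i j))) (at t)" for t i j
        by (rule DERIV_cong[OF DERIV_diff[OF DERIV_chain2[OF d] DERIV_chain2[OF d]]])
          (auto intro!: derivative_eq_intros simp: algebra_simps)
      fix t :: real assume t: "0 \<le> t"
      have "PSD n (\<lambda>i j. g' (F i j + t * G i j) - g' (t * G i j))"
        using mono PSD_scale[OF G t] F unfolding MONO_def
        by (auto dest!: spec[of _ "\<lambda>i j. t * G i j"] spec[of _ "\<lambda>i j. F i j + t * G i j"])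
      then show "0 \<le> qform n (\<lambda>i j. G i j * (g' (F i j + t * G i j) - g' (t * G i j))) v"
        using G by (intro PSD_qform PSD_hadamard)
    qed simp
    then show ?thesis by (simp add: g0 qform_diff qform_add)
  qed
  moreover have "g (F i j + G i j) - (g (F i j) + g (G i j)) = g (F j i + G j i) - (g (F j i) + g (G j i))"
    if "i < n" "j < n" for i j
    using PSD_sym[OF F that] PSD_sym[OF G that] by simp
  ultimately show "PSD n (\<lambda>i j. g (F i j + G i j) - (g (F i j) + g (G i j)))" by (auto simp: PSD_def)
qed

text \<open>For fixed weights the form along the segment from \<open>F\<close> to \<open>G\<close>
  is a convex function of one variable: later points of the segment exceed earlier ones by a
  nonnegative multiple of \<open>G - F\<close>, so the derivative grows by the form of a Schur
  product.\<close>

lemma CONV_deriv: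
  assumes d: "\<And>x. (g has_real_derivative g' x) (at x)" and mono: "MONO n g'"
  shows "CONV n g"
  unfolding CONV_def
proof (intro allI impI)
  fix F G and l :: real
  assume F: "PSD n F" and D: "PSD n (\<lambda>i j. G i j - F i j)" and l: "0 \<le> l" "l \<le> 1"
  let ?H = "\<lambda>t i j. F i j + t * (G i j - F i j)"
  let ?Q = "\<lambda>i j. l * g (G i j) + (1 - l) * g (F i j) - g (l * G i j + (1 - l) * F i j)"
  have "0 \<le> qform n ?Q v" for v
  proof -
    let ?D = "\<lambda>t i j. (G i j - F i j) * g' (?H t i j)"
    have der: "((\<lambda>t. qform n (\<lambda>i j. g (?H t i j)) v) has_real_derivative qform n (?D t) v) (at t)" for t
      by (intro DERIV_qform DERIV_cong[OF DERIV_chain2[OF d]]) (auto intro!: derivative_eq_intros)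
    have "convex_on {0..1} (\<lambda>t. qform n (\<lambda>i j. g (?H t i j)) v)"
    proof (rule convex_on_realI)
      fix s t :: real assume st: "s \<in> {0..1}" "t \<in> {0..1}" "s \<le> t"
      have s: "PSD n (?H s)" using st by (intro PSD_add F PSD_scale D) auto
      have t: "PSD n (\<lambda>i j. ?H t i j - ?H s i j)"
        by (rule PSD_cong[OF PSD_scale[OF D, of "t - s"]]) (use st in \<open>auto simp: algebra_simps\<close>)
      have "PSD n (\<lambda>i j. g' (?H t i j) - g' (?H s i j))"
        using mono s t unfolding MONO_def by (auto dest!: spec[of _ "?H s"] spec[of _ "?H t"])
      from PSD_qform[OF PSD_hadamard[OF D this], of v]
      have "0 \<le> qform n (\<lambda>i j. ?D t i j - ?D s i j) v" by (simp add: right_diff_distrib)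
      then show "qform n (?D s) v \<le> qform n (?D t) v" by (simp only: qform_diff)
    qed (use der in auto)
    from convex_onD[OF this, of l 0 1] l
    have "qform n (\<lambda>i j. g (?H l i j)) v \<le>
       (1 - l) * qform n (\<lambda>i j. g (F i j)) v + l * qform n (\<lambda>i j. g (G i j)) v" by simp
    moreover have "?H l i j = l * G i j + (1 - l) * F i j" for i j by (simp add: algebra_simps)
    ultimately show ?thesis by (simp add: qform_diff qform_add qform_scale)
  qed
  moreover have "?Q i j = ?Q j i" if "i < n" "j < n" for i j
    using PSD_sym[OF F that] PSD_sym[OF D that] by simp
  ultimately show "PSD n ?Q" by (auto simp: PSD_def)
qed

subsection \<open>Power functions on positive semidefinite matrices\<close>

text \<open>The sign is a parameter because differentiation toggles it, and the induction on the
  dimension needs both extensions at once.\<close>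

definition spow :: "bool \<Rightarrow> real \<Rightarrow> real \<Rightarrow> real" where
  "spow s \<alpha> x = (if x = 0 then 0 else (if s then sgn x else 1) * \<bar>x\<bar> powr \<alpha>)"

lemma spow_phi: "phi_pow \<alpha> = spow False \<alpha>"
  and spow_psi: "psi_pow \<alpha> = spow True \<alpha>"
  by (auto simp: spow_def phi_pow_def psi_pow_def fun_eq_iff)

lemma spow_f: "0 \<le> x \<Longrightarrow> f_pow \<alpha> x = spow s \<alpha> x"
  by (auto simp: spow_def f_pow_def)

lemma spow_0 [simp]: "spow s \<alpha> 0 = 0" and spow_1 [simp]: "spow s \<alpha> 1 = 1"
  by (auto simp: spow_def)

lemma spow_pos: "0 < x \<Longrightarrow> spow s \<alpha> x = x powr \<alpha>"
  by (simp add: spow_def)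

lemma spow_nonneg: "0 \<le> x \<Longrightarrow> 0 \<le> spow s \<alpha> x"
  by (simp add: spow_def)

lemma spow_mult: "spow s \<alpha> (x * y) = spow s \<alpha> x * spow s \<alpha> y"
  by (simp add: spow_def sgn_mult abs_mult powr_mult)

lemma abs_spow_le: "\<bar>spow s \<alpha> x\<bar> \<le> \<bar>x\<bar> powr \<alpha>"
  by (simp add: spow_def abs_mult sgn_if)

lemma spow_nat_phi: "even m \<Longrightarrow> 1 \<le> m \<Longrightarrow> spow False (real m) x = x ^ m"
  by (auto simp: spow_def powr_realpow power_even_abs)

lemma spow_nat_psi:
  assumes "odd m" shows "spow True (real m) x = x ^ m"
proof -
  have "m > 0" using assms by (cases m) auto
  then show ?thesis using assms
    by (cases "x < 0") (auto simp: spow_def powr_realpow power_minus_odd)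
qed

lemma spow_nat_nonneg: "1 \<le> m \<Longrightarrow> 0 \<le> x \<Longrightarrow> spow s (real m) x = x ^ m"
  by (auto simp: spow_def powr_realpow)

lemma DERIV_spow:
  assumes "1 < \<alpha>"
  shows "(spow s \<alpha> has_real_derivative \<alpha> * spow (\<not> s) (\<alpha> - 1) x) (at x)"
proof (cases "x = 0")
  case False
  define c where "c = (if s then sgn x else 1)"
  \<comment> \<open>The sign is locally constant away from 0, so near \<open>x\<close> the function
    is a constant times a power of the positive quantity \<open>sgn x * y\<close>.\<close>
  have ev: "\<forall>\<^sub>F y in nhds x. sgn y = sgn x \<and> y \<noteq> 0"
  proof (cases "x > 0")
    case True
    then show ?thesis using eventually_nhds_in_open[of "{0<..}" x] by (auto elim: eventually_mono)
  next
    case neg: False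
    with False have "x < 0" by simp
    then show ?thesis using eventually_nhds_in_open[of "{..<0}" x] by (auto elim: eventually_mono)
  qed
  have "((\<lambda>y. c * (sgn x * y) powr \<alpha>) has_real_derivative
      c * (\<alpha> * (sgn x * x) powr (\<alpha> - 1) * sgn x)) (at x)"
    using False by (auto intro!: derivative_eq_intros simp: sgn_if split: if_splits)
  moreover have "c * (\<alpha> * (sgn x * x) powr (\<alpha> - 1) * sgn x) = \<alpha> * spow (\<not> s) (\<alpha> - 1) x"
    using False by (auto simp: c_def spow_def sgn_if)
  moreover have "\<forall>\<^sub>F y in nhds x. spow s \<alpha> y = c * (sgn x * y) powr \<alpha>"
    using ev by eventually_elim (auto simp: spow_def c_def sgn_if split: if_splits)
  ultimately show ?thesis by (subst DERIV_cong_ev[OF refl _ refl]) auto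
next
  case True
  \<comment> \<open>At 0 this power bounds the difference quotient, and it tends to 0 because
    \<open>1 < \<alpha>\<close>.\<close>
  have "((\<lambda>h::real. \<bar>h\<bar> powr (\<alpha> - 1)) \<longlongrightarrow> \<bar>0\<bar> powr (\<alpha> - 1)) (at 0)"
    using assms by (intro tendsto_powr' tendsto_intros) auto
  then have lim: "((\<lambda>h::real. \<bar>h\<bar> powr (\<alpha> - 1)) \<longlongrightarrow> 0) (at 0)" by simp
  have "((\<lambda>h. (spow s \<alpha> (0 + h) - spow s \<alpha> 0) / h) \<longlongrightarrow> 0) (at 0)"
  proof (rule tendsto_0_le[OF lim, of _ 1])
    have "norm ((spow s \<alpha> (0 + h) - spow s \<alpha> 0) / h) \<le> \<bar>h\<bar> powr (\<alpha> - 1)" if "h \<noteq> 0" for h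
      using that abs_spow_le[of s \<alpha> h] by (simp add: powr_diff divide_right_mono)
    then show "\<forall>\<^sub>F h in at 0. norm ((spow s \<alpha> (0 + h) - spow s \<alpha> 0) / h) \<le> norm (\<bar>h\<bar> powr (\<alpha> - 1)) * 1"
      by (auto simp: eventually_at_filter)
  qed
  then show ?thesis using True by (simp add: DERIV_def)
qed

lemma POS_scale: "POS n g \<Longrightarrow> 0 \<le> c \<Longrightarrow> POS n (\<lambda>x. c * g x)"
  unfolding POS_def using PSD_scale by blast

lemma MONO_scale:
  assumes "MONO n g" "0 \<le> c" shows "MONO n (\<lambda>x. c * g x)"
proof -
  have "PSD n (\<lambda>i j. c * (g (G i j) - g (F i j)))"
    if "PSD n F" "PSD n (\<lambda>i j. G i j - F i j)" for F G
    using assms that by (intro PSD_scale) (auto simp: MONO_def)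
  then show ?thesis by (auto simp: MONO_def right_diff_distrib)
qed

text \<open>Semidefiniteness is closed under entrywise limits. This supplies the exponents at the
  thresholds, where the derivative arguments ask for a strict inequality.\<close>

lemma PSD_at_right:
  assumes "\<And>\<beta>. \<alpha> < \<beta> \<Longrightarrow> PSD n (F \<beta>)"
    and "\<And>i j. i < n \<Longrightarrow> j < n \<Longrightarrow> ((\<lambda>\<beta>. F \<beta> i j) \<longlongrightarrow> F \<alpha> i j) (at_right (\<alpha>::real))"
  shows "PSD n (F \<alpha>)"
  unfolding PSD_def
proof (intro conjI allI impI)
  have ev: "\<forall>\<^sub>F \<beta> in at_right \<alpha>. PSD n (F \<beta>)"
    using assms(1) by (auto simp: eventually_at_right_less eventually_at_filter)
  fix v
  have "((\<lambda>\<beta>. qform n (F \<beta>) v) \<longlongrightarrow> qform n (F \<alpha>) v) (at_right \<alpha>)"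
    unfolding qform_def by (intro tendsto_sum tendsto_mult tendsto_const assms(2)) auto
  then show "0 \<le> qform n (F \<alpha>) v"
    by (rule tendsto_lowerbound) (use ev in \<open>auto elim!: eventually_mono simp: PSD_def\<close>)
next
  fix i j assume ij: "i < n" "j < n"
  have ev: "\<forall>\<^sub>F \<beta> in at_right \<alpha>. F \<beta> i j = F \<beta> j i"
    using assms(1) ij by (auto simp: eventually_at_filter PSD_def)
  show "F \<alpha> i j = F \<alpha> j i"
    by (rule tendsto_unique[OF trivial_limit_at_right_real
          Lim_transform_eventually[OF assms(2)[OF ij] ev] assms(2)[OF ij(2,1)]])
qed

lemma tendsto_spow_exponent: "((\<lambda>\<beta>. spow s \<beta> x) \<longlongrightarrow> spow s \<alpha> x) (at_right \<alpha>)"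
proof (cases "x = 0")
  case False
  have "((\<lambda>\<beta>. \<beta>) \<longlongrightarrow> \<alpha>) (at_right \<alpha>)" by (rule tendsto_ident_at)
  then have "((\<lambda>\<beta>. \<bar>x\<bar> powr \<beta>) \<longlongrightarrow> \<bar>x\<bar> powr \<alpha>) (at_right \<alpha>)"
    using False by (intro tendsto_powr tendsto_const) auto
  then have "((\<lambda>\<beta>. (if s then sgn x else 1) * \<bar>x\<bar> powr \<beta>) \<longlongrightarrow>
      (if s then sgn x else 1) * \<bar>x\<bar> powr \<alpha>) (at_right \<alpha>)"
    by (intro tendsto_mult tendsto_const)
  with False show ?thesis by (simp add: spow_def)
qed simp

lemma POS_at_right:
  assumes "\<And>\<beta>. \<alpha> < \<beta> \<Longrightarrow> POS n (spow s \<beta>)" shows "POS n (spow s \<alpha>)"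
  unfolding POS_def
proof (intro allI impI)
  fix F assume F: "PSD n F"
  have *: "PSD n (\<lambda>i j. spow s \<beta> (F i j))" if "\<alpha> < \<beta>" for \<beta>
    using assms[OF that] F unfolding POS_def by blast
  show "PSD n (\<lambda>i j. spow s \<alpha> (F i j))"
    by (rule PSD_at_right, rule *, assumption) (intro tendsto_spow_exponent)
qed

lemma MONO_at_right:
  assumes "\<And>\<beta>. \<alpha> < \<beta> \<Longrightarrow> MONO n (spow s \<beta>)" shows "MONO n (spow s \<alpha>)"
  unfolding MONO_def
proof (intro allI impI)
  fix F G assume FG: "PSD n F" "PSD n (\<lambda>i j. G i j - F i j)"
  have *: "PSD n (\<lambda>i j. spow s \<beta> (G i j) - spow s \<beta> (F i j))" if "\<alpha> < \<beta>" for \<beta>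
    using assms[OF that] FG unfolding MONO_def by blast
  show "PSD n (\<lambda>i j. spow s \<alpha> (G i j) - spow s \<alpha> (F i j))"
    by (rule PSD_at_right, rule *, assumption) (intro tendsto_diff tendsto_spow_exponent)
qed

text \<open>Only the determinant matters, and \<open>spow\<close> is multiplicative:
  \<open>(F 0 1)^2 \<le> F 0 0 * F 1 1\<close> survives being raised to a nonnegative power. The
  induction on the dimension starts here, with threshold 2 - 2 = 0.\<close>

lemma POS_spow_2:
  assumes "0 \<le> \<alpha>" shows "POS 2 (spow s \<alpha>)"
  unfolding POS_def
proof (intro allI impI)
  fix F assume F: "PSD 2 F"
  let ?a = "spow s \<alpha> (F 0 0)" and ?b = "spow s \<alpha> (F 0 1)" and ?c = "spow s \<alpha> (F 1 1)"
  have d: "0 \<le> F 0 0" "0 \<le> F 1 1" using PSD_diag[OF F] by auto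
  then have ac: "0 \<le> ?a" "0 \<le> ?c" by (auto intro: spow_nonneg)
  have sym: "F 1 0 = F 0 1" using PSD_sym[OF F] by simp
  have e: "(F 0 1)^2 \<le> F 0 0 * F 1 1" using PSD_entry_bound[OF F, of 0 1] by simp
  have bd: "?b^2 \<le> ?a * ?c"
  proof (cases "F 0 1 = 0")
    case False
    then have p: "0 < (F 0 1)^2" by simp
    have "?b^2 = spow s \<alpha> ((F 0 1)^2)" by (simp add: spow_mult power2_eq_square)
    also have "\<dots> = ((F 0 1)^2) powr \<alpha>" using p by (rule spow_pos)
    also have "\<dots> \<le> (F 0 0 * F 1 1) powr \<alpha>" using e assms by (intro powr_mono2) auto
    also have "\<dots> = ?a * ?c"
      using less_le_trans[OF p e] by (simp only: spow_mult[symmetric] spow_pos)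
    finally show ?thesis .
  qed (use ac in simp)
  show "PSD 2 (\<lambda>i j. spow s \<alpha> (F i j))"
    by (rule PSD_2I) (use ac bd sym in simp_all)
qed

lemma qform_last_zero:
  assumes "\<And>i. i \<le> n \<Longrightarrow> F i n = 0" "\<And>i. i \<le> n \<Longrightarrow> F n i = 0"
  shows "qform (Suc n) F v = qform n F v"
  using assms by (simp add: qform_Suc)

text \<open>The FitzGerald--Horn induction: subtracting the rank-one matrix through the last column leaves
  a direction matrix supported on the first \<open>n\<close> indices, so only positivity of the
  derivative in dimension \<open>n\<close> enters.\<close>

lemma POS_spow:
  assumes "real n - 2 \<le> \<alpha>" "2 \<le> n" shows "POS n (spow s \<alpha>)"
  using assms(2,1)
proof (induction n arbitrary: s \<alpha> rule: dec_induct)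
  case base
  then show ?case by (intro POS_spow_2) simp
next
  case (step n)
  \<comment> \<open>Strictness gives \<open>1 < \<beta>\<close> even for \<open>n = 2\<close>, as
    \<open>DERIV_spow\<close> demands. The threshold itself is recovered by
    \<open>POS_at_right\<close>.\<close>
  have pos: "POS (Suc n) (spow s \<beta>)" if \<beta>: "real n - 1 < \<beta>" for \<beta>
    unfolding POS_def
  proof (intro allI impI)
    fix F assume F: "PSD (Suc n) F"
    let ?g = "spow s \<beta>"
    define x where "x i = (if F n n = 0 then 0 else F i n / sqrt (F n n))" for i
    define C where "C i j = F i j - x i * x j" for i j
    have nn: "0 \<le> F n n" using PSD_diag[OF F] by simp
    have C: "PSD (Suc n) C"
    proof (cases "F n n = 0")
      case True
      then show ?thesis by (intro PSD_cong[OF F]) (simp add: C_def x_def)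
    next
      case False
      then show ?thesis using nn
        by (intro PSD_cong[OF PSD_schur_complement[OF F, of n]]) (auto simp: C_def x_def)
    qed
    have Cn: "C i n = 0" if "i \<le> n" for i
      using PSD_zero_col[OF F, of n i] nn that by (auto simp: C_def x_def)
    have Cn': "C n i = 0" if "i \<le> n" for i
      using PSD_sym[OF C, of i n] Cn[OF that] that by simp
    let ?H = "\<lambda>t i j. x i * x j + t * C i j"
    have "0 \<le> qform (Suc n) (\<lambda>i j. ?g (F i j)) v" for v
    proof -
      have "qform (Suc n) (\<lambda>i j. ?g (?H 0 i j)) v = (\<Sum>i<Suc n. v i * ?g (x i))^2"
        by (simp only: spow_mult qform_rank1 mult_zero_left add_0_right)
      then have "0 \<le> qform (Suc n) (\<lambda>i j. ?g (?H 0 i j)) v" by (simp only: zero_le_power2)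
      also have "\<dots> \<le> qform (Suc n) (\<lambda>i j. ?g (?H 1 i j)) v"
      proof (rule qform_nondecreasing)
        show "((\<lambda>t. ?g (?H t i j)) has_real_derivative C i j * (\<beta> * spow (\<not> s) (\<beta> - 1) (?H t i j))) (at t)" for t i j
        proof -
          have "1 < \<beta>" using \<beta> step.hyps by simp
          moreover have "((\<lambda>t. ?H t i j) has_real_derivative C i j) (at t)"
            by (auto intro!: derivative_eq_intros)
          ultimately show ?thesis
            using DERIV_chain2[OF DERIV_spow] by (simp add: mult.commute)
        qed
        fix t :: real assume t: "0 \<le> t"
        \<comment> \<open>One dimension less meets one exponent less: \<open>\<beta> - 1\<close>
          stays above \<open>n - 2\<close>, now for the toggled sign.\<close>
        have "POS n (\<lambda>x. \<beta> * spow (\<not> s) (\<beta> - 1) x)"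
          by (rule POS_scale[OF step.IH]) (use \<beta> step.hyps in auto)
        moreover have "PSD n (?H t)"
          using PSD_mono_dim[OF C, of n] t by (intro PSD_add PSD_rank1 PSD_scale) auto
        ultimately have "PSD n (\<lambda>i j. \<beta> * spow (\<not> s) (\<beta> - 1) (?H t i j))" by (auto simp: POS_def)
        then have "0 \<le> qform n (\<lambda>i j. C i j * (\<beta> * spow (\<not> s) (\<beta> - 1) (?H t i j))) v"
          using PSD_mono_dim[OF C, of n] by (intro PSD_qform PSD_hadamard[of n C]) auto
        then show "0 \<le> qform (Suc n) (\<lambda>i j. C i j * (\<beta> * spow (\<not> s) (\<beta> - 1) (?H t i j))) v"
          by (subst qform_last_zero) (auto simp: Cn Cn')
      qed simp
      finally show ?thesis by (simp add: C_def)
    qed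
    moreover have "?g (F i j) = ?g (F j i)" if "i < Suc n" "j < Suc n" for i j
      using PSD_sym[OF F that] by simp
    ultimately show "PSD (Suc n) (\<lambda>i j. ?g (F i j))" unfolding PSD_def by blast
  qed
  show ?case by (rule POS_at_right, rule pos) (use step.prems in auto)
qed

lemma MONO_spow:
  assumes "real n - 1 \<le> \<alpha>" "2 \<le> n" shows "MONO n (spow s \<alpha>)"
proof (rule MONO_at_right)
  fix \<beta> assume \<beta>: "\<alpha> < \<beta>"
  show "MONO n (spow s \<beta>)"
    by (rule MONO_deriv[OF DERIV_spow POS_scale[OF POS_spow]]) (use assms \<beta> in auto)
qed

lemma CONV_spow:
  assumes "real n \<le> \<alpha>" "2 \<le> n" shows "CONV n (spow s \<alpha>)"
  by (rule CONV_deriv[OF DERIV_spow MONO_scale[OF MONO_spow]]) (use assms in auto)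

lemma SUPER_spow:
  assumes "real n \<le> \<alpha>" "2 \<le> n" shows "SUPER n (spow s \<alpha>)"
  by (rule SUPER_deriv[OF DERIV_spow MONO_scale[OF MONO_spow]]) (use assms in auto)

section \<open>Natural powers\<close>

lemma POS_power: "POS n (\<lambda>x. x ^ m)"
proof (induction m)
  case 0
  show ?case using PSD_rank1[of n "\<lambda>_. 1"] by (simp add: POS_def)
next
  case (Suc m)
  then show ?case by (simp add: POS_def PSD_hadamard)
qed

lemma MONO_power: "MONO n (\<lambda>x. x ^ m)"
  by (rule MONO_deriv[of _ "\<lambda>x. real m * x ^ (m - Suc 0)"])
    (auto intro!: derivative_eq_intros POS_scale[OF POS_power])

lemma CONV_power: "CONV n (\<lambda>x. x ^ m)"
  by (rule CONV_deriv[of _ "\<lambda>x. real m * x ^ (m - Suc 0)"])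
    (auto intro!: derivative_eq_intros MONO_scale[OF MONO_power])

lemma SUPER_power: "1 \<le> m \<Longrightarrow> SUPER n (\<lambda>x. x ^ m)"
  by (rule SUPER_deriv[of _ "\<lambda>x. real m * x ^ (m - Suc 0)"])
    (auto intro!: derivative_eq_intros MONO_scale[OF MONO_power])

subsection \<open>Conditions on Gram matrices\<close>

text \<open>The properties tested only on the matrices \<open>(x\<^sub>i x\<^sub>j)\<close> and \<open>(x\<^sub>i x\<^sub>j + y\<^sub>i y\<^sub>j)\<close>, which
  have rank at most one and two; this suffices for necessity.\<close>

definition superG :: "real set \<Rightarrow> nat \<Rightarrow> (real \<Rightarrow> real) \<Rightarrow> bool" where
  "superG J n g \<longleftrightarrow> (\<forall>x y v. range x \<subseteq> J \<longrightarrow> range y \<subseteq> J \<longrightarrow>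
     0 \<le> qform n (\<lambda>i j. g (x i * x j + y i * y j) - (g (x i * x j) + g (y i * y j))) v)"

definition posG :: "real set \<Rightarrow> nat \<Rightarrow> (real \<Rightarrow> real) \<Rightarrow> bool" where
  "posG J n g \<longleftrightarrow> (\<forall>x y v. range x \<subseteq> J \<longrightarrow> range y \<subseteq> J \<longrightarrow>
     0 \<le> qform n (\<lambda>i j. g (x i * x j + y i * y j)) v)"

definition monoG :: "real set \<Rightarrow> nat \<Rightarrow> (real \<Rightarrow> real) \<Rightarrow> bool" where
  "monoG J n g \<longleftrightarrow> (\<forall>x y v. range x \<subseteq> J \<longrightarrow> range y \<subseteq> J \<longrightarrow>
     0 \<le> qform n (\<lambda>i j. g (x i * x j + y i * y j) - g (x i * x j)) v)"

definition convG :: "real set \<Rightarrow> nat \<Rightarrow> (real \<Rightarrow> real) \<Rightarrow> bool" where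
  "convG J n g \<longleftrightarrow> (\<forall>x y v l. range x \<subseteq> J \<longrightarrow> range y \<subseteq> J \<longrightarrow> 0 \<le> l \<longrightarrow> l \<le> 1 \<longrightarrow>
     0 \<le> qform n (\<lambda>i j. l * g (x i * x j + y i * y j) + (1 - l) * g (x i * x j)
            - g (x i * x j + l * (y i * y j))) v)"

lemma qform_restrict:
  assumes "m \<le> n" shows "qform n F (\<lambda>i. if i < m then v i else 0) = qform m F v"
proof -
  have "qform n F (\<lambda>i. if i < m then v i else 0) =
    (\<Sum>i<n. if i < m then \<Sum>j<n. if j < m then v i * v j * F i j else 0 else 0)"
    unfolding qform_def by (intro sum.cong refl) (auto intro!: sum.cong sum.neutral)
  also have "\<dots> = (\<Sum>i<n. if i < m then \<Sum>j<m. v i * v j * F i j else 0)"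
    using assms by (intro sum.cong refl if_cong sum.mono_neutral_cong_right) auto
  also have "\<dots> = qform m F v"
    unfolding qform_def using assms by (intro sum.mono_neutral_cong_right) auto
  finally show ?thesis .
qed

lemma superG_D:
  "superG J n g \<Longrightarrow> range x \<subseteq> J \<Longrightarrow> range y \<subseteq> J \<Longrightarrow>
     0 \<le> qform n (\<lambda>i j. g (x i * x j + y i * y j) - (g (x i * x j) + g (y i * y j))) v"
  by (auto simp: superG_def)

lemma superG_antimono:
  assumes "superG J n g" "m \<le> n" shows "superG J m g"
  unfolding superG_def
proof (intro allI impI)
  fix x y v :: "nat \<Rightarrow> real" assume "range x \<subseteq> J" "range y \<subseteq> J"
  from superG_D[OF assms(1) this, of "\<lambda>i. if i < m then v i else 0"]
  show "0 \<le> qform m (\<lambda>i j. g (x i * x j + y i * y j) - (g (x i * x j) + g (y i * y j))) v"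
    unfolding qform_restrict[OF assms(2)] .
qed

lemma superG_UNIV: "superG UNIV n g \<Longrightarrow> superG J n g"
  by (auto simp: superG_def)

lemma qform_rank1_mult:
  assumes "\<And>a b. g (a * b) = g a * g b"
  shows "qform n (\<lambda>i j. g (x i * x j)) v = (\<Sum>i<n. v i * g (x i))^2"
  unfolding assms qform_rank1 ..

text \<open>Appending the points \<open>(1, 0)\<close> and \<open>(0, 1)\<close> to the Gram vectors \<open>(x i, y i)\<close> turns
  super-additivity on rank-one matrices into a Schur complement of positivity.\<close>

lemma posG_imp_superG:
  assumes g: "\<And>a b. g (a * b) = g a * g b" "g 0 = 0" "g 1 = 1"
    and J: "0 \<in> J" "1 \<in> J" and p: "posG J (Suc (Suc n)) g"
  shows "superG J n g"
  unfolding superG_def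
proof (intro allI impI)
  fix x y v :: "nat \<Rightarrow> real" assume x: "range x \<subseteq> J" and y: "range y \<subseteq> J"
  define x' where "x' i = (if i < n then x i else if i = n then 1 else 0)" for i
  define y' where "y' i = (if i < n then y i else if i = n then 0 else 1)" for i
  define s t where "s = (\<Sum>i<n. v i * g (x i))" and "t = (\<Sum>i<n. v i * g (y i))"
  \<comment> \<open>The last two coordinates minimise the form: the appended block is the identity,
    since \<open>g 0 = 0\<close> and \<open>g 1 = 1\<close>, and its couplings to \<open>v\<close>
    are \<open>s\<close> and \<open>t\<close>.\<close>
  define w where "w i = (if i < n then v i else if i = n then - s else - t)" for i
  have "range x' \<subseteq> J" "range y' \<subseteq> J" using x y J by (auto simp: x'_def y'_def)
  then have "0 \<le> qform (Suc (Suc n)) (\<lambda>i j. g (x' i * x' j + y' i * y' j)) w"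
    using p by (auto simp: posG_def)
  also have "\<dots> = qform n (\<lambda>i j. g (x' i * x' j + y' i * y' j)) w
      + (\<Sum>i<n. w i * w n * (g (x' i * x' n + y' i * y' n) + g (x' n * x' i + y' n * y' i))) + w n * w n
      + (\<Sum>i<n. w i * w (Suc n) * (g (x' i * x' (Suc n) + y' i * y' (Suc n))
           + g (x' (Suc n) * x' i + y' (Suc n) * y' i))) + w (Suc n) * w (Suc n)"
    by (simp add: qform_Suc x'_def y'_def g)
  also have "qform n (\<lambda>i j. g (x' i * x' j + y' i * y' j)) w = qform n (\<lambda>i j. g (x i * x j + y i * y j)) v"
    by (intro qform_cong) (auto simp: x'_def y'_def w_def)
  also have "(\<Sum>i<n. w i * w n * (g (x' i * x' n + y' i * y' n) + g (x' n * x' i + y' n * y' i))) = - 2 * s * s"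
    by (simp add: x'_def y'_def w_def g s_def sum_distrib_left mult_ac)
  also have "(\<Sum>i<n. w i * w (Suc n) * (g (x' i * x' (Suc n) + y' i * y' (Suc n))
           + g (x' (Suc n) * x' i + y' (Suc n) * y' i))) = - 2 * t * t"
    by (simp add: x'_def y'_def w_def g t_def sum_distrib_left mult_ac)
  also have "w n * w n = s^2" by (simp add: w_def power2_eq_square)
  also have "w (Suc n) * w (Suc n) = t^2" by (simp add: w_def power2_eq_square)
  finally show "0 \<le> qform n (\<lambda>i j. g (x i * x j + y i * y j) - (g (x i * x j) + g (y i * y j))) v"
    by (simp add: qform_diff qform_add qform_rank1_mult[of g, OF g(1)] s_def[symmetric] t_def[symmetric]
        power2_eq_square)
qed

text \<open>Here the single point \<open>(0, 1)\<close> is appended. Its diagonal entry is 1 and its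
  column is \<open>g (y i)\<close>, so the Schur complement subtracts the missing
  \<open>g (y i * y j)\<close>; the term \<open>g (x i * x j)\<close> is already subtracted.\<close>

lemma monoG_imp_superG:
  assumes g: "\<And>a b. g (a * b) = g a * g b" "g 0 = 0" "g 1 = 1"
    and J: "0 \<in> J" "1 \<in> J" and p: "monoG J (Suc n) g"
  shows "superG J n g"
  unfolding superG_def
proof (intro allI impI)
  fix x y v :: "nat \<Rightarrow> real" assume x: "range x \<subseteq> J" and y: "range y \<subseteq> J"
  define x' where "x' i = (if i < n then x i else 0)" for i
  define y' where "y' i = (if i < n then y i else 1)" for i
  define t where "t = (\<Sum>i<n. v i * g (y i))"
  define w where "w i = (if i < n then v i else - t)" for i
  let ?F = "\<lambda>i j. g (x' i * x' j + y' i * y' j) - g (x' i * x' j)"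
  have "range x' \<subseteq> J" "range y' \<subseteq> J" using x y J by (auto simp: x'_def y'_def)
  then have "0 \<le> qform (Suc n) ?F w"
    using p by (auto simp: monoG_def)
  also have "\<dots> = qform n ?F w + (\<Sum>i<n. w i * w n * (?F i n + ?F n i)) + w n * w n"
    by (simp add: qform_Suc x'_def y'_def g)
  also have "qform n ?F w = qform n (\<lambda>i j. g (x i * x j + y i * y j) - g (x i * x j)) v"
    by (intro qform_cong) (auto simp: x'_def y'_def w_def)
  also have "(\<Sum>i<n. w i * w n * (?F i n + ?F n i)) = - 2 * t * t"
    by (simp add: x'_def y'_def w_def g t_def sum_distrib_left mult_ac)
  also have "w n * w n = t^2" by (simp add: w_def power2_eq_square)
  finally show "0 \<le> qform n (\<lambda>i j. g (x i * x j + y i * y j) - (g (x i * x j) + g (y i * y j))) v"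
    by (simp add: qform_diff qform_add qform_rank1_mult[of g, OF g(1)] t_def[symmetric] power2_eq_square)
qed

text \<open>Differentiating the form of \<open>g (x i * x j + t * (y i * y j))\<close> in
  \<open>t\<close> produces factors \<open>y i * y j\<close>, which dividing the weights by
  \<open>y i\<close> absorbs. The chord inequality then compares the derivatives at 0 and 1.
  Vanishing coordinates of \<open>y\<close> are reached as limits of \<open>y i + e\<close>, which
  is where continuity of \<open>g'\<close> and the closure of \<open>J\<close> enter.\<close>

lemma convG_imp_monoG:
  assumes d: "\<And>x. (g has_real_derivative g' x) (at x)" and cont: "\<And>x. isCont g' x"
    and J: "\<And>a e. a \<in> J \<Longrightarrow> 0 < e \<Longrightarrow> a + e \<in> J" and c: "convG J n g"
  shows "monoG J n g'"
  unfolding monoG_def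
proof (intro allI impI)
  fix x y w :: "nat \<Rightarrow> real" assume x: "range x \<subseteq> J" and y: "range y \<subseteq> J"
  let ?Q = "\<lambda>y. qform n (\<lambda>i j. g' (x i * x j + y i * y j) - g' (x i * x j)) w"
  have nz: "0 \<le> ?Q y" if y: "range y \<subseteq> J" and y0: "\<And>i. i < n \<Longrightarrow> y i \<noteq> 0" for y
  proof -
    define v where "v i = w i / y i" for i
    define h where "h t = qform n (\<lambda>i j. g (x i * x j + t * (y i * y j))) v" for t
    define h' where "h' t = qform n (\<lambda>i j. g' (x i * x j + t * (y i * y j))) w" for t
    have dh: "(h has_real_derivative h' t) (at t)" for t
    proof -
      have "(h has_real_derivative qform n (\<lambda>i j. y i * y j * g' (x i * x j + t * (y i * y j))) v) (at t)"
        unfolding h_def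
        by (intro DERIV_qform DERIV_cong[OF DERIV_chain2[OF d]]) (auto intro!: derivative_eq_intros)
      moreover have "qform n (\<lambda>i j. y i * y j * g' (x i * x j + t * (y i * y j))) v = h' t"
        unfolding qform_hadamard_rank1 h'_def by (intro qform_cong) (auto simp: v_def y0)
      ultimately show ?thesis by simp
    qed
    \<comment> \<open>The chord minus the function: it vanishes at 0 and 1 and is nonnegative
      between, so the slope \<open>h 1 - h 0\<close> lies between \<open>h' 0\<close> and
      \<open>h' 1\<close>.\<close>
    define k where "k t = t * h 1 + (1 - t) * h 0 - h t" for t
    have dk: "(k has_real_derivative h 1 - h 0 - h' t) (at t)" for t
      unfolding k_def by (auto intro!: derivative_eq_intros dh)
    have k0: "0 \<le> k t" if "0 \<le> t" "t \<le> 1" for t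
    proof -
      have "0 \<le> qform n (\<lambda>i j. t * g (x i * x j + y i * y j) + (1 - t) * g (x i * x j)
            - g (x i * x j + t * (y i * y j))) v"
        using c x y that by (simp add: convG_def)
      then show ?thesis by (simp add: k_def h_def qform_diff qform_add qform_scale)
    qed
    have "h' 0 \<le> h 1 - h 0"
    proof (rule ccontr)
      assume "\<not> h' 0 \<le> h 1 - h 0"
      then obtain e where e: "e > 0" "\<forall>s>0. s < e \<longrightarrow> k (0 + s) < k 0"
        using DERIV_neg_dec_right[OF dk[of 0]] by auto
      then have "k (0 + min (e / 2) 1) < k 0" by auto
      then show False using k0[of "min (e / 2) 1"] e(1) by (simp add: k_def)
    qed
    moreover have "h 1 - h 0 \<le> h' 1"
    proof (rule ccontr)
      assume "\<not> h 1 - h 0 \<le> h' 1"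
      then obtain e where e: "e > 0" "\<forall>s>0. s < e \<longrightarrow> k (1 - s) < k 1"
        using DERIV_pos_inc_left[OF dk[of 1]] by auto
      then have "k (1 - min (e / 2) 1) < k 1" by auto
      then show False using k0[of "1 - min (e / 2) 1"] e(1) by (simp add: k_def)
    qed
    ultimately have "h' 0 \<le> h' 1" by simp
    then show ?thesis by (simp add: h'_def qform_diff)
  qed
  have lim: "((\<lambda>e. ?Q (\<lambda>i. y i + e)) \<longlongrightarrow> ?Q y) (at_right 0)"
  proof -
    have "((\<lambda>e. g' (x i * x j + (y i + e) * (y j + e))) \<longlongrightarrow> g' (x i * x j + (y i + 0) * (y j + 0))) (at_right 0)" for i j
      by (intro isCont_tendsto_compose[OF cont] tendsto_intros)
    then show ?thesis unfolding qform_def by (intro tendsto_intros) simp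
  qed
  have "\<forall>\<^sub>F e in at_right 0. e > (0::real) \<and> (\<forall>i\<in>{..<n}. e \<noteq> - y i)"
    by (intro eventually_conj eventually_at_right_less eventually_ball_finite ballI
        eventually_neq_at_within) auto
  then have "\<forall>\<^sub>F e in at_right 0. 0 \<le> ?Q (\<lambda>i. y i + e)"
  proof eventually_elim
    case (elim e)
    then have "range (\<lambda>i. y i + e) \<subseteq> J" using y J by auto
    moreover have "y i + e \<noteq> 0" if "i < n" for i
      using elim that by (metis add.inverse_unique lessThan_iff)
    ultimately show ?case by (rule nz)
  qed
  then show "0 \<le> ?Q y" using tendsto_lowerbound[OF lim] by simp
qed

subsection \<open>Exponents that are not integers\<close>

text \<open>The falling factorial, so that \<open>fall \<alpha> l / fact l\<close> is the
  generalised binomial coefficient.\<close>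

definition fall :: "real \<Rightarrow> nat \<Rightarrow> real" where
  "fall \<alpha> l = (\<Prod>i<l. \<alpha> - real i)"

lemma binomial_remainder:
  "\<exists>C. \<forall>z. 0 \<le> z \<longrightarrow> z \<le> 1 \<longrightarrow>
     \<bar>(1 + z) powr \<alpha> - (\<Sum>l\<le>m. fall \<alpha> l / fact l * z ^ l)\<bar> \<le> C * z ^ Suc m"
proof -
  define diff where "diff l t = fall \<alpha> l * (1 + t) powr (\<alpha> - real l)" for l t
  define b where "b = \<alpha> - real (Suc m)"
  \<comment> \<open>Lagrange's remainder contains \<open>(1 + t) powr b\<close> with 0 < t < 1,
    which \<open>2 powr \<bar>b\<bar>\<close> bounds for either sign of \<open>b\<close>.\<close>
  define C where "C = \<bar>fall \<alpha> (Suc m)\<bar> * 2 powr \<bar>b\<bar> / fact (Suc m)"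
  have "\<bar>(1 + z) powr \<alpha> - (\<Sum>l\<le>m. fall \<alpha> l / fact l * z ^ l)\<bar> \<le> C * z ^ Suc m"
    if z: "0 \<le> z" "z \<le> 1" for z
  proof (cases "z = 0")
    case True
    have "(\<Sum>l\<le>m. fall \<alpha> l / fact l * 0 ^ l) = (\<Sum>l\<le>m. if l = 0 then 1 else 0)"
      by (intro sum.cong refl) (auto simp: fall_def)
    then show ?thesis using True by simp
  next
    case False
    have der: "DERIV (diff l) t :> diff (Suc l) t" if "0 \<le> t" for l t
    proof -
      have "DERIV (diff l) t :> fall \<alpha> l * ((\<alpha> - real l) * (1 + t) powr (\<alpha> - real l - 1))"
        unfolding diff_def using that by (auto intro!: derivative_eq_intros)
      then show ?thesis by (simp add: diff_def fall_def algebra_simps)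
    qed
    obtain t where t: "0 < t" "t < z" and
      e: "diff 0 z = (\<Sum>l<Suc m. diff l 0 / fact l * z ^ l) + diff (Suc m) t / fact (Suc m) * z ^ Suc m"
      using Maclaurin[of z "Suc m" diff "diff 0"] z False der by auto
    have "(1 + z) powr \<alpha> - (\<Sum>l\<le>m. fall \<alpha> l / fact l * z ^ l) = diff (Suc m) t / fact (Suc m) * z ^ Suc m"
      using e by (simp add: diff_def fall_def lessThan_Suc_atMost)
    moreover have "\<bar>diff (Suc m) t\<bar> \<le> \<bar>fall \<alpha> (Suc m)\<bar> * 2 powr \<bar>b\<bar>"
    proof -
      have "(1 + t) powr b \<le> (1 + t) powr \<bar>b\<bar>" using t by (intro powr_mono) auto
      also have "\<dots> \<le> 2 powr \<bar>b\<bar>" using t z by (intro powr_mono2) auto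
      finally show ?thesis by (simp add: diff_def b_def abs_mult mult_left_mono)
    qed
    ultimately show ?thesis using z
      by (simp add: C_def abs_mult mult_right_mono divide_right_mono del: fact_Suc power_Suc)
  qed
  then show ?thesis by blast
qed

lemma binomial_remainder_limit:
  assumes "\<beta> < real m + 1"
  shows "((\<lambda>z. ((1 + z) powr \<alpha> - (\<Sum>l\<le>m. fall \<alpha> l / fact l * z ^ l)) / z powr \<beta>) \<longlongrightarrow> 0) (at_right 0)"
proof -
  obtain C where C: "\<And>z. 0 \<le> z \<Longrightarrow> z \<le> 1 \<Longrightarrow>
     \<bar>(1 + z) powr \<alpha> - (\<Sum>l\<le>m. fall \<alpha> l / fact l * z ^ l)\<bar> \<le> C * z ^ Suc m"
    using binomial_remainder by blast
  have "((\<lambda>z::real. z) \<longlongrightarrow> 0) (at_right 0)" by (rule tendsto_ident_at)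
  then have "((\<lambda>z. C * z powr (real m + 1 - \<beta>)) \<longlongrightarrow> C * 0 powr (real m + 1 - \<beta>)) (at_right 0)"
    using assms by (intro tendsto_mult tendsto_const tendsto_powr') (auto simp: eventually_at_filter)
  then have lim: "((\<lambda>z. C * z powr (real m + 1 - \<beta>)) \<longlongrightarrow> 0) (at_right 0)" by simp
  show ?thesis
  proof (rule tendsto_0_le[OF lim, of _ 1])
    have "\<forall>\<^sub>F z in at_right 0. z \<in> {0<..<1::real}"
      by (rule eventually_at_rightI[of 0 1]) auto
    then show "\<forall>\<^sub>F z in at_right 0. norm (((1 + z) powr \<alpha> - (\<Sum>l\<le>m. fall \<alpha> l / fact l * z ^ l)) / z powr \<beta>)
      \<le> norm (C * z powr (real m + 1 - \<beta>)) * 1"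
    proof eventually_elim
      case (elim z)
      then have "\<bar>(1 + z) powr \<alpha> - (\<Sum>l\<le>m. fall \<alpha> l / fact l * z ^ l)\<bar> \<le> C * z ^ Suc m"
        by (intro C) auto
      also have "z ^ Suc m = z powr (real m + 1)" using elim by (simp add: powr_add powr_realpow)
      finally have "\<bar>(1 + z) powr \<alpha> - (\<Sum>l\<le>m. fall \<alpha> l / fact l * z ^ l)\<bar> / z powr \<beta> \<le>
          C * z powr (real m + 1) / z powr \<beta>" by (rule divide_right_mono) simp
      also have "\<dots> = C * z powr (real m + 1 - \<beta>)" by (simp add: powr_diff)
      also have "\<dots> \<le> \<bar>C\<bar> * z powr (real m + 1 - \<beta>)" by (intro mult_right_mono) auto
      finally show ?case by (simp add: abs_mult)
    qed
  qed
qed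

text \<open>Up to the binomial factor, the coefficient of \<open>e ^ l\<close> is the rank-one
  matrix \<open>2 ^ (l * (i + j))\<close>; its form is the square of the polynomial with
  coefficients \<open>v\<close>, evaluated at \<open>2 ^ l\<close>. The roots of that polynomial
  decide which orders survive.\<close>

lemma binomial_qform_expansion:
  assumes "\<beta> < real m + 1"
  shows "((\<lambda>e. (qform n (\<lambda>i j. (1 + e * 2 ^ (i + j)) powr \<alpha>) v -
      (\<Sum>l\<le>m. fall \<alpha> l / fact l * e ^ l * (\<Sum>i<n. v i * (2 ^ l) ^ i)^2)) / e powr \<beta>) \<longlongrightarrow> 0) (at_right 0)"
proof -
  define R where "R z = (1 + z) powr \<alpha> - (\<Sum>l\<le>m. fall \<alpha> l / fact l * z ^ l)" for z
  have R: "((\<lambda>e. R (e * c) / e powr \<beta>) \<longlongrightarrow> 0) (at_right 0)" if "c > 0" for c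
  proof -
    have "filterlim (\<lambda>e::real. e * c) (at_right 0) (at_right 0)"
      unfolding filterlim_at using that
      by (auto simp: eventually_at_filter intro!: tendsto_mult_left_zero tendsto_ident_at)
    from filterlim_compose[OF binomial_remainder_limit[OF assms, of \<alpha>] this]
    have "((\<lambda>e. c powr \<beta> * (R (e * c) / (e * c) powr \<beta>)) \<longlongrightarrow> c powr \<beta> * 0) (at_right 0)"
      unfolding R_def by (intro tendsto_mult tendsto_const)
    then show ?thesis using that by (simp add: powr_mult)
  qed
  have "((\<lambda>e. qform n (\<lambda>i j. R (e * 2 ^ (i + j)) / e powr \<beta>) v) \<longlongrightarrow> qform n (\<lambda>i j. 0) v) (at_right 0)"
    unfolding qform_def by (intro tendsto_sum tendsto_mult tendsto_const R) simp
  moreover have "qform n (\<lambda>i j. R (e * 2 ^ (i + j)) / e powr \<beta>) v =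
     (qform n (\<lambda>i j. (1 + e * 2 ^ (i + j)) powr \<alpha>) v -
      (\<Sum>l\<le>m. fall \<alpha> l / fact l * e ^ l * (\<Sum>i<n. v i * (2 ^ l) ^ i)^2)) / e powr \<beta>" for e
  proof -
    have "qform n (\<lambda>i j. R (e * 2 ^ (i + j))) v = qform n (\<lambda>i j. (1 + e * 2 ^ (i + j)) powr \<alpha>) v
       - qform n (\<lambda>i j. \<Sum>l\<le>m. fall \<alpha> l / fact l * e ^ l * ((2 ^ l) ^ i * (2 ^ l) ^ j)) v"
      unfolding R_def qform_diff
      by (simp add: power_mult_distrib power_add power_mult[symmetric] mult_ac)
    also have "\<dots> = qform n (\<lambda>i j. (1 + e * 2 ^ (i + j)) powr \<alpha>) v
       - (\<Sum>l\<le>m. fall \<alpha> l / fact l * e ^ l * (\<Sum>i<n. v i * (2 ^ l) ^ i)^2)"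
      by (simp only: qform_sum qform_scale qform_rank1)
    finally show ?thesis
      using qform_scale[of n "1 / e powr \<beta>" "\<lambda>i j. R (e * 2 ^ (i + j))" v] by simp
  qed
  ultimately show ?thesis by (simp add: qform_def)
qed

lemma weights_with_roots:
  assumes "finite T"
  shows "\<exists>v. \<forall>c::real. (\<Sum>i<Suc (card T). v i * c ^ i) = (\<Prod>t\<in>T. c - t)"
proof -
  define p where "p = (\<Prod>t\<in>T. [:- t, 1::real:])"
  have "degree p = (\<Sum>t\<in>T. degree [:- t, 1:])"
    unfolding p_def by (intro degree_prod_eq_sum_degree) auto
  then have "degree p = card T" by simp
  then have "(\<Sum>i<Suc (card T). coeff p i * c ^ i) = poly p c" for c
    by (simp add: poly_altdef lessThan_Suc_atMost)
  moreover have "poly p c = (\<Prod>t\<in>T. c - t)" for c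
    by (simp add: p_def poly_prod)
  ultimately show ?thesis by metis
qed

lemma two_powr_power: "((2::real) ^ k) powr \<alpha> = (2 powr \<alpha>) ^ k"
proof -
  have "((2::real) ^ k) powr \<alpha> = (2 powr real k) powr \<alpha>" by (simp add: powr_realpow)
  also have "\<dots> = (2 powr \<alpha>) powr real k" by (simp add: powr_powr mult.commute)
  finally show ?thesis by (simp add: powr_realpow)
qed

lemma powr_scaled_power:
  fixes e :: real
  assumes "0 \<le> e" shows "(e * 2 ^ (i + j)) powr \<alpha> = e powr \<alpha> * ((2 powr \<alpha>) ^ i * (2 powr \<alpha>) ^ j)"
  using assms by (simp add: powr_mult two_powr_power power_add)

lemma spow_sqrt_scaled:
  assumes "0 \<le> e"
  shows "spow s \<alpha> (1 * 1 + (sqrt e * 2 ^ i) * (sqrt e * 2 ^ j)) = (1 + e * 2 ^ (i + j)) powr \<alpha>"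
    and "0 < e \<Longrightarrow> spow s \<alpha> ((sqrt e * 2 ^ i) * (sqrt e * 2 ^ j)) = e powr \<alpha> * ((2 powr \<alpha>) ^ i * (2 powr \<alpha>) ^ j)"
proof -
  have e: "(sqrt e * 2 ^ i) * (sqrt e * 2 ^ j) = e * 2 ^ (i + j)"
    using assms by (simp add: power_add)
  have "0 < 1 + e * 2 ^ (i + j)" using assms by (simp add: add_pos_nonneg)
  then show "spow s \<alpha> (1 * 1 + (sqrt e * 2 ^ i) * (sqrt e * 2 ^ j)) = (1 + e * 2 ^ (i + j)) powr \<alpha>"
    unfolding e by (simp add: spow_pos)
  show "spow s \<alpha> ((sqrt e * 2 ^ i) * (sqrt e * 2 ^ j)) = e powr \<alpha> * ((2 powr \<alpha>) ^ i * (2 powr \<alpha>) ^ j)"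
    if "0 < e" unfolding e using that by (subst spow_pos) (auto intro: powr_scaled_power)
qed

lemma superG_not_below_1:
  assumes "superG {0..} 1 (spow s \<alpha>)" shows "1 \<le> \<alpha>"
proof -
  have "0 \<le> spow s \<alpha> 2 - 2"
    using superG_D[OF assms, of "\<lambda>_. 1" "\<lambda>_. 1" "\<lambda>_. 1"] by (simp add: qform_def)
  then have "2 powr 1 \<le> 2 powr \<alpha>" by (simp add: spow_pos)
  then show ?thesis by (subst (asm) powr_le_cancel_iff) auto
qed

text \<open>A polynomial with the \<open>m\<close> roots 2, ..., 2 ^ m needs \<open>m + 1\<close>
  weights, whence the dimension. Of the expansion only order 0 remains, and it cancels against the
  all-ones matrix. Dividing by \<open>e powr \<alpha>\<close> then forces
  \<open>2 powr \<alpha>\<close> to be a root, impossible for \<alpha> strictly between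
  \<open>m\<close> and \<open>m + 1\<close>.\<close>

lemma superG_nonint:
  assumes sup: "superG {0..} (Suc m) (spow s \<alpha>)" and m: "1 \<le> m" "real m < \<alpha>" "\<alpha> < real m + 1"
  shows False
proof -
  have inj: "inj_on (\<lambda>l. (2::real) ^ l) {1..m}" by (auto intro: inj_onI)
  then have card: "card ((\<lambda>l. (2::real) ^ l) ` {1..m}) = m" by (simp add: card_image)
  obtain v where v: "\<And>c::real. (\<Sum>i<Suc m. v i * c ^ i) = (\<Prod>t\<in>(\<lambda>l. 2 ^ l) ` {1..m}. c - t)"
    using weights_with_roots[of "(\<lambda>l. (2::real) ^ l) ` {1..m}"] unfolding card by auto
  let ?P = "\<lambda>c. \<Sum>i<Suc m. v i * c ^ i"
  let ?E = "\<lambda>e. qform (Suc m) (\<lambda>i j. (1 + e * 2 ^ (i + j)) powr \<alpha>) v -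
      (\<Sum>l\<le>m. fall \<alpha> l / fact l * e ^ l * (?P (2 ^ l))^2)"
  have sum0: "(\<Sum>l\<le>m. fall \<alpha> l / fact l * e ^ l * (?P (2 ^ l))^2) = (?P 1)^2" for e
  proof -
    have "(\<Sum>l\<le>m. fall \<alpha> l / fact l * e ^ l * (?P (2 ^ l))^2) = (\<Sum>l\<le>m. if l = 0 then (?P 1)^2 else 0)"
    proof (intro sum.cong refl)
      fix l assume "l \<in> {..m}"
      then have "?P (2 ^ l) = 0" if "l \<noteq> 0" using that unfolding v by (intro prod_zero) auto
      then show "fall \<alpha> l / fact l * e ^ l * (?P (2 ^ l))^2 = (if l = 0 then (?P 1)^2 else 0)"
        by (auto simp: fall_def simp del: sum.lessThan_Suc)
    qed
    then show ?thesis by (simp del: sum.lessThan_Suc)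
  qed
  have lb: "(?P (2 powr \<alpha>))^2 \<le> ?E e / e powr \<alpha>" if e: "0 < e" for e
  proof -
    have "0 \<le> qform (Suc m) (\<lambda>i j. spow s \<alpha> (1 * 1 + (sqrt e * 2 ^ i) * (sqrt e * 2 ^ j)) -
        (spow s \<alpha> (1 * 1) + spow s \<alpha> ((sqrt e * 2 ^ i) * (sqrt e * 2 ^ j)))) v"
      using e by (intro superG_D[OF sup, of "\<lambda>_. 1" "\<lambda>i. sqrt e * 2 ^ i"]) auto
    also have "\<dots> = qform (Suc m) (\<lambda>i j. (1 + e * 2 ^ (i + j)) powr \<alpha> -
       (1 ^ i * 1 ^ j + e powr \<alpha> * ((2 powr \<alpha>) ^ i * (2 powr \<alpha>) ^ j))) v"
      using e by (simp only: spow_sqrt_scaled less_imp_le) simp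
    also have "\<dots> = ?E e - e powr \<alpha> * (?P (2 powr \<alpha>))^2"
      unfolding sum0 by (simp only: qform_diff qform_add qform_scale qform_rank1)
    finally show ?thesis using e by (simp add: field_simps del: sum.lessThan_Suc)
  qed
  have "(?P (2 powr \<alpha>))^2 \<le> 0"
  proof (rule tendsto_lowerbound[OF binomial_qform_expansion[OF m(3)]])
    show "\<forall>\<^sub>F e in at_right 0. (?P (2 powr \<alpha>))^2 \<le> ?E e / e powr \<alpha>"
      by (rule eventually_mono[OF eventually_at_right_less]) (rule lb)
  qed simp
  then have "?P (2 powr \<alpha>) = 0" by simp
  then obtain l where l: "l \<in> {1..m}" "2 powr \<alpha> = 2 ^ l"
    unfolding v by (auto simp: prod_zero_iff)
  then have "2 powr \<alpha> = 2 powr (real l)" by (simp add: powr_realpow)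
  then have "\<alpha> = real l" by (metis powr_inj numeral_eq_one_iff less_numeral_extra(4) semiring_norm(85) zero_less_numeral)
  then show False using l m by auto
qed

lemma superG_exponent:
  assumes sup: "superG {0..} n (spow s \<alpha>)" and n: "1 \<le> n"
  shows "\<alpha> \<in> pos_ints \<union> {real n..}"
proof (rule ccontr)
  assume a: "\<not> ?thesis"
  then have an: "\<alpha> < real n" by auto
  have "1 \<le> \<alpha>" using superG_not_below_1[OF superG_antimono[OF sup n]] .
  define m where "m = nat \<lfloor>\<alpha>\<rfloor>"
  have m: "real m \<le> \<alpha>" "\<alpha> < real m + 1" "1 \<le> m" using \<open>1 \<le> \<alpha>\<close> unfolding m_def by linarith+
  have "real m \<noteq> \<alpha>" using a m(3) by (auto simp: pos_ints_def)
  with m have "real m < \<alpha>" by simp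
  moreover have "Suc m \<le> n" using an m by linarith
  ultimately show False using superG_nonint[OF superG_antimono[OF sup]] m by blast
qed

subsection \<open>Integer exponents of the wrong parity\<close>

lemma alternating_binomial_sum_Suc:
  fixes f :: "nat \<Rightarrow> real"
  shows "(\<Sum>i\<le>Suc m. (-1) ^ i * real (Suc m choose i) * f i) =
    (\<Sum>i\<le>m. (-1) ^ i * real (m choose i) * (f i - f (Suc i)))"
proof -
  have "(\<Sum>i\<le>Suc m. (-1) ^ i * real (Suc m choose i) * f i) =
     f 0 + (\<Sum>i\<le>m. (-1) ^ Suc i * real (Suc m choose Suc i) * f (Suc i))"
    by (subst sum.atMost_Suc_shift) simp
  also have "\<dots> = f 0 + (\<Sum>i\<le>m. (-1) ^ Suc i * real (m choose Suc i) * f (Suc i))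
     - (\<Sum>i\<le>m. (-1) ^ i * real (m choose i) * f (Suc i))"
    unfolding add_diff_eq[symmetric] sum_subtractf[symmetric]
    by (intro arg_cong2[of _ _ _ _ "(+)"] refl sum.cong) (simp add: algebra_simps)
  also have "f 0 + (\<Sum>i\<le>m. (-1) ^ Suc i * real (m choose Suc i) * f (Suc i)) =
     (\<Sum>i\<le>Suc m. (-1) ^ i * real (m choose i) * f i)"
    by (subst sum.atMost_Suc_shift) simp
  also have "\<dots> = (\<Sum>i\<le>m. (-1) ^ i * real (m choose i) * f i)" by simp
  finally show ?thesis by (simp add: right_diff_distrib sum_subtractf)
qed

lemma power_step: "((u::real) + 1) ^ l - u ^ l = (\<Sum>k<l. real (l choose k) * u ^ k)"
proof -
  have "(u + 1) ^ l = (\<Sum>k\<le>l. real (l choose k) * u ^ k)" by (simp add: binomial_ring)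
  then show ?thesis by (simp add: lessThan_Suc_atMost[symmetric])
qed

text \<open>The sum is an \<open>m\<close>-th finite difference of a polynomial of degree
  \<open>l < m\<close>. By \<open>alternating_binomial_sum_Suc\<close>, which is Pascal's rule, each
  step passes to a difference, and \<open>power_step\<close> lowers the degree.\<close>

lemma alternating_binomial_power_sum:
  assumes "l < m"
  shows "(\<Sum>i\<le>m. (-1) ^ i * real (m choose i) * (c - real i) ^ l) = 0"
  using assms
proof (induction m arbitrary: c l)
  case (Suc m)
  have step: "(c - real i) ^ l - (c - real (Suc i)) ^ l = (\<Sum>k<l. real (l choose k) * (c - 1 - real i) ^ k)" for i
    using power_step[of "c - 1 - real i" l] by (simp add: algebra_simps)
  have "(\<Sum>i\<le>Suc m. (-1) ^ i * real (Suc m choose i) * (c - real i) ^ l) =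
     (\<Sum>i\<le>m. \<Sum>k<l. real (l choose k) * ((-1) ^ i * real (m choose i) * (c - 1 - real i) ^ k))"
    unfolding alternating_binomial_sum_Suc step by (simp add: sum_distrib_left mult_ac)
  also have "\<dots> = (\<Sum>k<l. real (l choose k) * (\<Sum>i\<le>m. (-1) ^ i * real (m choose i) * (c - 1 - real i) ^ k))"
    by (subst sum.swap) (simp add: sum_distrib_left)
  also have "\<dots> = 0" using Suc by (intro sum.neutral) auto
  finally show ?case .
qed simp

lemma one_plus_power_le:
  fixes z :: real assumes z: "0 \<le> z" "z \<le> 1" shows "(1 + z) ^ m \<le> 1 + 2 ^ m * z"
proof -
  \<comment> \<open>The slope \<open>2 ^ m - 1\<close> is that of the chord over [0, 1]; with it the
    induction closes.\<close>
  have "(1 + z) ^ m \<le> 1 + (2 ^ m - 1) * z"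
  proof (induction m)
    case (Suc m)
    have "(1 + z) ^ Suc m \<le> (1 + z) * (1 + (2 ^ m - 1) * z)"
      using Suc z by (simp add: mult_left_mono)
    also have "\<dots> = 1 + 2 ^ m * z + (2 ^ m - 1) * (z * z)" by (simp add: algebra_simps)
    also have "\<dots> \<le> 1 + 2 ^ m * z + (2 ^ m - 1) * (1 * z)"
      using z by (intro add_left_mono mult_left_mono mult_right_mono) auto
    finally show ?case by (simp add: algebra_simps)
  qed simp
  then show ?thesis using z by (simp add: algebra_simps)
qed

text \<open>For odd \<open>m\<close> this is \<phi> and for even \<open>m\<close> it is \<psi>, at
  exponent \<open>m\<close>. On the points \<open>(1, e * s i)\<close> the form is at most of order
  \<open>e ^ (2 * m)\<close>, whereas their coupling to \<open>(- e, 1)\<close> is exactly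
  \<open>- 2 * e ^ m\<close>; a weight of order \<open>e ^ m\<close> on that point makes the form
  negative.\<close>

lemma superG_odd_power:
  assumes g: "\<And>z. g z = (if 0 \<le> z then z ^ m else - (z ^ m))" and m: "1 \<le> m"
  shows "\<not> superG UNIV (Suc m) g"
proof
  assume sup: "superG UNIV (Suc m) g"
  have mult: "g (a * b) = g a * g b" for a b
    using m by (auto simp: g power_mult_distrib zero_le_mult_iff not_le)
  define a where "a i = (-1) ^ i * real (m choose i)" for i
  define s where "s i = 1 - real i" for i
  have van: "(\<Sum>i<Suc m. a i * s i ^ l) = 0" if "l < m" for l
    using alternating_binomial_power_sum[OF that, of 1] by (simp only: a_def s_def lessThan_Suc_atMost)
  define A where "A = (\<Sum>i<Suc m. a i * s i ^ m)"
  \<comment> \<open>\<open>B\<close> makes the cross contribution \<open>- 4 * B\<close> dominate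
    \<open>A^2\<close>. The denominator of \<open>e\<close> ensures \<open>e * m \<le> 1\<close>,
    which keeps \<open>1 + (e * s i) * (e * s j)\<close> nonnegative, and
    \<open>e * (B * 2 ^ m) \<le> 1\<close>, which keeps the corner contribution at most
    \<open>B\<close>.\<close>
  define B where "B = A^2 + 1"
  define e where "e = 1 / (real m + B * 2 ^ m + 1)"
  have B: "1 \<le> B" by (simp add: B_def)
  have pos: "0 < real m + B * 2 ^ m + 1" using B by (intro add_nonneg_pos) auto
  have e: "0 < e" "e \<le> 1" "e * real m \<le> 1" "e * (B * 2 ^ m) \<le> 1"
    using pos B by (auto simp: e_def)
  \<comment> \<open>Since \<open>s 1 = 0\<close>, the point with index 1 would be
    \<open>(1, 0)\<close>, whose row of the form is zero. Its slot is free for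
    \<open>(- e, 1)\<close>, so dimension \<open>m + 1\<close> suffices.\<close>
  define x where "x i = (if i = 1 then - e else 1)" for i :: nat
  define y where "y i = (if i = 1 then 1 else e * s i)" for i :: nat
  let ?F = "\<lambda>i j. g (x i * x j + y i * y j) - (g (x i * x j) + g (y i * y j))"
  let ?a = "\<lambda>i. if i = 1 then 0 else a i"
  let ?b = "e ^ m * B"
  have g1: "g 1 = 1" and g0: "g 0 = 0" using m by (auto simp: g)
  have ge: "g (e * z) = e ^ m * g z" for z using e by (simp add: mult) (simp add: g)
  have g11: "?F 1 1 \<le> 2 ^ m * e^2"
  proof -
    have "?F 1 1 = (1 + e^2) ^ m - 1 - g (e * e)"
      by (simp add: x_def y_def g1) (simp add: g power2_eq_square add.commute)
    moreover have "0 \<le> g (e * e)" by (simp add: g)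
    moreover have "(1 + e^2) ^ m \<le> 1 + 2 ^ m * e^2"
      using e by (intro one_plus_power_le) (auto simp: power_le_one)
    ultimately show ?thesis by linarith
  qed
  have cross: "(\<Sum>i<Suc m. ?a i * ?F i 1) = - 2 * e ^ m"
  proof -
    have "(\<Sum>i<Suc m. ?a i * ?F i 1) = (\<Sum>i<Suc m. e ^ m * (a i * (g (s i - 1) - g (- 1) - g (s i))))"
    proof (intro sum.cong refl)
      fix i
      have "?F i 1 = e ^ m * (g (s i - 1) - g (- 1) - g (s i))" if "i \<noteq> 1"
      proof -
        have "?F i 1 = g (e * (s i - 1)) - (g (e * (- 1)) + g (e * s i))"
          using that by (simp add: x_def y_def algebra_simps)
        then show ?thesis unfolding ge by (simp add: algebra_simps)
      qed
      then show "?a i * ?F i 1 = e ^ m * (a i * (g (s i - 1) - g (- 1) - g (s i)))"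
        by (auto simp: s_def g0)
    qed
    also have "\<dots> = e ^ m * (\<Sum>i<Suc m. a i * (g (s i - 1) - g (- 1) - g (s i)))"
      by (simp only: sum_distrib_left)
    \<comment> \<open>For \<open>i \<ge> 1\<close> both \<open>s i\<close> and
      \<open>s i - 1\<close> are nonpositive, where \<open>g z = - (z ^ m)\<close>; only
      \<open>i = 0\<close> lies on the other side of the kink and leaves the defect 2, as
      \<open>a 0 = 1\<close>. The polynomial rest has degree below \<open>m\<close> in
      \<open>s i\<close>, so the weights annihilate it.\<close>
    also have "(\<Sum>i<Suc m. a i * (g (s i - 1) - g (- 1) - g (s i))) =
      (\<Sum>i<Suc m. a i * (s i ^ m - (s i - 1) ^ m) - g (- 1) * a i - (if i = 0 then 2 else 0))"
    proof (intro sum.cong refl)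
      fix i
      show "a i * (g (s i - 1) - g (- 1) - g (s i)) =
        a i * (s i ^ m - (s i - 1) ^ m) - g (- 1) * a i - (if i = 0 then 2 else 0)"
      proof (cases "i = 0")
        case True
        then show ?thesis using m by (simp add: s_def a_def g)
      next
        case False
        then have "g (s i) = - (s i ^ m)" "g (s i - 1) = - ((s i - 1) ^ m)"
          using m by (auto simp: g s_def)
        then show ?thesis using False by (simp add: algebra_simps)
      qed
    qed
    also have "\<dots> = (\<Sum>i<Suc m. a i * (s i ^ m - (s i - 1) ^ m)) - g (- 1) * (\<Sum>i<Suc m. a i) - 2"
      by (simp only: sum_subtractf sum_distrib_left[symmetric]) simp
    also have "(\<Sum>i<Suc m. a i) = 0" using van[of 0] m by simp
    also have "(\<Sum>i<Suc m. a i * (s i ^ m - (s i - 1) ^ m)) = 0"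
    proof -
      have "(\<Sum>i<Suc m. a i * (s i ^ m - (s i - 1) ^ m)) =
        (\<Sum>i<Suc m. \<Sum>k<m. real (m choose k) * (a i * (0 - real i) ^ k))"
        using power_step[of "s _ - 1" m] by (simp add: s_def sum_distrib_left mult_ac)
      also have "\<dots> = (\<Sum>k<m. real (m choose k) * (\<Sum>i<Suc m. a i * (0 - real i) ^ k))"
        by (subst sum.swap) (simp only: sum_distrib_left)
      also have "\<dots> = 0"
        unfolding a_def lessThan_Suc_atMost
        by (intro sum.neutral ballI) (use alternating_binomial_power_sum[of _ m 0] in auto)
      finally show ?thesis .
    qed
    finally show ?thesis by simp
  qed
  have main: "qform (Suc m) ?F ?a \<le> (e ^ m)^2 * A^2"
  proof -
    have "qform (Suc m) ?F ?a = qform (Suc m) (\<lambda>i j. (1 + e^2 * (s i * s j)) ^ m - (1 * 1 + g ((e * s i) * (e * s j)))) a"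
      unfolding qform_def
    proof (intro sum.cong refl)
      fix i j assume ij: "i \<in> {..<Suc m}" "j \<in> {..<Suc m}"
      have sb: "\<bar>e * s k\<bar> \<le> 1" if "k \<in> {..<Suc m}" for k
      proof -
        have "\<bar>s k\<bar> \<le> real m" using that m by (auto simp: s_def)
        then have "e * \<bar>s k\<bar> \<le> e * real m" using e by (intro mult_left_mono) auto
        then have "e * \<bar>s k\<bar> \<le> 1" using e(3) by linarith
        then show ?thesis using e by (simp add: abs_mult)
      qed
      have "\<bar>(e * s i) * (e * s j)\<bar> \<le> 1 * 1"
        unfolding abs_mult[of "e * s i"] using sb ij by (intro mult_mono) auto
      then have "0 \<le> 1 + (e * s i) * (e * s j)" by linarith
      then have "g (1 + (e * s i) * (e * s j)) = (1 + e^2 * (s i * s j)) ^ m"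
        by (simp add: g power2_eq_square mult_ac)
      then show "?a i * ?a j * ?F i j = a i * a j * ((1 + e^2 * (s i * s j)) ^ m - (1 * 1 + g ((e * s i) * (e * s j))))"
        using m by (auto simp: x_def y_def g1 g0 s_def)
    qed
    also have "\<dots> = qform (Suc m) (\<lambda>i j. \<Sum>l\<le>m. real (m choose l) * (e^2) ^ l * (s i ^ l * s j ^ l)) a
        - ((\<Sum>i<Suc m. a i * 1)^2 + (\<Sum>i<Suc m. a i * g (e * s i))^2)"
    proof -
      have "(1 + e^2 * (s i * s j)) ^ m = (\<Sum>l\<le>m. real (m choose l) * (e^2) ^ l * (s i ^ l * s j ^ l))" for i j
        using binomial_ring[of "e^2 * (s i * s j)" 1 m] by (simp add: power_mult_distrib mult_ac add.commute)
      then show ?thesis by (simp only: qform_diff qform_add qform_rank1_mult[of g, OF mult] qform_rank1)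
    qed
    also have "\<dots> \<le> qform (Suc m) (\<lambda>i j. \<Sum>l\<le>m. real (m choose l) * (e^2) ^ l * (s i ^ l * s j ^ l)) a"
      by simp
    also have "\<dots> = (\<Sum>l\<le>m. real (m choose l) * (e^2) ^ l * (\<Sum>i<Suc m. a i * s i ^ l)^2)"
      by (simp only: qform_sum qform_scale qform_rank1)
    also have "\<dots> = (\<Sum>l\<le>m. if l = m then (e^2) ^ m * A^2 else 0)"
    proof (intro sum.cong refl)
      fix l assume "l \<in> {..m}"
      then have "l = m \<or> l < m" by auto
      then show "real (m choose l) * (e^2) ^ l * (\<Sum>i<Suc m. a i * s i ^ l)^2 = (if l = m then (e^2) ^ m * A^2 else 0)"
        using van[of l] by (auto simp: A_def simp del: sum.lessThan_Suc)
    qed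
    finally show ?thesis by (simp add: power_mult[symmetric] mult.commute)
  qed
  have "0 \<le> qform (Suc m) ?F (\<lambda>i. ?a i + (if i = 1 then ?b else 0))"
    by (intro superG_D[OF sup]) auto
  also have "\<dots> = qform (Suc m) ?F ?a + 2 * ?b * (\<Sum>i<Suc m. ?a i * ?F i 1) + ?b^2 * ?F 1 1"
    using m by (intro qform_shift) (auto simp: mult.commute add.commute)
  also have "\<dots> \<le> (e ^ m)^2 * A^2 + 2 * ?b * (- 2 * e ^ m) + ?b^2 * (2 ^ m * e^2)"
    using main mult_left_mono[OF g11, of "?b^2"] unfolding cross by simp
  also have "\<dots> = (e ^ m)^2 * (A^2 - 4 * B + B * (e * (e * (B * 2 ^ m))))"
    by (simp add: power2_eq_square algebra_simps)
  also have "\<dots> < 0"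
  proof -
    have "e * (e * (B * 2 ^ m)) \<le> 1 * 1" using e B by (intro mult_mono) auto
    then have "B * (e * (e * (B * 2 ^ m))) \<le> B * 1" using B by (intro mult_left_mono) auto
    moreover have "A^2 = B - 1" by (simp add: B_def)
    ultimately have "A^2 - 4 * B + B * (e * (e * (B * 2 ^ m))) < 0" using B by linarith
    then show ?thesis using e by (intro mult_pos_neg) auto
  qed
  finally show False by simp
qed

lemma superG_phi_exponent:
  assumes "superG UNIV n (spow False \<alpha>)" "1 \<le> n"
  shows "\<alpha> \<in> pos_evens \<union> {real n..}"
proof (rule ccontr)
  assume a: "\<not> ?thesis"
  then obtain m where m: "\<alpha> = real m" "1 \<le> m" "m < n"
    using superG_exponent[OF superG_UNIV[OF assms(1)] assms(2)] by (auto simp: pos_ints_def)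
  then have "odd m" using a by (auto simp: pos_evens_def)
  then have "spow False \<alpha> z = (if 0 \<le> z then z ^ m else - (z ^ m))" for z
    using m by (auto simp: spow_def powr_realpow)
  then show False using superG_odd_power[OF _ m(2)] superG_antimono[OF assms(1), of "Suc m"] m(3) by auto
qed

lemma superG_psi_exponent:
  assumes "superG UNIV n (spow True \<alpha>)" "1 \<le> n"
  shows "\<alpha> \<in> pos_odds \<union> {real n..}"
proof (rule ccontr)
  assume a: "\<not> ?thesis"
  then obtain m where m: "\<alpha> = real m" "1 \<le> m" "m < n"
    using superG_exponent[OF superG_UNIV[OF assms(1)] assms(2)] by (auto simp: pos_ints_def)
  then have "even m" using a by (auto simp: pos_odds_def)
  then have "spow True \<alpha> z = (if 0 \<le> z then z ^ m else - (z ^ m))" for z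
    using m by (auto simp: spow_def powr_realpow)
  then show False using superG_odd_power[OF _ m(2)] superG_antimono[OF assms(1), of "Suc m"] m(3) by auto
qed

subsection \<open>Matrices and their entries\<close>

lemma isCont_spow:
  assumes "0 < \<alpha>" shows "isCont (spow s \<alpha>) x"
proof -
  have abs: "isCont (\<lambda>x::real. (max x 0) powr \<alpha>) x" for x
    unfolding isCont_def using assms
    by (intro tendsto_powr' tendsto_intros) (auto intro: always_eventually)
  have minus: "isCont (\<lambda>x::real. (max (- x) 0) powr \<alpha>) x" for x
    unfolding isCont_def using assms
    by (intro tendsto_powr' tendsto_intros) (auto intro: always_eventually)
  \<comment> \<open>Positive and negative parts are continuous and nonnegative, and a positive power
    of such a function is continuous also at its zeros.\<close>
  have "spow s \<alpha> = (\<lambda>x. (max x 0) powr \<alpha> + (if s then -1 else 1) * (max (- x) 0) powr \<alpha>)"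
    by (auto simp: spow_def fun_eq_iff sgn_if max_def)
  then show ?thesis using abs minus by (auto intro!: continuous_intros)
qed

lemma elements_mat_iff:
  assumes A: "A \<in> carrier_mat n n"
  shows "elements_mat A \<subseteq> I \<longleftrightarrow> (\<forall>i<n. \<forall>j<n. A $$ (i,j) \<in> I)"
proof
  assume "elements_mat A \<subseteq> I"
  then show "\<forall>i<n. \<forall>j<n. A $$ (i,j) \<in> I" using elements_matI[OF A] by blast
next
  assume "\<forall>i<n. \<forall>j<n. A $$ (i,j) \<in> I"
  then show "elements_mat A \<subseteq> I" using A by (auto dest!: elements_matD)
qed

lemma psd_iff_PSD:
  "A \<in> psd n I \<longleftrightarrow> A \<in> carrier_mat n n \<and> PSD n (\<lambda>i j. A $$ (i,j)) \<and> (\<forall>i<n. \<forall>j<n. A $$ (i,j) \<in> I)"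
proof (cases "A \<in> carrier_mat n n")
  case True
  have sym: "transpose_mat A = A \<longleftrightarrow> (\<forall>i<n. \<forall>j<n. A $$ (i,j) = A $$ (j,i))"
  proof
    assume t: "transpose_mat A = A"
    show "\<forall>i<n. \<forall>j<n. A $$ (i,j) = A $$ (j,i)"
    proof (intro allI impI)
      fix i j assume "i < n" "j < n"
      then have "transpose_mat A $$ (j,i) = A $$ (i,j)" using True by auto
      then show "A $$ (i,j) = A $$ (j,i)" using t by simp
    qed
  next
    assume "\<forall>i<n. \<forall>j<n. A $$ (i,j) = A $$ (j,i)"
    then show "transpose_mat A = A" using True by (intro eq_matI) auto
  qed
  have el: "elements_mat A \<subseteq> I \<longleftrightarrow> (\<forall>i<n. \<forall>j<n. A $$ (i,j) \<in> I)"
    using True by (rule elements_mat_iff)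
  have q: "v \<bullet> (A *\<^sub>v v) = qform n (\<lambda>i j. A $$ (i,j)) (\<lambda>i. v $ i)" if "v \<in> carrier_vec n" for v
    using True that
    by (auto simp: scalar_prod_def qform_def atLeast0LessThan sum_distrib_left mult_ac intro!: sum.cong)
  have "(\<forall>v\<in>carrier_vec n. 0 \<le> v \<bullet> (A *\<^sub>v v)) \<longleftrightarrow> (\<forall>v. 0 \<le> qform n (\<lambda>i j. A $$ (i,j)) v)"
  proof
    assume a: "\<forall>v\<in>carrier_vec n. 0 \<le> v \<bullet> (A *\<^sub>v v)"
    show "\<forall>v. 0 \<le> qform n (\<lambda>i j. A $$ (i,j)) v"
    proof
      fix v
      have "0 \<le> qform n (\<lambda>i j. A $$ (i,j)) (\<lambda>i. vec n v $ i)"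
        using a q[of "vec n v"] by (metis vec_carrier)
      also have "\<dots> = qform n (\<lambda>i j. A $$ (i,j)) v" by (intro qform_cong) auto
      finally show "0 \<le> qform n (\<lambda>i j. A $$ (i,j)) v" .
    qed
  qed (use q in auto)
  then show ?thesis using True sym el unfolding psd_def PSD_def by blast
qed (auto simp: psd_def)

lemma psd_D:
  assumes "A \<in> psd n I"
  shows "A \<in> carrier_mat n n" "PSD n (\<lambda>i j. A $$ (i,j))" "i < n \<Longrightarrow> j < n \<Longrightarrow> A $$ (i,j) \<in> I"
  using assms by (auto simp: psd_iff_PSD)

lemma psd_rank_psd: "psd_rank n k I \<subseteq> psd n I"
  by (auto simp: psd_rank_def)

lemma loewner_le_iff:
  assumes "A \<in> carrier_mat n n" "B \<in> carrier_mat n n"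
  shows "loewner_le n A B \<longleftrightarrow> PSD n (\<lambda>i j. B $$ (i,j) - A $$ (i,j))"
proof -
  have "PSD n (\<lambda>i j. (B - A) $$ (i,j)) \<longleftrightarrow> PSD n (\<lambda>i j. B $$ (i,j) - A $$ (i,j))"
    using assms by (auto intro!: iffI elim!: PSD_cong)
  then show ?thesis using assms by (auto simp: loewner_le_def psd_iff_PSD minus_carrier_mat)
qed

text \<open>Closure under the operations that form the entries \<open>x i * x j + y i * y j\<close>;
  both domains qualify.\<close>

definition semiring_set :: "real set \<Rightarrow> bool" where
  "semiring_set I \<longleftrightarrow> 0 \<in> I \<and> 1 \<in> I \<and> (\<forall>a\<in>I. \<forall>b\<in>I. a + b \<in> I \<and> a * b \<in> I)"

lemma semiring_set_UNIV: "semiring_set UNIV" and semiring_set_nonneg: "semiring_set {0..}"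
  by (auto simp: semiring_set_def)

lemma semiring_setD:
  assumes "semiring_set I"
  shows "0 \<in> I" "1 \<in> I" "a \<in> I \<Longrightarrow> b \<in> I \<Longrightarrow> a + b \<in> I" "a \<in> I \<Longrightarrow> b \<in> I \<Longrightarrow> a * b \<in> I"
  using assms by (auto simp: semiring_set_def)

definition gram1 :: "nat \<Rightarrow> (nat \<Rightarrow> real) \<Rightarrow> real mat" where
  "gram1 n x = mat n n (\<lambda>(i,j). x i * x j)"

definition gram2 :: "nat \<Rightarrow> (nat \<Rightarrow> real) \<Rightarrow> (nat \<Rightarrow> real) \<Rightarrow> real mat" where
  "gram2 n x y = mat n n (\<lambda>(i,j). x i * x j + y i * y j)"

lemma gram_simps [simp]:
  "gram1 n x \<in> carrier_mat n n" "gram2 n x y \<in> carrier_mat n n"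
  "dim_row (gram1 n x) = n" "dim_col (gram1 n x) = n" "dim_row (gram2 n x y) = n" "dim_col (gram2 n x y) = n"
  "i < n \<Longrightarrow> j < n \<Longrightarrow> gram1 n x $$ (i,j) = x i * x j"
  "i < n \<Longrightarrow> j < n \<Longrightarrow> gram2 n x y $$ (i,j) = x i * x j + y i * y j"
  by (auto simp: gram1_def gram2_def)

lemma gram1_psd_rank:
  assumes "semiring_set I" "range x \<subseteq> I" "1 \<le> k"
  shows "gram1 n x \<in> psd_rank n k I"
proof -
  have "vec_space.rank n (gram1 n x) \<le> 1"
    by (rule vec_space.rank_le_1_product_entries[where f = x and g = x]) auto
  moreover have "PSD n (\<lambda>i j. gram1 n x $$ (i,j))"
    by (rule PSD_cong[OF PSD_rank1[of n x]]) simp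
  moreover have "x i \<in> I" for i using assms(2) by auto
  ultimately show ?thesis using assms semiring_setD[OF assms(1)]
    by (auto simp: psd_rank_def psd_iff_PSD)
qed

lemma gram2_psd_rank:
  assumes "semiring_set I" "range x \<subseteq> I" "range y \<subseteq> I" "2 \<le> k"
  shows "gram2 n x y \<in> psd_rank n k I"
proof -
  have "gram2 n x y = gram1 n x + gram1 n y" by (intro eq_matI) auto
  moreover have "vec_space.rank n (gram1 n z) \<le> 1" for z
    by (rule vec_space.rank_le_1_product_entries[where f = z and g = z]) auto
  then have "vec_space.rank n (gram1 n x) + vec_space.rank n (gram1 n y) \<le> 2"
    by (metis add_mono one_add_one)
  moreover have "vec_space.rank n (gram1 n x + gram1 n y) \<le> vec_space.rank n (gram1 n x) + vec_space.rank n (gram1 n y)"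
    by (rule vec_space.rank_subadditive[of _ _ n]) auto
  moreover have "PSD n (\<lambda>i j. gram2 n x y $$ (i,j))"
    by (rule PSD_cong[OF PSD_add[OF PSD_rank1[of n x] PSD_rank1[of n y]]]) simp
  moreover have "x i \<in> I" "y i \<in> I" for i using assms(2,3) by auto
  ultimately show ?thesis using assms semiring_setD[OF assms(1)]
    by (auto simp: psd_rank_def psd_iff_PSD)
qed

section \<open>Symmetric matrices of rank at most one\<close>

lemma det_symmetric_2_nonzero:
  fixes M :: "real mat"
  assumes M: "M \<in> carrier_mat 2 2" and s: "M $$ (1,0) = M $$ (0,1)"
    and d: "M $$ (0,0) * M $$ (1,1) \<noteq> (M $$ (0,1))^2"
  shows "det M \<noteq> 0"
proof
  assume "det M = 0"
  then obtain v where v: "v \<in> carrier_vec 2" "v \<noteq> 0\<^sub>v 2" "M *\<^sub>v v = 0\<^sub>v 2"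
    using det_0_iff_vec_prod_zero_field[OF M] by auto
  have 2: "{0..<2} = {0, 1::nat}" by auto
  have "(M *\<^sub>v v) $ 0 = M $$ (0,0) * v $ 0 + M $$ (0,1) * v $ 1"
    "(M *\<^sub>v v) $ 1 = M $$ (1,0) * v $ 0 + M $$ (1,1) * v $ 1"
    using M v(1) by (simp_all add: scalar_prod_def 2)
  then have e: "M $$ (0,0) * v $ 0 + M $$ (0,1) * v $ 1 = 0" "M $$ (0,1) * v $ 0 + M $$ (1,1) * v $ 1 = 0"
    unfolding v(3) s by simp_all
  \<comment> \<open>Cramer's rule: the determinant times each coordinate of the kernel vector is a
    combination of the two equations.\<close>
  have "(M $$ (0,0) * M $$ (1,1) - (M $$ (0,1))^2) * v $ 0 =
     M $$ (1,1) * (M $$ (0,0) * v $ 0 + M $$ (0,1) * v $ 1) - M $$ (0,1) * (M $$ (0,1) * v $ 0 + M $$ (1,1) * v $ 1)"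
    "(M $$ (0,0) * M $$ (1,1) - (M $$ (0,1))^2) * v $ 1 =
     M $$ (0,0) * (M $$ (0,1) * v $ 0 + M $$ (1,1) * v $ 1) - M $$ (0,1) * (M $$ (0,0) * v $ 0 + M $$ (0,1) * v $ 1)"
    by (auto simp: algebra_simps power2_eq_square)
  then have "v $ 0 = 0" "v $ 1 = 0" using e d by auto
  then have "v = 0\<^sub>v 2" using v(1) by (intro eq_vecI) (auto simp: less_2_cases_iff)
  then show False using v(2) by simp
qed

lemma rank_le_1_principal_minor:
  fixes A :: "real mat"
  assumes A: "A \<in> carrier_mat n n" and s: "A $$ (q,p) = A $$ (p,q)" and pq: "p < q" "q < n"
    and r: "vec_space.rank n A \<le> 1"
  shows "A $$ (p,p) * A $$ (q,q) = (A $$ (p,q))^2"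
proof (rule ccontr)
  assume d: "\<not> ?thesis"
  let ?M = "submatrix A {p,q} {p,q}"
  have c: "{i. i < n \<and> i \<in> {p,q}} = {p,q}" using pq by auto
  have cc: "card {p,q} = 2" using pq by auto
  have M: "?M \<in> carrier_mat 2 2"
    using A c cc dim_submatrix[of A "{p,q}" "{p,q}"] by (metis carrier_matD(1,2) carrier_matI)
  \<comment> \<open>\<open>submatrix\<close> renumbers the chosen indices by counting those below,
    so \<open>p < q\<close> become 0 and 1.\<close>
  have "{a \<in> {p,q}. a < p} = {}" "{a \<in> {p,q}. a < q} = {p}" using pq by auto
  then have cs: "card {a \<in> {p,q}. a < p} = 0" "card {a \<in> {p,q}. a < q} = 1" by (metis card.empty, metis card_1_singleton_iff One_nat_def)
  have idx: "?M $$ (card {a \<in> {p,q}. a < i}, card {a \<in> {p,q}. a < j}) = A $$ (i,j)"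
    if "i \<in> {p,q}" "j \<in> {p,q}" for i j
    using A pq that by (intro submatrix_index_card) auto
  have "?M $$ (0,0) = A $$ (p,p)" "?M $$ (0,1) = A $$ (p,q)"
    "?M $$ (1,0) = A $$ (q,p)" "?M $$ (1,1) = A $$ (q,q)"
    using idx[of p p] idx[of p q] idx[of q p] idx[of q q] unfolding cs by simp_all
  then have "det ?M \<noteq> 0" using d s by (intro det_symmetric_2_nonzero[OF M]) simp_all
  then have "card {j. j < n \<and> j \<in> {p,q}} \<le> vec_space.rank n A"
    using vec_space.rank_gt_minor[OF A] by blast
  then show False using r unfolding c cc by simp
qed

text \<open>All principal 2 x 2 minors vanish, so the Schur complement at a nonzero pivot has zero
  diagonal, and a semidefinite form with zero diagonal is zero.\<close>

lemma psd_rank_1E: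
  assumes "A \<in> psd_rank n 1 I"
  obtains x where "\<And>i j. i < n \<Longrightarrow> j < n \<Longrightarrow> A $$ (i,j) = x i * x j"
proof -
  have A: "A \<in> carrier_mat n n" "PSD n (\<lambda>i j. A $$ (i,j))" "vec_space.rank n A \<le> 1"
    using assms by (auto simp: psd_rank_def psd_iff_PSD)
  note F = A(2)
  have minor: "A $$ (i,i) * A $$ (p,p) = (A $$ (i,p))^2" if "i < n" "p < n" for i p
  proof (cases i p rule: linorder_cases)
    case less
    then show ?thesis using rank_le_1_principal_minor[OF A(1) _ less that(2) A(3)] PSD_sym[OF F] that by auto
  next
    case greater
    then show ?thesis using rank_le_1_principal_minor[OF A(1) _ greater that(1) A(3)] PSD_sym[OF F] that
      by (metis mult.commute)
  qed (simp add: power2_eq_square)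
  show ?thesis
  proof (cases "\<exists>p<n. A $$ (p,p) \<noteq> 0")
    case True
    then obtain p where p: "p < n" "A $$ (p,p) \<noteq> 0" by auto
    then have pos: "A $$ (p,p) > 0" using PSD_diag[OF F p(1)] by simp
    let ?x = "\<lambda>i. A $$ (i,p) / sqrt (A $$ (p,p))"
    have G: "PSD n (\<lambda>i j. A $$ (i,j) - ?x i * ?x j)"
      using PSD_schur_complement[OF F p(1)] pos by simp
    have "A $$ (i,j) = ?x i * ?x j" if ij: "i < n" "j < n" for i j
    proof -
      have "A $$ (j,j) - ?x j * ?x j = 0"
        using minor[OF ij(2) p(1)] pos by (simp add: field_simps power2_eq_square)
      then show ?thesis using PSD_zero_col[OF G _ ij] by simp
    qed
    then show ?thesis by (rule that)
  next
    case False
    then have "A $$ (i,j) = 0" if "i < n" "j < n" for i j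
      using PSD_zero_col[OF F _ that] that by auto
    then show ?thesis by (intro that[of "\<lambda>_. 0"]) auto
  qed
qed

text \<open>Lets \<open>f_pow\<close>, meaningful on nonnegative arguments only, be exchanged for
  \<open>spow\<close> or a monomial on the whole line.\<close>

definition agree :: "real set \<Rightarrow> (real \<Rightarrow> real) \<Rightarrow> (real \<Rightarrow> real) \<Rightarrow> bool" where
  "agree I g h \<longleftrightarrow> (\<forall>x\<in>I. g x = h x)"

lemma agreeD: "agree I g h \<Longrightarrow> x \<in> I \<Longrightarrow> g x = h x"
  by (simp add: agree_def)

lemma MONO_D:
  "MONO n g \<Longrightarrow> PSD n F \<Longrightarrow> PSD n (\<lambda>i j. G i j - F i j) \<Longrightarrow> PSD n (\<lambda>i j. g (G i j) - g (F i j))"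
  unfolding MONO_def by blast

lemma CONV_D:
  "CONV n g \<Longrightarrow> PSD n F \<Longrightarrow> PSD n (\<lambda>i j. G i j - F i j) \<Longrightarrow> 0 \<le> l \<Longrightarrow> l \<le> 1 \<Longrightarrow>
     PSD n (\<lambda>i j. l * g (G i j) + (1 - l) * g (F i j) - g (l * G i j + (1 - l) * F i j))"
  unfolding CONV_def by blast

section \<open>Sufficiency: from forms to matrix predicates\<close>

lemma positive_on_suff:
  assumes P: "POS n h" and g: "agree I g h" and V: "V \<subseteq> psd n I"
  shows "positive_on n I V g"
  unfolding positive_on_def
proof
  fix A assume "A \<in> V"
  then have A: "A \<in> psd n I" using V by auto
  note A = psd_D[OF this]
  have "PSD n (\<lambda>i j. h (A $$ (i,j)))" using P A(2) by (simp add: POS_def)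
  then have "PSD n (\<lambda>i j. map_mat g A $$ (i,j) - 0\<^sub>m n n $$ (i,j))"
    by (rule PSD_cong) (use A agreeD[OF g] in auto)
  then show "loewner_le n (0\<^sub>m n n) (map_mat g A)" using A(1) by (simp add: loewner_le_iff)
qed

lemma monotone_loewner_on_suff:
  assumes P: "MONO n h" and g: "agree I g h" and V: "V \<subseteq> psd n I"
  shows "monotone_loewner_on n I V g"
  unfolding monotone_loewner_on_def
proof (intro ballI impI)
  fix A B assume AB: "A \<in> V" "B \<in> V" and le: "loewner_le n B A"
  then have "A \<in> psd n I" "B \<in> psd n I" using V by auto
  note A = psd_D[OF this(1)] and B = psd_D[OF this(2)]
  have "PSD n (\<lambda>i j. A $$ (i,j) - B $$ (i,j))" using le A B by (simp add: loewner_le_iff)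
  with P B(2) have "PSD n (\<lambda>i j. h (A $$ (i,j)) - h (B $$ (i,j)))" by (rule MONO_D)
  then have "PSD n (\<lambda>i j. map_mat g A $$ (i,j) - map_mat g B $$ (i,j))"
    by (rule PSD_cong) (use A B agreeD[OF g] in auto)
  then show "loewner_le n (map_mat g B) (map_mat g A)" using A(1) B(1) by (simp add: loewner_le_iff)
qed

lemma convex_loewner_on_suff:
  assumes P: "CONV n h" and g: "agree I g h" and V: "V \<subseteq> psd n I" and I: "convex I"
  shows "convex_loewner_on n I V g"
  unfolding convex_loewner_on_def
proof (intro ballI allI impI)
  fix A B and l :: real assume AB: "A \<in> V" "B \<in> V" and le: "loewner_le n B A" and l: "0 \<le> l" "l \<le> 1"
  then have "A \<in> psd n I" "B \<in> psd n I" using V by auto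
  note A = psd_D[OF this(1)] and B = psd_D[OF this(2)]
  have "PSD n (\<lambda>i j. A $$ (i,j) - B $$ (i,j))" using le A B by (simp add: loewner_le_iff)
  from P B(2) this l
  have "PSD n (\<lambda>i j. l * h (A $$ (i,j)) + (1 - l) * h (B $$ (i,j)) - h (l * A $$ (i,j) + (1 - l) * B $$ (i,j)))"
    by (rule CONV_D)
  moreover have "l * A $$ (i,j) + (1 - l) * B $$ (i,j) \<in> I" if "i < n" "j < n" for i j
    using convexD[OF I A(3)[OF that] B(3)[OF that], of l "1 - l"] l by simp
  ultimately have "PSD n (\<lambda>i j. (l \<cdot>\<^sub>m map_mat g A + (1 - l) \<cdot>\<^sub>m map_mat g B) $$ (i,j)
      - map_mat g (l \<cdot>\<^sub>m A + (1 - l) \<cdot>\<^sub>m B) $$ (i,j))"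
    by (elim PSD_cong) (use A B agreeD[OF g] in auto)
  then show "loewner_le n (map_mat g (l \<cdot>\<^sub>m A + (1 - l) \<cdot>\<^sub>m B)) (l \<cdot>\<^sub>m map_mat g A + (1 - l) \<cdot>\<^sub>m map_mat g B)"
    using A(1) B(1) by (simp add: loewner_le_iff)
qed

lemma super_additive_on_suff:
  assumes P: "SUPER n h" and g: "agree I g h" and V: "V \<subseteq> psd n I"
  shows "super_additive_on n I V g"
  unfolding super_additive_on_def
proof (intro ballI impI)
  fix A B assume AB: "A \<in> V" "B \<in> V" and s: "elements_mat (A + B) \<subseteq> I"
  then have "A \<in> psd n I" "B \<in> psd n I" using V by auto
  note A = psd_D[OF this(1)] and B = psd_D[OF this(2)]
  have s: "A $$ (i,j) + B $$ (i,j) \<in> I" if "i < n" "j < n" for i j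
    using s A(1) B(1) that elements_mat_iff[of "A + B" n I] by auto
  have "PSD n (\<lambda>i j. h (A $$ (i,j) + B $$ (i,j)) - (h (A $$ (i,j)) + h (B $$ (i,j))))"
    using P A(2) B(2) unfolding SUPER_def by blast
  then have "PSD n (\<lambda>i j. map_mat g (A + B) $$ (i,j) - (map_mat g A + map_mat g B) $$ (i,j))"
    by (rule PSD_cong) (use A B s agreeD[OF g] in auto)
  then show "loewner_le n (map_mat g A + map_mat g B) (map_mat g (A + B))"
    using A(1) B(1) by (simp add: loewner_le_iff)
qed

lemma sub_additive_on_iff:
  assumes "V \<subseteq> psd n I"
  shows "sub_additive_on n I V g \<longleftrightarrow> (\<forall>A\<in>V. \<forall>B\<in>V. (\<forall>i<n. \<forall>j<n. A $$ (i,j) + B $$ (i,j) \<in> I) \<longrightarrow>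
    PSD n (\<lambda>i j. g (A $$ (i,j)) + g (B $$ (i,j)) - g (A $$ (i,j) + B $$ (i,j))))"
  unfolding sub_additive_on_def
proof (intro ball_cong refl)
  fix A B assume "A \<in> V" "B \<in> V"
  then have A: "A \<in> carrier_mat n n" and B: "B \<in> carrier_mat n n"
    using assms by (auto dest: psd_D(1))
  have "PSD n (\<lambda>i j. (map_mat g A + map_mat g B) $$ (i,j) - map_mat g (A + B) $$ (i,j)) \<longleftrightarrow>
    PSD n (\<lambda>i j. g (A $$ (i,j)) + g (B $$ (i,j)) - g (A $$ (i,j) + B $$ (i,j)))"
    using A B by (auto intro!: iffI elim!: PSD_cong)
  moreover have "elements_mat (A + B) \<subseteq> I \<longleftrightarrow> (\<forall>i<n. \<forall>j<n. A $$ (i,j) + B $$ (i,j) \<in> I)"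
    using A B elements_mat_iff[of "A + B" n I] by auto
  ultimately show "(elements_mat (A + B) \<subseteq> I \<longrightarrow> loewner_le n (map_mat g (A + B)) (map_mat g A + map_mat g B)) =
    ((\<forall>i<n. \<forall>j<n. A $$ (i,j) + B $$ (i,j) \<in> I) \<longrightarrow>
    PSD n (\<lambda>i j. g (A $$ (i,j)) + g (B $$ (i,j)) - g (A $$ (i,j) + B $$ (i,j))))"
    using A B by (simp add: loewner_le_iff)
qed

section \<open>Necessity: from matrix predicates to Gram conditions\<close>

lemma positive_on_posG:
  assumes p: "positive_on n I (psd_rank n k I) g" and g: "agree I g h" and I: "semiring_set I" and k: "2 \<le> k"
  shows "posG I n h"
  unfolding posG_def
proof (intro allI impI)
  fix x y v :: "nat \<Rightarrow> real" assume xy: "range x \<subseteq> I" "range y \<subseteq> I"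
  note i = semiring_setD[OF I]
  have m: "x i \<in> I" "y i \<in> I" for i using xy by auto
  have "loewner_le n (0\<^sub>m n n) (map_mat g (gram2 n x y))"
    using p gram2_psd_rank[OF I xy k] by (auto simp: positive_on_def)
  then have "PSD n (\<lambda>i j. map_mat g (gram2 n x y) $$ (i,j) - 0\<^sub>m n n $$ (i,j))"
    by (subst (asm) loewner_le_iff) auto
  then have "PSD n (\<lambda>i j. h (x i * x j + y i * y j))"
    by (rule PSD_cong) (use agreeD[OF g] m i in auto)
  then show "0 \<le> qform n (\<lambda>i j. h (x i * x j + y i * y j)) v" by (rule PSD_qform)
qed

lemma monotone_loewner_on_monoG:
  assumes p: "monotone_loewner_on n I (psd_rank n k I) g" and g: "agree I g h" and I: "semiring_set I" and k: "2 \<le> k"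
  shows "monoG I n h"
  unfolding monoG_def
proof (intro allI impI)
  fix x y v :: "nat \<Rightarrow> real" assume xy: "range x \<subseteq> I" "range y \<subseteq> I"
  note i = semiring_setD[OF I]
  have m: "x i \<in> I" "y i \<in> I" for i using xy by auto
  have 1: "gram1 n x \<in> psd_rank n k I" using gram1_psd_rank[OF I xy(1)] k by simp
  have "loewner_le n (gram1 n x) (gram2 n x y)"
    by (subst loewner_le_iff) (auto intro!: PSD_cong[OF PSD_rank1[of n y]])
  moreover have "loewner_le n (0\<^sub>m n n) (gram1 n x)"
    by (subst loewner_le_iff) (auto intro!: PSD_cong[OF PSD_rank1[of n x]])
  ultimately have "loewner_le n (map_mat g (gram1 n x)) (map_mat g (gram2 n x y))"
    using p gram2_psd_rank[OF I xy k] 1 by (auto simp: monotone_loewner_on_def)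
  then have "PSD n (\<lambda>i j. map_mat g (gram2 n x y) $$ (i,j) - map_mat g (gram1 n x) $$ (i,j))"
    by (subst (asm) loewner_le_iff) auto
  then have "PSD n (\<lambda>i j. h (x i * x j + y i * y j) - h (x i * x j))"
    by (rule PSD_cong) (use agreeD[OF g] m i in auto)
  then show "0 \<le> qform n (\<lambda>i j. h (x i * x j + y i * y j) - h (x i * x j)) v" by (rule PSD_qform)
qed

lemma convex_loewner_on_convG:
  assumes p: "convex_loewner_on n I (psd_rank n k I) g" and g: "agree I g h" and I: "semiring_set I"
    and I': "convex I" and k: "2 \<le> k"
  shows "convG I n h"
  unfolding convG_def
proof (intro allI impI)
  fix x y v :: "nat \<Rightarrow> real" and l :: real assume xy: "range x \<subseteq> I" "range y \<subseteq> I" and l: "0 \<le> l" "l \<le> 1"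
  note i = semiring_setD[OF I]
  have m: "x i \<in> I" "y i \<in> I" for i using xy by auto
  have 1: "gram1 n x \<in> psd_rank n k I" using gram1_psd_rank[OF I xy(1)] k by simp
  have "loewner_le n (gram1 n x) (gram2 n x y)"
    by (subst loewner_le_iff) (auto intro!: PSD_cong[OF PSD_rank1[of n y]])
  moreover have "loewner_le n (0\<^sub>m n n) (gram1 n x)"
    by (subst loewner_le_iff) (auto intro!: PSD_cong[OF PSD_rank1[of n x]])
  ultimately have "loewner_le n (map_mat g (l \<cdot>\<^sub>m gram2 n x y + (1 - l) \<cdot>\<^sub>m gram1 n x))
      (l \<cdot>\<^sub>m map_mat g (gram2 n x y) + (1 - l) \<cdot>\<^sub>m map_mat g (gram1 n x))"
    using p gram2_psd_rank[OF I xy k] 1 l by (auto simp: convex_loewner_on_def)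
  then have "PSD n (\<lambda>i j. (l \<cdot>\<^sub>m map_mat g (gram2 n x y) + (1 - l) \<cdot>\<^sub>m map_mat g (gram1 n x)) $$ (i,j)
     - map_mat g (l \<cdot>\<^sub>m gram2 n x y + (1 - l) \<cdot>\<^sub>m gram1 n x) $$ (i,j))"
    by (subst (asm) loewner_le_iff) auto
  moreover have "(l \<cdot>\<^sub>m map_mat g (gram2 n x y) + (1 - l) \<cdot>\<^sub>m map_mat g (gram1 n x)) $$ (i,j)
     - map_mat g (l \<cdot>\<^sub>m gram2 n x y + (1 - l) \<cdot>\<^sub>m gram1 n x) $$ (i,j) =
     l * h (x i * x j + y i * y j) + (1 - l) * h (x i * x j) - h (x i * x j + l * (y i * y j))"
    if ij: "i < n" "j < n" for i j
  proof -
    have e: "l * (x i * x j + y i * y j) + (1 - l) * (x i * x j) = x i * x j + l * (y i * y j)"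
      by (simp add: algebra_simps)
    have in2: "x i * x j + y i * y j \<in> I" and in1: "x i * x j \<in> I" using m i by auto
    have "x i * x j + l * (y i * y j) \<in> I"
      using convexD[OF I' in2 in1, of l "1 - l"] l by (simp add: e)
    then show ?thesis using ij agreeD[OF g] in1 in2 by (simp add: e)
  qed
  ultimately have "PSD n (\<lambda>i j. l * h (x i * x j + y i * y j) + (1 - l) * h (x i * x j) - h (x i * x j + l * (y i * y j)))"
    by (rule PSD_cong)
  then show "0 \<le> qform n (\<lambda>i j. l * h (x i * x j + y i * y j) + (1 - l) * h (x i * x j)
            - h (x i * x j + l * (y i * y j))) v" by (rule PSD_qform)
qed

lemma super_additive_on_superG:
  assumes p: "super_additive_on n I (psd_rank n k I) g" and g: "agree I g h" and I: "semiring_set I" and k: "1 \<le> k"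
  shows "superG I n h"
  unfolding superG_def
proof (intro allI impI)
  fix x y v :: "nat \<Rightarrow> real" assume xy: "range x \<subseteq> I" "range y \<subseteq> I"
  note i = semiring_setD[OF I]
  have m: "x i \<in> I" "y i \<in> I" for i using xy by auto
  have "elements_mat (gram1 n x + gram1 n y) \<subseteq> I"
    by (subst elements_mat_iff[of _ n]) (use m i in auto)
  then have "loewner_le n (map_mat g (gram1 n x) + map_mat g (gram1 n y)) (map_mat g (gram1 n x + gram1 n y))"
    using p gram1_psd_rank[OF I xy(1) k] gram1_psd_rank[OF I xy(2) k] by (auto simp: super_additive_on_def)
  then have "PSD n (\<lambda>i j. map_mat g (gram1 n x + gram1 n y) $$ (i,j)
      - (map_mat g (gram1 n x) + map_mat g (gram1 n y)) $$ (i,j))"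
    by (subst (asm) loewner_le_iff) auto
  then have "PSD n (\<lambda>i j. h (x i * x j + y i * y j) - (h (x i * x j) + h (y i * y j)))"
    by (rule PSD_cong) (use agreeD[OF g] m i in auto)
  then show "0 \<le> qform n (\<lambda>i j. h (x i * x j + y i * y j) - (h (x i * x j) + h (y i * y j))) v"
    by (rule PSD_qform)
qed

subsection \<open>Sub-additivity\<close>

definition subG :: "real set \<Rightarrow> nat \<Rightarrow> (real \<Rightarrow> real) \<Rightarrow> bool" where
  "subG J n g \<longleftrightarrow> (\<forall>x y v. range x \<subseteq> J \<longrightarrow> range y \<subseteq> J \<longrightarrow>
     0 \<le> qform n (\<lambda>i j. g (x i * x j) + g (y i * y j) - g (x i * x j + y i * y j)) v)"

lemma subG_D:
  "subG J n g \<Longrightarrow> range x \<subseteq> J \<Longrightarrow> range y \<subseteq> J \<Longrightarrow>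
     0 \<le> qform n (\<lambda>i j. g (x i * x j) + g (y i * y j) - g (x i * x j + y i * y j)) v"
  by (auto simp: subG_def)

lemma subG_antimono:
  assumes "subG J n g" "m \<le> n" shows "subG J m g"
  unfolding subG_def
proof (intro allI impI)
  fix x y v :: "nat \<Rightarrow> real" assume "range x \<subseteq> J" "range y \<subseteq> J"
  from subG_D[OF assms(1) this, of "\<lambda>i. if i < m then v i else 0"]
  show "0 \<le> qform m (\<lambda>i j. g (x i * x j) + g (y i * y j) - g (x i * x j + y i * y j)) v"
    unfolding qform_restrict[OF assms(2)] .
qed

lemma subG_UNIV: "subG UNIV n g \<Longrightarrow> subG J n g"
  by (auto simp: subG_def)

lemma subG_le_1:
  assumes "subG {0..} 2 (spow s \<alpha>)" shows "\<alpha> \<le> 1"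
proof -
  have "subG {0..} 1 (spow s \<alpha>)" using subG_antimono[OF assms] by simp
  then have "0 \<le> 2 - spow s \<alpha> 2"
    using subG_D[of "{0..}" 1 "spow s \<alpha>" "\<lambda>_. 1" "\<lambda>_. 1" "\<lambda>_. 1"] by (simp add: qform_def)
  then have "2 powr \<alpha> \<le> 2 powr 1" by (simp add: spow_pos)
  then show ?thesis by (subst (asm) powr_le_cancel_iff) auto
qed

text \<open>With \<open>x = (1, 1, \<dots>)\<close>, \<open>y\<^sub>i = sqrt e * 2 ^ i\<close> and weights annihilating \<open>2 powr (\<alpha> * i)\<close>,
  only the binomial expansion of \<open>(1 + e * 2 ^ (i + j)) powr \<alpha>\<close> without its constant term remains.\<close>

lemma subG_expansion:
  assumes sub: "subG {0..} n (spow s \<alpha>)" and v: "(\<Sum>i<n. v i * (2 powr \<alpha>) ^ i) = 0" and e: "0 < e"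
  shows "qform n (\<lambda>i j. (1 + e * 2 ^ (i + j)) powr \<alpha>) v \<le> (\<Sum>i<n. v i)^2"
proof -
  have "0 \<le> qform n (\<lambda>i j. spow s \<alpha> (1 * 1) + spow s \<alpha> ((sqrt e * 2 ^ i) * (sqrt e * 2 ^ j))
      - spow s \<alpha> (1 * 1 + (sqrt e * 2 ^ i) * (sqrt e * 2 ^ j))) v"
    using e by (intro subG_D[OF sub, of "\<lambda>_. 1" "\<lambda>i. sqrt e * 2 ^ i"]) auto
  also have "\<dots> = qform n (\<lambda>i j. 1 * 1 + e powr \<alpha> * ((2 powr \<alpha>) ^ i * (2 powr \<alpha>) ^ j)
      - (1 + e * 2 ^ (i + j)) powr \<alpha>) v"
    using e by (simp only: spow_sqrt_scaled less_imp_le) simp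
  also have "\<dots> = (\<Sum>i<n. v i * 1)^2 + e powr \<alpha> * (\<Sum>i<n. v i * (2 powr \<alpha>) ^ i)^2 -
     qform n (\<lambda>i j. (1 + e * 2 ^ (i + j)) powr \<alpha>) v"
    by (simp only: qform_diff qform_add qform_scale[of n "e powr \<alpha>"] qform_rank1)
  finally show ?thesis using v by simp
qed

text \<open>The weight polynomial \<open>c - 2 powr \<alpha>\<close> removes the term of order
  \<alpha>. What remains at order one is \<alpha> times a positive square, while sub-additivity asks
  for a nonpositive coefficient.\<close>

lemma subG_not_between_0_1:
  assumes sub: "subG {0..} 2 (spow s \<alpha>)" and \<alpha>: "0 < \<alpha>" "\<alpha> < 1"
  shows False
proof -
  obtain v where v: "\<And>c::real. (\<Sum>i<2. v i * c ^ i) = c - 2 powr \<alpha>"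
    using weights_with_roots[of "{2 powr \<alpha>}"] by (auto simp: numeral_2_eq_2)
  have lim: "((\<lambda>e. (qform 2 (\<lambda>i j. (1 + e * 2 ^ (i + j)) powr \<alpha>) v -
      (\<Sum>l\<le>1. fall \<alpha> l / fact l * e ^ l * (\<Sum>i<2. v i * (2 ^ l) ^ i)^2)) / e powr 1) \<longlongrightarrow> 0) (at_right 0)"
    by (rule binomial_qform_expansion) simp
  have "0 \<le> - \<alpha> * (2 - 2 powr \<alpha>)^2"
  proof (rule tendsto_upperbound[OF lim])
    show "\<forall>\<^sub>F e in at_right 0. (qform 2 (\<lambda>i j. (1 + e * 2 ^ (i + j)) powr \<alpha>) v -
      (\<Sum>l\<le>1. fall \<alpha> l / fact l * e ^ l * (\<Sum>i<2. v i * (2 ^ l) ^ i)^2)) / e powr 1 \<le> - \<alpha> * (2 - 2 powr \<alpha>)^2"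
    proof (rule eventually_mono[OF eventually_at_right_less])
      fix e :: real assume e: "0 < e"
      have "(\<Sum>i<2. v i) = 1 - 2 powr \<alpha>" using v[of 1] by simp
      then have "qform 2 (\<lambda>i j. (1 + e * 2 ^ (i + j)) powr \<alpha>) v \<le> (1 - 2 powr \<alpha>)^2"
        using subG_expansion[OF sub, of v e] v[of "2 powr \<alpha>"] e by simp
      then show "(qform 2 (\<lambda>i j. (1 + e * 2 ^ (i + j)) powr \<alpha>) v -
        (\<Sum>l\<le>1. fall \<alpha> l / fact l * e ^ l * (\<Sum>i<2. v i * (2 ^ l) ^ i)^2)) / e powr 1 \<le> - \<alpha> * (2 - 2 powr \<alpha>)^2"
        unfolding v using e by (simp add: fall_def divide_le_eq mult_ac)
    qed
  qed simp
  moreover have "2 powr \<alpha> \<noteq> 2" using powr_less_mono[of \<alpha> 1 2] \<alpha> by simp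
  then have "0 < \<alpha> * (2 - 2 powr \<alpha>)^2" using \<alpha> by simp
  ultimately show False by simp
qed

text \<open>For negative \<alpha> the coefficient of order one has the sign that sub-additivity
  allows. A second root at 2, hence a third index, removes it, and the coefficient \<alpha>
  (\<alpha> - 1) / 2 of order two has the forbidden sign.\<close>

lemma subG_3_nonneg:
  assumes sub: "subG {0..} 3 (spow s \<alpha>)"
  shows "0 \<le> \<alpha>"
proof (rule ccontr)
  assume "\<not> 0 \<le> \<alpha>"
  then have \<alpha>: "\<alpha> < 0" by simp
  then have p: "2 powr \<alpha> < 1" using powr_less_mono[of \<alpha> 0 2] by simp
  then have "card {2 powr \<alpha>, 2} = 2" by simp
  then obtain v where v: "\<And>c::real. (\<Sum>i<3. v i * c ^ i) = (c - 2 powr \<alpha>) * (c - 2)"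
    using weights_with_roots[of "{2 powr \<alpha>, 2}"] p by (auto simp: numeral_3_eq_3)
  have lim: "((\<lambda>e. (qform 3 (\<lambda>i j. (1 + e * 2 ^ (i + j)) powr \<alpha>) v -
      (\<Sum>l\<le>2. fall \<alpha> l / fact l * e ^ l * (\<Sum>i<3. v i * (2 ^ l) ^ i)^2)) / e powr 2) \<longlongrightarrow> 0) (at_right 0)"
    by (rule binomial_qform_expansion) simp
  let ?c = "\<alpha> * (\<alpha> - 1) / 2 * ((4 - 2 powr \<alpha>) * 2)^2"
  have "0 \<le> - ?c"
  proof (rule tendsto_upperbound[OF lim])
    show "\<forall>\<^sub>F e in at_right 0. (qform 3 (\<lambda>i j. (1 + e * 2 ^ (i + j)) powr \<alpha>) v -
      (\<Sum>l\<le>2. fall \<alpha> l / fact l * e ^ l * (\<Sum>i<3. v i * (2 ^ l) ^ i)^2)) / e powr 2 \<le> - ?c"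
    proof (rule eventually_mono[OF eventually_at_right_less])
      fix e :: real assume e: "0 < e"
      have s1: "(\<Sum>i<3. v i) = (1 - 2 powr \<alpha>) * (1 - 2)" using v[of 1] by simp
      have "qform 3 (\<lambda>i j. (1 + e * 2 ^ (i + j)) powr \<alpha>) v \<le> ((1 - 2 powr \<alpha>) * (1 - 2))^2"
        using subG_expansion[OF sub, of v e] v[of "2 powr \<alpha>"] e unfolding s1 by simp
      moreover have "(\<Sum>l\<le>2. fall \<alpha> l / fact l * e ^ l * ((2 ^ l - 2 powr \<alpha>) * (2 ^ l - 2))^2) =
        ((1 - 2 powr \<alpha>) * (1 - 2))^2 + ?c * e^2"
        by (simp add: fall_def numeral_2_eq_2 lessThan_Suc)
      ultimately have "qform 3 (\<lambda>i j. (1 + e * 2 ^ (i + j)) powr \<alpha>) v -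
        (\<Sum>l\<le>2. fall \<alpha> l / fact l * e ^ l * (\<Sum>i<3. v i * (2 ^ l) ^ i)^2) \<le> - ?c * e^2"
        unfolding v by simp
      then show "(qform 3 (\<lambda>i j. (1 + e * 2 ^ (i + j)) powr \<alpha>) v -
        (\<Sum>l\<le>2. fall \<alpha> l / fact l * e ^ l * (\<Sum>i<3. v i * (2 ^ l) ^ i)^2)) / e powr 2 \<le> - ?c"
        using e by (subst powr_numeral) (auto simp: divide_le_eq)
    qed
  qed simp
  moreover have "0 < \<alpha> * (\<alpha> - 1)" using \<alpha> by (intro mult_neg_neg) auto
  then have "0 < ?c" using p by simp
  ultimately show False by simp
qed

section \<open>Sub-additivity with entries of both signs\<close>

lemma subG_phi_False: "\<not> subG UNIV 2 (spow False \<alpha>)"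
proof
  assume "subG UNIV 2 (spow False \<alpha>)"
  \<comment> \<open>Off the diagonal 1 and - 1 cancel, so the entry is \<phi>(1) + \<phi>(- 1) -
    \<phi>(0) = 2, above the diagonal value 2 - 2 powr \<alpha>.\<close>
  from subG_D[OF this, of "\<lambda>_. 1" "\<lambda>i. if i = 0 then 1 else - 1" "\<lambda>i. if i = 0 then 1 else - 1"]
  have "0 \<le> - (2 * 2 powr \<alpha>)"
    by (simp add: qform_def numeral_2_eq_2 spow_def)
  then show False by simp
qed

text \<open>With \<open>y = (b, - 1)\<close> and \<open>b\<close> just below 1 the off-diagonal sum
  is the small positive number \<open>1 - b\<close>, where a negative power is huge, while the other
  terms stay bounded.\<close>

lemma subG_psi_nonneg:
  assumes "subG UNIV 2 (spow True \<alpha>)" shows "0 \<le> \<alpha>"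
proof (rule ccontr)
  assume "\<not> 0 \<le> \<alpha>"
  then have \<alpha>: "\<alpha> < 0" by simp
  \<comment> \<open>\<open>M\<close> bounds \<open>(b * b) powr \<alpha>\<close> for
    \<open>b \<ge> 1 / 2\<close>, and \<open>d\<close> solves
    \<open>d powr \<alpha> = 5 + M\<close>; the form is then at most 1 + M + 2 + 2 (1 - 5 - M) <
    0.\<close>
  define M where "M = (1 / 2) powr (2 * \<alpha>)"
  define d where "d = (5 + M) powr (1 / \<alpha>)"
  define b where "b = 1 - d"
  have "M > 0" by (simp add: M_def)
  have da: "d powr \<alpha> = 5 + M" using \<alpha> \<open>M > 0\<close> by (simp add: d_def powr_powr)
  have d0: "0 < d" using \<open>M > 0\<close> by (simp add: d_def)
  have "d \<le> 1 / 2"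
  proof (rule ccontr)
    assume "\<not> d \<le> 1 / 2"
    then have "d powr \<alpha> \<le> (1 / 2) powr \<alpha>" using \<alpha> by (intro powr_mono2') auto
    also have "\<dots> \<le> (1 / 2) powr (2 * \<alpha>)" using \<alpha> by (intro powr_mono') auto
    finally show False using da by (simp add: M_def)
  qed
  then have b: "1 / 2 \<le> b" "b < 1" using d0 by (auto simp: b_def)
  have "b powr (2 * \<alpha>) \<le> M" unfolding M_def using \<alpha> b by (intro powr_mono2') auto
  then have bb: "(b * b) powr \<alpha> \<le> M" using b by (simp add: powr_mult powr_add[symmetric])
  from subG_D[OF assms, of "\<lambda>_. 1" "\<lambda>i. if i = 0 then b else - 1" "\<lambda>_. 1"]
  have "0 \<le> 1 + spow True \<alpha> (b * b) - spow True \<alpha> (1 + b * b) + (2 - spow True \<alpha> 2)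
     + 2 * (1 + spow True \<alpha> (- b) - spow True \<alpha> d)"
    by (simp add: qform_def numeral_2_eq_2 b_def[symmetric]) (simp add: b_def)
  also have "spow True \<alpha> (b * b) = (b * b) powr \<alpha>" using b by (intro spow_pos) auto
  also have "spow True \<alpha> d = 5 + M" using d0 da by (simp add: spow_pos)
  finally have "0 \<le> 1 + (b * b) powr \<alpha> - spow True \<alpha> (1 + b * b) + (2 - spow True \<alpha> 2)
     + 2 * (1 + spow True \<alpha> (- b) - (5 + M))" .
  moreover have "0 \<le> spow True \<alpha> (1 + b * b)" "0 \<le> spow True \<alpha> 2" by (auto intro!: spow_nonneg)
  moreover have "spow True \<alpha> (- b) \<le> 0" using b by (simp add: spow_def)
  moreover have False
    if "0 \<le> 1 + p - q + (2 - r) + 2 * (1 + t - (5 + M))" "0 \<le> q" "0 \<le> r" "t \<le> 0" "p \<le> M" for p q r t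
    using that \<open>M > 0\<close> by (simp add: algebra_simps)
  ultimately show False using bb by blast
qed

lemma subG_psi_0_False: "\<not> subG UNIV 3 (spow True 0)"
proof
  assume "subG UNIV 3 (spow True 0)"
  \<comment> \<open>The resulting matrix has ones on and next to the diagonal and zeros at (0, 2)
    and (2, 0); its form at \<open>(1, - 1, 1)\<close> is - 1.\<close>
  from subG_D[OF this, of "\<lambda>_. 1" "\<lambda>i. if i = 0 then 1 else if i = 1 then 2 else - 1"
      "\<lambda>i. if i = 1 then - 1 else 1"]
  show False by (simp add: qform_def numeral_3_eq_3 spow_def)
qed

text \<open>The quotient \<open>(1 + z powr \<alpha> - (1 + z) powr \<alpha>) / z powr \<alpha>\<close>, in the form \<open>1 +\<close> a product of two
  nonnegative increasing functions.\<close>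

lemma gap_quotient:
  fixes \<alpha> z :: real
  assumes \<alpha>: "\<alpha> \<le> 0" and z: "0 < z"
  shows "1 + z powr \<alpha> - (1 + z) powr \<alpha> = z powr \<alpha> * (1 + z powr (- \<alpha>) * (1 - (1 + z) powr \<alpha>))"
proof -
  have "z powr \<alpha> * z powr (- \<alpha>) = 1" using z by (simp add: powr_add[symmetric])
  then show ?thesis by (simp add: algebra_simps)
qed

lemma gap_log_convex:
  fixes \<alpha> :: real
  assumes \<alpha>: "\<alpha> \<le> 0"
  shows "convex_on UNIV (\<lambda>t. ln (1 + exp t powr \<alpha> - (1 + exp t) powr \<alpha>))"
proof -
  define N where "N z = 1 - (z / (1 + z)) powr (1 - \<alpha>)" for z :: real
  define M where "M z = 1 + z powr (- \<alpha>) * (1 - (1 + z) powr \<alpha>)" for z :: real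
  define \<gamma> where "\<gamma> z = 1 + z powr \<alpha> - (1 + z) powr \<alpha>" for z :: real
  have le1: "(1 + z) powr \<alpha> \<le> 1" if "0 < z" for z :: real
    using powr_mono[of \<alpha> 0 "1 + z"] \<alpha> that by simp
  have M1: "1 \<le> M z" if "0 < z" for z using le1[OF that] by (simp add: M_def)
  have \<gamma>M: "\<gamma> z = z powr \<alpha> * M z" if "0 < z" for z
    using gap_quotient[OF \<alpha> that] by (simp add: \<gamma>_def M_def)
  have \<gamma>0: "0 < \<gamma> z" if "0 < z" for z using M1[OF that] that by (simp add: \<gamma>M)
  have Mmono: "M y \<le> M z" if "0 < y" "y \<le> z" for y z
  proof -
    have "y powr (- \<alpha>) \<le> z powr (- \<alpha>)" using that \<alpha> by (intro powr_mono2) auto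
    moreover have "(1 + z) powr \<alpha> \<le> (1 + y) powr \<alpha>" using that \<alpha> by (intro powr_mono2') auto
    ultimately have "y powr (- \<alpha>) * (1 - (1 + y) powr \<alpha>) \<le> z powr (- \<alpha>) * (1 - (1 + z) powr \<alpha>)"
      using le1[of y] that by (intro mult_mono) auto
    then show ?thesis by (simp add: M_def)
  qed
  have Nmono: "N z \<le> N y" if "0 < y" "y \<le> z" for y z
  proof -
    have "y / (1 + y) \<le> z / (1 + z)" using that by (simp add: divide_simps algebra_simps)
    then have "(y / (1 + y)) powr (1 - \<alpha>) \<le> (z / (1 + z)) powr (1 - \<alpha>)"
      using that \<alpha> by (intro powr_mono2) auto
    then show ?thesis by (simp add: N_def)
  qed
  have N0: "0 \<le> N z" if "0 < z" for z
    using that \<alpha> powr_le1[of "1 - \<alpha>" "z / (1 + z)"] by (simp add: N_def)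
  have "convex_on UNIV (\<lambda>t. ln (\<gamma> (exp t)))"
  proof (rule convex_on_realI[where f' = "\<lambda>t. \<alpha> * (N (exp t) / M (exp t))"])
    fix t :: real
    let ?z = "exp t"
    have dg: "((\<lambda>t. \<gamma> (exp t)) has_real_derivative \<alpha> * (?z powr \<alpha> - ?z * (1 + ?z) powr (\<alpha> - 1))) (at t)"
      unfolding \<gamma>_def
      by (auto intro!: derivative_eq_intros simp: add_pos_pos powr_diff algebra_simps)
    have "((\<lambda>t. ln (\<gamma> (exp t))) has_real_derivative
        (1 / \<gamma> ?z) * (\<alpha> * (?z powr \<alpha> - ?z * (1 + ?z) powr (\<alpha> - 1)))) (at t)"
      by (rule DERIV_chain2[OF DERIV_ln_divide dg]) (simp add: \<gamma>0)
    moreover have "?z powr \<alpha> - ?z * (1 + ?z) powr (\<alpha> - 1) = ?z powr \<alpha> * N ?z"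
    proof -
      have "(?z / (1 + ?z)) powr (1 - \<alpha>) = ?z powr (1 - \<alpha>) / (1 + ?z) powr (1 - \<alpha>)"
        by (simp add: powr_divide)
      also have "\<dots> = ?z powr (1 - \<alpha>) * (1 + ?z) powr (\<alpha> - 1)"
        using powr_minus_divide[of "1 + ?z" "1 - \<alpha>"] by simp
      finally have "?z powr \<alpha> * (?z / (1 + ?z)) powr (1 - \<alpha>) = ?z * (1 + ?z) powr (\<alpha> - 1)"
        by (simp add: powr_add[symmetric] mult.assoc[symmetric])
      then show ?thesis by (simp add: N_def right_diff_distrib)
    qed
    ultimately show "((\<lambda>t. ln (\<gamma> (exp t))) has_real_derivative \<alpha> * (N ?z / M ?z)) (at t)"
      by (simp add: \<gamma>M)
  next
    fix s t :: real assume "s \<le> t"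
    then have "N (exp t) / M (exp t) \<le> N (exp s) / M (exp s)"
      using Nmono[of "exp s" "exp t"] Mmono[of "exp s" "exp t"] N0[of "exp s"] M1[of "exp s"]
      by (intro frac_le) auto
    then show "\<alpha> * (N (exp s) / M (exp s)) \<le> \<alpha> * (N (exp t) / M (exp t))"
      using \<alpha> by (intro mult_left_mono_neg)
  qed auto
  then show ?thesis by (simp add: \<gamma>_def)
qed

lemma gap_nonneg:
  fixes \<alpha> z :: real
  assumes \<alpha>: "\<alpha> \<le> 0" and z: "0 < z"
  shows "0 < 1 + z powr \<alpha> - (1 + z) powr \<alpha>"
proof -
  have "(1 + z) powr \<alpha> \<le> 1" using powr_mono[of \<alpha> 0 "1 + z"] \<alpha> z by simp
  moreover have "0 < z powr \<alpha>" using z by simp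
  ultimately show ?thesis by linarith
qed

text \<open>Midpoint log-convexity: \<open>a * b\<close> is the geometric mean of
  \<open>a * a\<close> and \<open>b * b\<close>, so its logarithm is the midpoint of theirs.\<close>

lemma gap_square_le:
  fixes \<alpha> a b :: real
  defines "\<gamma> \<equiv> \<lambda>z. 1 + z powr \<alpha> - (1 + z) powr \<alpha>"
  assumes \<alpha>: "\<alpha> \<le> 0" and ab: "0 < a" "0 < b"
  shows "(\<gamma> (a * b))^2 \<le> \<gamma> (a * a) * \<gamma> (b * b)"
proof -
  have pos: "0 < \<gamma> z" if "0 < z" for z unfolding \<gamma>_def using gap_nonneg[OF \<alpha> that] .
  let ?L = "\<lambda>t. ln (\<gamma> (exp t))"
  have L: "?L ((1 - 1/2) *\<^sub>R (ln a + ln a) + (1/2) *\<^sub>R (ln b + ln b)) \<le>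
      (1 - 1/2) * ?L (ln a + ln a) + 1/2 * ?L (ln b + ln b)"
    unfolding \<gamma>_def by (rule convex_onD[OF gap_log_convex[OF \<alpha>]]) auto
  have m: "(1 - 1/2) *\<^sub>R (ln a + ln a) + (1/2) *\<^sub>R (ln b + ln b) = ln a + ln b" by simp
  have e: "exp (ln a + ln a) = a * a" "exp (ln b + ln b) = b * b" "exp (ln a + ln b) = a * b"
    unfolding exp_add using ab by simp_all
  from L[unfolded m e] have "2 * ln (\<gamma> (a * b)) \<le> ln (\<gamma> (a * a)) + ln (\<gamma> (b * b))" by simp
  then have "ln ((\<gamma> (a * b))^2) \<le> ln (\<gamma> (a * a) * \<gamma> (b * b))"
    using ab by (simp add: ln_realpow ln_mult_pos[OF pos pos])
  then show ?thesis using ab pos[of "a * b"]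
    by (subst (asm) ln_le_cancel_iff) (auto intro!: mult_pos_pos pos)
qed

text \<open>By homogeneity the factor \<open>x i * x j\<close> comes out and leaves the gap at
  \<open>(y i / x i) * (y j / x j)\<close>, so the determinant condition is
  \<open>gap_square_le\<close>. An entry with a vanishing coordinate is 0, thanks to the value 0 at
  0.\<close>

lemma sub_additive_2_nonpos:
  fixes x y :: "nat \<Rightarrow> real"
  assumes \<alpha>: "\<alpha> \<le> 0" and x: "\<And>i. 0 \<le> x i" and y: "\<And>i. 0 \<le> y i"
  shows "PSD 2 (\<lambda>i j. spow False \<alpha> (x i * x j) + spow False \<alpha> (y i * y j) - spow False \<alpha> (x i * x j + y i * y j))"
proof (rule PSD_2I)
  let ?g = "spow False \<alpha>"
  let ?F = "\<lambda>i j. ?g (x i * x j) + ?g (y i * y j) - ?g (x i * x j + y i * y j)"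
  define \<gamma> where "\<gamma> = (\<lambda>z. 1 + z powr \<alpha> - (1 + z) powr \<alpha>)"
  have F: "?F i j = ?g (x i) * ?g (x j) * \<gamma> ((y i / x i) * (y j / x j))" if "0 < x i" "0 < x j" "0 < y i" "0 < y j" for i j
  proof -
    let ?z = "(y i / x i) * (y j / x j)"
    have z: "0 < ?z" using that by simp
    have "?F i j = ?g (x i * x j) + ?g (x i * x j * ?z) - ?g (x i * x j * (1 + ?z))"
      using that by (simp add: distrib_left)
    also have "\<dots> = ?g (x i * x j) * (1 + ?g ?z - ?g (1 + ?z))"
      unfolding spow_mult[of _ _ "x i * x j"] by (simp add: algebra_simps)
    finally show ?thesis using z by (simp add: \<gamma>_def spow_pos spow_mult[of _ _ "x i" "x j"])
  qed
  have Fz: "?F i j = 0" if "x i = 0 \<or> x j = 0 \<or> y i = 0 \<or> y j = 0" for i j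
    using that by auto
  have diag: "0 \<le> ?F i i" for i
  proof (cases "x i = 0 \<or> y i = 0")
    case False
    then have p: "0 < x i" "0 < y i" using x[of i] y[of i] by auto
    have "0 < \<gamma> ((y i / x i) * (y i / x i))" unfolding \<gamma>_def using p by (intro gap_nonneg \<alpha>) auto
    then show ?thesis using F[of i i] p by simp
  qed (use Fz[of i i] in auto)
  show "?F 1 0 = ?F 0 1" by (simp add: mult.commute)
  show "0 \<le> ?F 0 0" "0 \<le> ?F 1 1" by (rule diag)+
  show "(?F 0 1)^2 \<le> ?F 0 0 * ?F 1 1"
  proof (cases "x 0 = 0 \<or> x 1 = 0 \<or> y 0 = 0 \<or> y 1 = 0")
    case True
    then have "?F 0 1 = 0" by (rule Fz)
    then show ?thesis using mult_nonneg_nonneg[OF diag[of 0] diag[of 1]] by simp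
  next
    case False
    then have p: "0 < x 0" "0 < x 1" "0 < y 0" "0 < y 1" using x[of 0] x[of 1] y[of 0] y[of 1] by auto
    let ?a = "y 0 / x 0" and ?b = "y 1 / x 1"
    have "(?F 0 1)^2 = (?g (x 0) * ?g (x 1))^2 * (\<gamma> (?a * ?b))^2"
      unfolding F[OF p] by (simp add: power_mult_distrib)
    also have "\<dots> \<le> (?g (x 0) * ?g (x 1))^2 * (\<gamma> (?a * ?a) * \<gamma> (?b * ?b))"
      unfolding \<gamma>_def using p by (intro mult_left_mono gap_square_le \<alpha>) auto
    also have "\<dots> = ?F 0 0 * ?F 1 1"
      unfolding F[OF p(1,1,3,3)] F[OF p(2,2,4,4)] by (simp add: power2_eq_square)
    finally show ?thesis .
  qed
qed

text \<open>At exponent 0 a nonnegative entry is replaced by the indicator of being nonzero. The gap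
  is the product of the two indicators, and at rank one each of these factors over \<open>i\<close>
  and \<open>j\<close>; so the gap has the form \<open>w i * w j\<close> in every dimension.\<close>

lemma sub_additive_0_rank1:
  assumes x: "\<And>i. 0 \<le> x i" and y: "\<And>i. 0 \<le> y i"
  shows "PSD n (\<lambda>i j. spow False 0 (x i * x j) + spow False 0 (y i * y j) - spow False 0 (x i * x j + y i * y j))"
proof (rule PSD_cong[OF PSD_rank1])
  fix i j
  let ?w = "\<lambda>i. spow False 0 (x i) * spow False 0 (y i)"
  show "?w i * ?w j = spow False 0 (x i * x j) + spow False 0 (y i * y j) - spow False 0 (x i * x j + y i * y j)"
    using x[of i] x[of j] y[of i] y[of j] by (auto simp: spow_def add_nonneg_eq_0_iff)
qed

subsection \<open>Matrices of rank at most one\<close>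

text \<open>Weights orthogonal to \<open>x\<close> on a pair of indices make the form minus a
  square, namely of \<open>y i * x p - y p * x i\<close>. Hence \<open>y\<close> is a multiple of
  \<open>x\<close>, and the diagonal bounds the factor.\<close>

lemma rank1_ordered:
  assumes P: "PSD n (\<lambda>i j. x i * x j - y i * y j)"
  obtains c where "0 \<le> c" "c \<le> 1" "\<And>i j. i < n \<Longrightarrow> j < n \<Longrightarrow> y i * y j = c * (x i * x j)"
proof (cases "\<exists>p<n. x p \<noteq> 0")
  case True
  then obtain p where p: "p < n" "x p \<noteq> 0" by auto
  define d where "d = y p / x p"
  have y: "y i = d * x i" if i: "i < n" for i
  proof (cases "i = p")
    case False
    have "(y i * x p - y p * x i)^2 \<le> 0"
      using PSD_pair[OF P i p(1) False, of "x p" "- x i"] by (simp add: power2_eq_square algebra_simps)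
    then have "y i * x p = y p * x i" by simp
    then show ?thesis using p by (simp add: d_def field_simps)
  qed (use p in \<open>simp add: d_def\<close>)
  have "d^2 * (x p)^2 \<le> 1 * (x p)^2"
    using PSD_diag[OF P p(1)] y[OF p(1)] by (simp add: power2_eq_square algebra_simps)
  then have "d^2 \<le> 1" using p by (subst (asm) mult_le_cancel_right) auto
  then show ?thesis using y by (intro that[of "d^2"]) (auto simp: power2_eq_square)
next
  case False
  then have "y i = 0" if "i < n" for i
    using PSD_diag[OF P that] that by (auto simp: mult_le_0_iff)
  then show ?thesis by (intro that[of 0]) auto
qed

lemma spow_unit_interval:
  assumes "0 \<le> \<alpha>" "0 \<le> c" "c \<le> 1" shows "spow s \<alpha> c \<le> 1"
  using assms powr_le1[of \<alpha> c] by (cases "c = 0") (auto simp: spow_pos)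

lemma spow_chord:
  assumes \<alpha>: "1 \<le> \<alpha>" and l: "0 \<le> l" "l \<le> 1" and c: "0 \<le> c" "c \<le> 1"
  shows "spow s \<alpha> (l + (1 - l) * c) \<le> l + (1 - l) * spow s \<alpha> c"
proof (cases "c = 0")
  case True
  show ?thesis
  proof (cases "l = 0")
    case False
    then have "l powr \<alpha> \<le> l powr 1" using l \<alpha> by (intro powr_mono') auto
    then show ?thesis using True False l by (simp add: spow_pos)
  qed (use True in simp)
next
  case False
  then have c: "0 < c" using c by simp
  have pos: "0 < l + (1 - l) * c"
    using c l by (cases "l = 0") (auto intro: add_pos_nonneg)
  have "(\<lambda>x. x powr \<alpha>) ((1 - l) *\<^sub>R c + l *\<^sub>R 1) \<le> (1 - l) * (c powr \<alpha>) + l * (1 powr \<alpha>)"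
    using c l by (intro convex_onD[OF powr_convex[OF \<alpha>]]) auto
  then show ?thesis using pos c by (simp add: spow_pos add.commute)
qed

lemma positive_on_rank1:
  assumes g: "agree I g (spow s \<alpha>)"
  shows "positive_on n I (psd_rank n 1 I) g"
  unfolding positive_on_def
proof
  fix A assume A1: "A \<in> psd_rank n 1 I"
  note A = psd_D[OF subsetD[OF psd_rank_psd A1]]
  obtain x where x: "\<And>i j. i < n \<Longrightarrow> j < n \<Longrightarrow> A $$ (i,j) = x i * x j" by (rule psd_rank_1E[OF A1]) blast
  have "PSD n (\<lambda>i j. map_mat g A $$ (i,j) - 0\<^sub>m n n $$ (i,j))"
    by (rule PSD_cong[OF PSD_rank1[of n "\<lambda>i. spow s \<alpha> (x i)"]])
      (use A agreeD[OF g] x in \<open>simp add: spow_mult\<close>)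
  then show "loewner_le n (0\<^sub>m n n) (map_mat g A)" using A(1) by (simp add: loewner_le_iff)
qed

lemma rank1_ordered_mats:
  assumes A: "A \<in> psd_rank n 1 I" and B: "B \<in> psd_rank n 1 I" and le: "loewner_le n B A"
  obtains c x where "0 \<le> c" "c \<le> 1" "\<And>i j. i < n \<Longrightarrow> j < n \<Longrightarrow> A $$ (i,j) = x i * x j"
    "\<And>i j. i < n \<Longrightarrow> j < n \<Longrightarrow> B $$ (i,j) = c * (x i * x j)"
proof -
  note A' = psd_D[OF subsetD[OF psd_rank_psd A]] and B' = psd_D[OF subsetD[OF psd_rank_psd B]]
  obtain x where x: "\<And>i j. i < n \<Longrightarrow> j < n \<Longrightarrow> A $$ (i,j) = x i * x j" by (rule psd_rank_1E[OF A]) blast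
  obtain y where y: "\<And>i j. i < n \<Longrightarrow> j < n \<Longrightarrow> B $$ (i,j) = y i * y j" by (rule psd_rank_1E[OF B]) blast
  have "PSD n (\<lambda>i j. A $$ (i,j) - B $$ (i,j))" using le A'(1) B'(1) by (simp add: loewner_le_iff)
  then have "PSD n (\<lambda>i j. x i * x j - y i * y j)" by (rule PSD_cong) (simp add: x y)
  from rank1_ordered[OF this] obtain c where
    "0 \<le> c" "c \<le> 1" "\<And>i j. i < n \<Longrightarrow> j < n \<Longrightarrow> y i * y j = c * (x i * x j)" by blast
  then show ?thesis using x y by (intro that[of c x]) auto
qed

text \<open>\<open>B\<close> is \<open>c\<close> times \<open>A\<close>, so by multiplicativity the
  difference is the scalar \<open>1 - spow s \<alpha> c\<close> times a rank-one matrix.\<close>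

lemma monotone_loewner_on_rank1:
  assumes g: "agree I g (spow s \<alpha>)" and \<alpha>: "0 \<le> \<alpha>"
  shows "monotone_loewner_on n I (psd_rank n 1 I) g"
  unfolding monotone_loewner_on_def
proof (intro ballI impI)
  fix A B assume A1: "A \<in> psd_rank n 1 I" and B1: "B \<in> psd_rank n 1 I" and le: "loewner_le n B A"
  note A = psd_D[OF subsetD[OF psd_rank_psd A1]] and B = psd_D[OF subsetD[OF psd_rank_psd B1]]
  obtain c x where c: "0 \<le> c" "c \<le> 1" and
    x: "\<And>i j. i < n \<Longrightarrow> j < n \<Longrightarrow> A $$ (i,j) = x i * x j"
    and y: "\<And>i j. i < n \<Longrightarrow> j < n \<Longrightarrow> B $$ (i,j) = c * (x i * x j)"
    by (rule rank1_ordered_mats[OF A1 B1 le]) blast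
  have "PSD n (\<lambda>i j. map_mat g A $$ (i,j) - map_mat g B $$ (i,j))"
  proof (rule PSD_cong[OF PSD_scale[OF PSD_rank1[of n "\<lambda>i. spow s \<alpha> (x i)"]]])
    show "0 \<le> 1 - spow s \<alpha> c" using spow_unit_interval[OF \<alpha> c] by simp
    fix i j assume ij: "i < n" "j < n"
    have "map_mat g A $$ (i,j) - map_mat g B $$ (i,j) = spow s \<alpha> (x i * x j) - spow s \<alpha> (c * (x i * x j))"
      using A(1) B(1) agreeD[OF g A(3)[OF ij]] agreeD[OF g B(3)[OF ij]] ij
      by (simp only: x[OF ij] y[OF ij] index_map_mat carrier_matD)
    then show "(1 - spow s \<alpha> c) * (spow s \<alpha> (x i) * spow s \<alpha> (x j)) = map_mat g A $$ (i,j) - map_mat g B $$ (i,j)"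
      by (simp add: spow_mult algebra_simps)
  qed
  then show "loewner_le n (map_mat g B) (map_mat g A)" using A(1) B(1) by (simp add: loewner_le_iff)
qed

text \<open>Proportionality reduces the claim to the scalar chord inequality
  \<open>spow_chord\<close> between \<open>c\<close> and 1.\<close>

lemma convex_loewner_on_rank1:
  assumes g: "agree I g (spow s \<alpha>)" and \<alpha>: "1 \<le> \<alpha>" and I: "convex I"
  shows "convex_loewner_on n I (psd_rank n 1 I) g"
  unfolding convex_loewner_on_def
proof (intro ballI allI impI)
  fix A B and l :: real
  assume A1: "A \<in> psd_rank n 1 I" and B1: "B \<in> psd_rank n 1 I" and le: "loewner_le n B A" and l: "0 \<le> l" "l \<le> 1"
  note A = psd_D[OF subsetD[OF psd_rank_psd A1]] and B = psd_D[OF subsetD[OF psd_rank_psd B1]]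
  obtain c x where c: "0 \<le> c" "c \<le> 1" and
    x: "\<And>i j. i < n \<Longrightarrow> j < n \<Longrightarrow> A $$ (i,j) = x i * x j"
    and y: "\<And>i j. i < n \<Longrightarrow> j < n \<Longrightarrow> B $$ (i,j) = c * (x i * x j)"
    by (rule rank1_ordered_mats[OF A1 B1 le]) blast
  let ?u = "l + (1 - l) * c"
  have "PSD n (\<lambda>i j. (l \<cdot>\<^sub>m map_mat g A + (1 - l) \<cdot>\<^sub>m map_mat g B) $$ (i,j)
      - map_mat g (l \<cdot>\<^sub>m A + (1 - l) \<cdot>\<^sub>m B) $$ (i,j))"
  proof (rule PSD_cong[OF PSD_scale[OF PSD_rank1[of n "\<lambda>i. spow s \<alpha> (x i)"]]])
    show "0 \<le> l + (1 - l) * spow s \<alpha> c - spow s \<alpha> ?u" using spow_chord[OF \<alpha> l c] by simp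
    fix i j assume ij: "i < n" "j < n"
    have e: "l * A $$ (i,j) + (1 - l) * B $$ (i,j) = ?u * (x i * x j)"
      by (simp add: x[OF ij] y[OF ij] algebra_simps)
    have "l * A $$ (i,j) + (1 - l) * B $$ (i,j) \<in> I"
      using convexD[OF I A(3)[OF ij] B(3)[OF ij], of l "1 - l"] l by simp
    then have "(l \<cdot>\<^sub>m map_mat g A + (1 - l) \<cdot>\<^sub>m map_mat g B) $$ (i,j)
      - map_mat g (l \<cdot>\<^sub>m A + (1 - l) \<cdot>\<^sub>m B) $$ (i,j) =
      l * spow s \<alpha> (A $$ (i,j)) + (1 - l) * spow s \<alpha> (B $$ (i,j)) - spow s \<alpha> (l * A $$ (i,j) + (1 - l) * B $$ (i,j))"
      using A(1) B(1) agreeD[OF g] A(3)[OF ij] B(3)[OF ij] ij by simp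
    also have "\<dots> = l * (spow s \<alpha> (x i) * spow s \<alpha> (x j)) + (1 - l) * (spow s \<alpha> c * (spow s \<alpha> (x i) * spow s \<alpha> (x j)))
       - spow s \<alpha> ?u * (spow s \<alpha> (x i) * spow s \<alpha> (x j))"
      unfolding e unfolding x[OF ij] y[OF ij] by (simp only: spow_mult)
    finally show "(l + (1 - l) * spow s \<alpha> c - spow s \<alpha> ?u) * (spow s \<alpha> (x i) * spow s \<alpha> (x j)) =
      (l \<cdot>\<^sub>m map_mat g A + (1 - l) \<cdot>\<^sub>m map_mat g B) $$ (i,j) - map_mat g (l \<cdot>\<^sub>m A + (1 - l) \<cdot>\<^sub>m B) $$ (i,j)"
      by (simp add: algebra_simps)
  qed
  then show "loewner_le n (map_mat g (l \<cdot>\<^sub>m A + (1 - l) \<cdot>\<^sub>m B)) (l \<cdot>\<^sub>m map_mat g A + (1 - l) \<cdot>\<^sub>m map_mat g B)"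
    using A(1) B(1) by (simp add: loewner_le_iff)
qed

section \<open>Bounds on the exponent from constant matrices\<close>

lemma monotone_loewner_on_exponent_nonneg:
  assumes p: "monotone_loewner_on n I (psd_rank n k I) g" and g: "agree I g (spow s \<alpha>)"
    and I: "semiring_set I" "{0..} \<subseteq> I" and k: "1 \<le> k" and n: "1 \<le> n"
  shows "0 \<le> \<alpha>"
proof -
  have J: "gram1 n (\<lambda>_. a) \<in> psd_rank n k I" if "0 \<le> a" for a
    using that I k by (intro gram1_psd_rank) auto
  have "loewner_le n (gram1 n (\<lambda>_. 1)) (gram1 n (\<lambda>_. sqrt 2))"
    by (subst loewner_le_iff) (auto intro!: PSD_cong[OF PSD_rank1[of n "\<lambda>_. 1"]])
  moreover have "loewner_le n (0\<^sub>m n n) (gram1 n (\<lambda>_. 1))"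
    by (subst loewner_le_iff) (auto intro!: PSD_cong[OF PSD_rank1[of n "\<lambda>_. 1"]])
  ultimately have "loewner_le n (map_mat g (gram1 n (\<lambda>_. 1))) (map_mat g (gram1 n (\<lambda>_. sqrt 2)))"
    using p J[of 1] J[of "sqrt 2"] by (auto simp: monotone_loewner_on_def)
  then have "PSD n (\<lambda>i j. map_mat g (gram1 n (\<lambda>_. sqrt 2)) $$ (i,j) - map_mat g (gram1 n (\<lambda>_. 1)) $$ (i,j))"
    by (subst (asm) loewner_le_iff) auto
  from PSD_diag[OF this, of 0] n have "g 1 \<le> g 2" by simp
  moreover have "1 \<in> I" "2 \<in> I" using I(2) by auto
  ultimately have "2 powr 0 \<le> 2 powr \<alpha>" by (simp add: agreeD[OF g] spow_pos)
  then show ?thesis by (subst (asm) powr_le_cancel_iff) auto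
qed

lemma convex_loewner_onD:
  assumes "convex_loewner_on n I V g" "A \<in> V" "B \<in> V" "0 \<le> l" "l \<le> 1"
    "loewner_le n B A" "loewner_le n (0\<^sub>m n n) B"
  shows "loewner_le n (map_mat g (l \<cdot>\<^sub>m A + (1 - l) \<cdot>\<^sub>m B)) (l \<cdot>\<^sub>m map_mat g A + (1 - l) \<cdot>\<^sub>m map_mat g B)"
  using assms unfolding convex_loewner_on_def by blast

lemma convex_loewner_on_exponent_ge_1:
  assumes p: "convex_loewner_on n I (psd_rank n k I) g" and g: "agree I g (spow s \<alpha>)"
    and I: "semiring_set I" "{0..} \<subseteq> I" and k: "1 \<le> k" and n: "1 \<le> n"
  shows "1 \<le> \<alpha>"
proof -
  have J: "gram1 n (\<lambda>_. a) \<in> psd_rank n k I" if "0 \<le> a" for a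
    using that I k by (intro gram1_psd_rank) auto
  let ?A = "gram1 n (\<lambda>_. 1)" and ?B = "gram1 n (\<lambda>_. 0)"
  have "loewner_le n ?B ?A"
    by (subst loewner_le_iff) (auto intro!: PSD_cong[OF PSD_rank1[of n "\<lambda>_. 1"]])
  moreover have "loewner_le n (0\<^sub>m n n) ?B"
    by (subst loewner_le_iff) (auto intro!: PSD_cong[OF PSD_rank1[of n "\<lambda>_. 0"]])
  ultimately have "loewner_le n (map_mat g ((1/2) \<cdot>\<^sub>m ?A + (1 - 1/2) \<cdot>\<^sub>m ?B))
      ((1/2) \<cdot>\<^sub>m map_mat g ?A + (1 - 1/2) \<cdot>\<^sub>m map_mat g ?B)"
    by (intro convex_loewner_onD[OF p J J]) simp_all
  then have "PSD n (\<lambda>i j. ((1/2) \<cdot>\<^sub>m map_mat g ?A + (1 - 1/2) \<cdot>\<^sub>m map_mat g ?B) $$ (i,j) -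
      map_mat g ((1/2) \<cdot>\<^sub>m ?A + (1 - 1/2) \<cdot>\<^sub>m ?B) $$ (i,j))"
    by (subst (asm) loewner_le_iff) auto
  from PSD_diag[OF this, of 0] n have "g (1/2) \<le> 1/2 * g 1 + 1/2 * g 0" by simp
  moreover have "0 \<in> I" "1 \<in> I" "1/2 \<in> I" using I(2) by auto
  ultimately have le: "(1/2) powr \<alpha> \<le> 1/2" by (simp add: agreeD[OF g] spow_pos)
  show ?thesis
  proof (rule ccontr)
    assume "\<not> 1 \<le> \<alpha>"
    then have "(1/2) powr 1 < (1/2::real) powr \<alpha>" by (intro powr_less_mono') auto
    then show False using le by simp
  qed
qed

section \<open>Test matrices for sub-additivity, convexity and positivity\<close>

lemma sub_additive_on_subG:
  assumes p: "sub_additive_on n I (psd_rank n k I) g" and g: "agree I g h" and I: "semiring_set I" and k: "1 \<le> k"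
  shows "subG I n h"
  unfolding subG_def
proof (intro allI impI)
  fix x y v :: "nat \<Rightarrow> real" assume xy: "range x \<subseteq> I" "range y \<subseteq> I"
  note i = semiring_setD[OF I]
  have m: "x i \<in> I" "y i \<in> I" for i using xy by auto
  have "\<forall>i<n. \<forall>j<n. gram1 n x $$ (i,j) + gram1 n y $$ (i,j) \<in> I" using m i by auto
  then have "PSD n (\<lambda>i j. g (gram1 n x $$ (i,j)) + g (gram1 n y $$ (i,j)) - g (gram1 n x $$ (i,j) + gram1 n y $$ (i,j)))"
    using p gram1_psd_rank[OF I xy(1) k] gram1_psd_rank[OF I xy(2) k]
    unfolding sub_additive_on_iff[OF psd_rank_psd] by blast
  then have "PSD n (\<lambda>i j. h (x i * x j) + h (y i * y j) - h (x i * x j + y i * y j))"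
    by (rule PSD_cong) (use agreeD[OF g] m i in auto)
  then show "0 \<le> qform n (\<lambda>i j. h (x i * x j) + h (y i * y j) - h (x i * x j + y i * y j)) v"
    by (rule PSD_qform)
qed

lemma sub_additive_on_rank2:
  assumes p: "sub_additive_on n I (psd_rank n k I) g" and g: "agree I g h" and I: "semiring_set I" and k: "2 \<le> k"
    and xy: "range x \<subseteq> I" "range y \<subseteq> I"
  shows "PSD n (\<lambda>i j. h (x i * x j + y i * y j) + h 1 - h (x i * x j + y i * y j + 1))"
proof -
  note i = semiring_setD[OF I]
  have m: "x i \<in> I" "y i \<in> I" for i using xy by auto
  let ?J = "gram1 n (\<lambda>_. 1)"
  have J: "?J \<in> psd_rank n k I" using i k by (intro gram1_psd_rank I) auto
  have "\<forall>i<n. \<forall>j<n. gram2 n x y $$ (i,j) + ?J $$ (i,j) \<in> I" using m i by auto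
  then have "PSD n (\<lambda>i j. g (gram2 n x y $$ (i,j)) + g (?J $$ (i,j)) - g (gram2 n x y $$ (i,j) + ?J $$ (i,j)))"
    using p gram2_psd_rank[OF I xy k] J unfolding sub_additive_on_iff[OF psd_rank_psd] by blast
  then show ?thesis by (rule PSD_cong) (use agreeD[OF g] m i in auto)
qed

lemma sub_additive_on_rank2_nonneg:
  assumes p: "sub_additive_on 2 {0..} (psd_rank 2 k {0..}) g" and g: "agree {0..} g (spow s \<alpha>)" and k: "2 \<le> k"
  shows "0 \<le> \<alpha>"
proof (rule ccontr)
  assume "\<not> 0 \<le> \<alpha>"
  then have \<alpha>: "\<alpha> < 0" by simp
  \<comment> \<open>The Gram matrix has diagonal 5 and off-diagonal 4; adding the all-ones matrix
    gives 6 and 5.\<close>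
  let ?x = "\<lambda>i::nat. if i = 0 then 2 else 1 :: real" and ?y = "\<lambda>i::nat. if i = 0 then 1 else 2 :: real"
  have "PSD 2 (\<lambda>i j. spow s \<alpha> (?x i * ?x j + ?y i * ?y j) + spow s \<alpha> 1 - spow s \<alpha> (?x i * ?x j + ?y i * ?y j + 1))"
    by (rule sub_additive_on_rank2[OF p g semiring_set_nonneg k]) auto
  from PSD_qform[OF this, of "\<lambda>i. if i = 0 then 1 else - 1"]
  have "4 powr \<alpha> + 6 powr \<alpha> \<le> 2 * 5 powr \<alpha>"
    by (simp add: qform_def numeral_2_eq_2 spow_pos)
  moreover have "2 * (5 powr \<alpha>) < 4 powr \<alpha> + 6 powr \<alpha>"
  proof -
    \<comment> \<open>As 25 > 24 = 4 * 6, a negative power followed by the arithmetic-geometric mean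
      inequality gives the strict bound.\<close>
    have "5 powr \<alpha> = 25 powr (\<alpha> / 2)" using powr_powr[of 5 2 "\<alpha> / 2"] by simp
    also have "\<dots> < 24 powr (\<alpha> / 2)" using \<alpha> by (intro powr_less_mono2_neg) auto
    also have "\<dots> = sqrt (4 powr \<alpha> * 6 powr \<alpha>)" by (simp add: powr_mult[symmetric] powr_half_sqrt_powr)
    also have "\<dots> \<le> (4 powr \<alpha> + 6 powr \<alpha>) / 2" by (rule arith_geo_mean_sqrt) auto
    finally show ?thesis by simp
  qed
  ultimately show False by simp
qed

lemma sub_additive_on_rank2_nonzero:
  assumes p: "sub_additive_on n {0..} (psd_rank n k {0..}) g" and g: "agree {0..} g (spow s 0)" and k: "2 \<le> k"
    and n: "3 \<le> n"
  shows False
proof -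
  \<comment> \<open>At exponent 0 the gap is the support pattern of the Gram matrix: on the first
    three indices, ones on and next to the diagonal, with form - 1 at
    \<open>(1, - 1, 1)\<close>.\<close>
  let ?x = "\<lambda>i::nat. if i \<le> 1 then 1 else 0 :: real" and ?y = "\<lambda>i::nat. if 1 \<le> i then 1 else 0 :: real"
  have "PSD n (\<lambda>i j. spow s 0 (?x i * ?x j + ?y i * ?y j) + spow s 0 1 - spow s 0 (?x i * ?x j + ?y i * ?y j + 1))"
    by (rule sub_additive_on_rank2[OF p g semiring_set_nonneg k]) auto
  from PSD_qform[OF PSD_mono_dim[OF this n], of "\<lambda>i. if i = 1 then - 1 else 1"]
  show False by (simp add: qform_def numeral_3_eq_3 spow_pos)
qed

text \<open>At exponent 1 the function is |z|, not differentiable at 0, so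
  \<open>convG_imp_monoG\<close> does not apply. In the test the off-diagonal entry moves from - 1
  to 1 across the kink, while the diagonal stays where |z| is linear.\<close>

lemma convG_phi_1_False:
  assumes n: "2 \<le> n" shows "\<not> convG UNIV n (spow False 1)"
proof
  let ?x = "\<lambda>i::nat. if i = 0 then 1 else - 1 :: real"
  let ?v = "\<lambda>i. if i < 2 then ?x i else 0"
  let ?g = "spow False 1"
  assume "convG UNIV n ?g"
  then have "\<forall>x y v l. 0 \<le> l \<longrightarrow> l \<le> 1 \<longrightarrow>
     0 \<le> qform n (\<lambda>i j. l * ?g (x i * x j + y i * y j) + (1 - l) * ?g (x i * x j)
            - ?g (x i * x j + l * (y i * y j))) v" by (simp add: convG_def)
  from this[rule_format, of "1/2" ?x "\<lambda>_. sqrt 2" ?v]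
  have "0 \<le> qform n (\<lambda>i j. 1/2 * ?g (?x i * ?x j + sqrt 2 * sqrt 2) + (1 - 1/2) * ?g (?x i * ?x j)
            - ?g (?x i * ?x j + 1/2 * (sqrt 2 * sqrt 2))) ?v" by simp
  then show False unfolding qform_restrict[OF n] by (simp add: qform_def numeral_2_eq_2 spow_def)
qed

text \<open>Serves the threshold n - 2 at n = 2, where appending two points would leave dimension 0
  and no information. The test matrix has diagonal 5 and off-diagonal 4.\<close>

lemma posG_2_nonneg:
  assumes "posG {0..} 2 (spow s \<alpha>)" shows "0 \<le> \<alpha>"
proof (rule ccontr)
  assume "\<not> 0 \<le> \<alpha>"
  let ?x = "\<lambda>i::nat. if i = 0 then 2 else 1 :: real" and ?y = "\<lambda>i::nat. if i = 0 then 1 else 2 :: real"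
  have "0 \<le> qform 2 (\<lambda>i j. spow s \<alpha> (?x i * ?x j + ?y i * ?y j)) (\<lambda>i. if i = 0 then 1 else - 1)"
    using assms unfolding posG_def by (elim allE impE) auto
  then have "4 powr \<alpha> \<le> 5 powr \<alpha>"
    by (simp add: qform_def numeral_2_eq_2 spow_pos)
  moreover have "5 powr \<alpha> < 4 powr \<alpha>" using \<open>\<not> 0 \<le> \<alpha>\<close> by (intro powr_less_mono2_neg) auto
  ultimately show False by simp
qed

subsection \<open>The three families of power functions\<close>

lemma pos_ints_power:
  assumes "\<alpha> \<in> pos_ints" shows "\<exists>m\<ge>1. agree {0..} (f_pow \<alpha>) (\<lambda>x. x ^ m)"
proof -
  obtain m where "\<alpha> = real m" "1 \<le> m" using assms by (auto simp: pos_ints_def)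
  then show ?thesis
    by (intro exI[of _ m]) (simp add: agree_def spow_f[of _ _ False] spow_nat_nonneg)
qed

lemma pos_evens_power:
  assumes "\<alpha> \<in> pos_evens" shows "\<exists>m\<ge>1. agree UNIV (phi_pow \<alpha>) (\<lambda>x. x ^ m)"
proof -
  obtain m where "\<alpha> = real m" "1 \<le> m" "even m" using assms by (auto simp: pos_evens_def)
  then show ?thesis
    by (intro exI[of _ m]) (simp add: agree_def spow_phi spow_nat_phi)
qed

lemma pos_odds_power:
  assumes "\<alpha> \<in> pos_odds" shows "\<exists>m\<ge>1. agree UNIV (psi_pow \<alpha>) (\<lambda>x. x ^ m)"
proof -
  obtain m where "\<alpha> = real m" "odd m" using assms by (auto simp: pos_odds_def)
  moreover from this have "1 \<le> m" by (cases m) auto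
  ultimately show ?thesis
    by (intro exI[of _ m]) (simp add: agree_def spow_psi spow_nat_psi)
qed

lemma pos_ints_Suc: "\<beta> \<in> pos_ints \<Longrightarrow> \<beta> + 1 \<in> pos_ints"
  unfolding pos_ints_def by clarsimp (metis of_nat_Suc add.commute le_Suc_eq)

lemma pos_evens_Suc: "\<beta> \<in> pos_evens \<Longrightarrow> \<beta> + 1 \<in> pos_odds"
  unfolding pos_evens_def pos_odds_def by clarsimp (metis of_nat_Suc add.commute even_Suc)

lemma pos_odds_Suc:
  assumes "\<beta> \<in> pos_odds" shows "\<beta> + 1 \<in> pos_evens"
proof -
  obtain m where m: "\<beta> = real m" "odd m" using assms by (auto simp: pos_odds_def)
  have "\<beta> + 1 = real (Suc m)" "1 \<le> Suc m" "even (Suc m)" using m by auto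
  then show ?thesis unfolding pos_evens_def by blast
qed

lemma Collect_eq_setI: "(\<And>a. P a \<Longrightarrow> a \<in> S) \<Longrightarrow> (\<And>a. a \<in> S \<Longrightarrow> P a) \<Longrightarrow> {a. P a} = S"
  by auto

text \<open>\<open>E\<close> is the set of exponents for which \<open>g\<close> is a polynomial, and \<open>E'\<close> the one of the
  derivative family, for which the sign is toggled.\<close>

locale power_family =
  fixes I :: "real set" and g :: "real \<Rightarrow> real \<Rightarrow> real" and s :: bool and E E' :: "real set"
  assumes I: "semiring_set I" "{0..} \<subseteq> I" "convex I"
    and agree: "agree I (g \<alpha>) (spow s \<alpha>)"
    and power: "\<alpha> \<in> E \<Longrightarrow> \<exists>m\<ge>1. agree I (g \<alpha>) (\<lambda>x. x ^ m)"
    and superG_E: "superG I m (spow s \<alpha>) \<Longrightarrow> 1 \<le> m \<Longrightarrow> \<alpha> \<in> E \<union> {real m..}"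
    and superG_E': "superG I m (spow (\<not> s) \<alpha>) \<Longrightarrow> 1 \<le> m \<Longrightarrow> \<alpha> \<in> E' \<union> {real m..}"
    and E'_Suc: "\<alpha> \<in> E' \<Longrightarrow> \<alpha> + 1 \<in> E"
    and convG_1: "convG I m (spow s 1) \<Longrightarrow> 2 \<le> m \<Longrightarrow> 1 \<in> E"
begin

lemma superG_spow:
  shows posG_superG: "posG I (Suc (Suc n)) (spow t \<alpha>) \<Longrightarrow> superG I n (spow t \<alpha>)"
    and monoG_superG: "monoG I (Suc n) (spow t \<alpha>) \<Longrightarrow> superG I n (spow t \<alpha>)"
  using semiring_setD(1,2)[OF I(1)]
  by (auto intro: posG_imp_superG monoG_imp_superG simp: spow_mult)

lemma positive_char:
  assumes n: "2 \<le> n" and k: "2 \<le> k"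
  shows "{\<alpha>. positive_on n I (psd_rank n k I) (g \<alpha>)} = E \<union> {real n - 2..}"
proof (rule Collect_eq_setI)
  fix \<alpha> assume "positive_on n I (psd_rank n k I) (g \<alpha>)"
  then have p: "posG I n (spow s \<alpha>)" by (rule positive_on_posG[OF _ agree I(1) k])
  show "\<alpha> \<in> E \<union> {real n - 2..}"
  proof (cases "n = 2")
    case True
    then have "posG {0..} 2 (spow s \<alpha>)" using p I(2) by (auto simp: posG_def)
    then show ?thesis using posG_2_nonneg True by simp
  next
    case False
    define l where "l = n - 2"
    have l: "n = Suc (Suc l)" "1 \<le> l" using n False by (auto simp: l_def)
    have "superG I l (spow s \<alpha>)" using p unfolding l by (rule posG_superG)
    from superG_E[OF this l(2)] show ?thesis using l by auto
  qed
next
  fix \<alpha> assume "\<alpha> \<in> E \<union> {real n - 2..}"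
  then consider "\<alpha> \<in> E" | "real n - 2 \<le> \<alpha>" by auto
  then show "positive_on n I (psd_rank n k I) (g \<alpha>)"
  proof cases
    case 1
    then obtain m where m: "1 \<le> m" "agree I (g \<alpha>) (\<lambda>x. x ^ m)" using power by blast
    show ?thesis by (rule positive_on_suff[OF POS_power m(2) psd_rank_psd])
  next
    case 2
    show ?thesis by (rule positive_on_suff[OF POS_spow[OF 2 n] agree psd_rank_psd])
  qed
qed

lemma monotone_char:
  assumes n: "2 \<le> n" and k: "2 \<le> k"
  shows "{\<alpha>. monotone_loewner_on n I (psd_rank n k I) (g \<alpha>)} = E \<union> {real n - 1..}"
proof (rule Collect_eq_setI)
  fix \<alpha> assume "monotone_loewner_on n I (psd_rank n k I) (g \<alpha>)"
  then have p: "monoG I n (spow s \<alpha>)" by (rule monotone_loewner_on_monoG[OF _ agree I(1) k])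
  obtain l where l: "n = Suc l" "1 \<le> l" using n by (cases n) auto
  have "superG I l (spow s \<alpha>)" using p unfolding l by (rule monoG_superG)
  from superG_E[OF this l(2)] show "\<alpha> \<in> E \<union> {real n - 1..}" using l by auto
next
  fix \<alpha> assume "\<alpha> \<in> E \<union> {real n - 1..}"
  then consider "\<alpha> \<in> E" | "real n - 1 \<le> \<alpha>" by auto
  then show "monotone_loewner_on n I (psd_rank n k I) (g \<alpha>)"
  proof cases
    case 1
    then obtain m where m: "1 \<le> m" "agree I (g \<alpha>) (\<lambda>x. x ^ m)" using power by blast
    show ?thesis by (rule monotone_loewner_on_suff[OF MONO_power m(2) psd_rank_psd])
  next
    case 2
    show ?thesis by (rule monotone_loewner_on_suff[OF MONO_spow[OF 2 n] agree psd_rank_psd])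
  qed
qed

text \<open>Differentiation lowers the exponent by one and toggles the sign, and monotonicity of the
  derivative in dimension \<open>n\<close> gives super-additivity in dimension \<open>n - 1\<close>.
  Hence \<alpha> - 1 lies in \<open>E'\<close> or is at least n - 1. Exponent 1 is treated apart by
  \<open>convG_1\<close>.\<close>

lemma convex_char:
  assumes n: "2 \<le> n" and k: "2 \<le> k"
  shows "{\<alpha>. convex_loewner_on n I (psd_rank n k I) (g \<alpha>)} = E \<union> {real n..}"
proof (rule Collect_eq_setI)
  fix \<alpha> assume c: "convex_loewner_on n I (psd_rank n k I) (g \<alpha>)"
  then have p: "convG I n (spow s \<alpha>)" by (rule convex_loewner_on_convG[OF _ agree I(1,3) k])
  have "1 \<le> \<alpha>" using convex_loewner_on_exponent_ge_1[OF c agree I(1,2)] n k by simp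
  show "\<alpha> \<in> E \<union> {real n..}"
  proof (cases "\<alpha> = 1")
    case True
    then show ?thesis using convG_1[OF _ n] p by auto
  next
    case False
    then have \<alpha>: "1 < \<alpha>" using \<open>1 \<le> \<alpha>\<close> by simp
    have "monoG I n (\<lambda>x. \<alpha> * spow (\<not> s) (\<alpha> - 1) x)"
    proof (rule convG_imp_monoG[OF DERIV_spow[OF \<alpha>] _ _ p])
      show "isCont (\<lambda>x. \<alpha> * spow (\<not> s) (\<alpha> - 1) x) x" for x
        using \<alpha> by (intro continuous_mult continuous_const isCont_spow) auto
      show "a + e \<in> I" if "a \<in> I" "0 < e" for a e
        using that I(2) by (intro semiring_setD(3)[OF I(1)]) auto
    qed
    moreover have "qform n (\<lambda>i j. \<alpha> * F i j - \<alpha> * G i j) v = \<alpha> * qform n (\<lambda>i j. F i j - G i j) v" for F G v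
      unfolding qform_scale[symmetric] by (simp add: right_diff_distrib)
    ultimately have m: "monoG I n (spow (\<not> s) (\<alpha> - 1))"
      using \<alpha> by (simp add: monoG_def zero_le_mult_iff)
    obtain l where l: "n = Suc l" "1 \<le> l" using n by (cases n) auto
    have "superG I l (spow (\<not> s) (\<alpha> - 1))" using m unfolding l by (rule monoG_superG)
    from superG_E'[OF this l(2)] show ?thesis using l E'_Suc[of "\<alpha> - 1"] by auto
  qed
next
  fix \<alpha> assume "\<alpha> \<in> E \<union> {real n..}"
  then consider "\<alpha> \<in> E" | "real n \<le> \<alpha>" by auto
  then show "convex_loewner_on n I (psd_rank n k I) (g \<alpha>)"
  proof cases
    case 1
    then obtain m where m: "1 \<le> m" "agree I (g \<alpha>) (\<lambda>x. x ^ m)" using power by blast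
    show ?thesis by (rule convex_loewner_on_suff[OF CONV_power m(2) psd_rank_psd I(3)])
  next
    case 2
    show ?thesis by (rule convex_loewner_on_suff[OF CONV_spow[OF 2 n] agree psd_rank_psd I(3)])
  qed
qed

lemma super_additive_char:
  assumes n: "2 \<le> n" and k: "1 \<le> k"
  shows "{\<alpha>. super_additive_on n I (psd_rank n k I) (g \<alpha>)} = E \<union> {real n..}"
proof (rule Collect_eq_setI)
  fix \<alpha> assume "super_additive_on n I (psd_rank n k I) (g \<alpha>)"
  then have "superG I n (spow s \<alpha>)" by (rule super_additive_on_superG[OF _ agree I(1) k])
  then show "\<alpha> \<in> E \<union> {real n..}" by (rule superG_E) (use n in simp)
next
  fix \<alpha> assume "\<alpha> \<in> E \<union> {real n..}"
  then consider "\<alpha> \<in> E" | "real n \<le> \<alpha>" by auto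
  then show "super_additive_on n I (psd_rank n k I) (g \<alpha>)"
  proof cases
    case 1
    then obtain m where m: "1 \<le> m" "agree I (g \<alpha>) (\<lambda>x. x ^ m)" using power by blast
    show ?thesis by (rule super_additive_on_suff[OF SUPER_power[OF m(1)] m(2) psd_rank_psd])
  next
    case 2
    show ?thesis by (rule super_additive_on_suff[OF SUPER_spow[OF 2 n] agree psd_rank_psd])
  qed
qed

lemma rank1_chars:
  assumes n: "2 \<le> n"
  shows "{\<alpha>. positive_on n I (psd_rank n 1 I) (g \<alpha>)} = UNIV"
    and "{\<alpha>. monotone_loewner_on n I (psd_rank n 1 I) (g \<alpha>)} = {0..}"
    and "{\<alpha>. convex_loewner_on n I (psd_rank n 1 I) (g \<alpha>)} = {1..}"
proof -
  show "{\<alpha>. positive_on n I (psd_rank n 1 I) (g \<alpha>)} = UNIV"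
    using positive_on_rank1[OF agree] by blast
  have "0 \<le> \<alpha>" if "monotone_loewner_on n I (psd_rank n 1 I) (g \<alpha>)" for \<alpha>
    using monotone_loewner_on_exponent_nonneg[OF that agree I(1,2)] n by simp
  then show "{\<alpha>. monotone_loewner_on n I (psd_rank n 1 I) (g \<alpha>)} = {0..}"
    using monotone_loewner_on_rank1[OF agree] by auto
  have "1 \<le> \<alpha>" if "convex_loewner_on n I (psd_rank n 1 I) (g \<alpha>)" for \<alpha>
    using convex_loewner_on_exponent_ge_1[OF that agree I(1,2)] n by simp
  then show "{\<alpha>. convex_loewner_on n I (psd_rank n 1 I) (g \<alpha>)} = {1..}"
    using convex_loewner_on_rank1[OF agree _ I(3)] by auto
qed

lemma sub_additive_1:
  assumes "\<And>x. x \<in> I \<Longrightarrow> g 1 x = x"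
  shows "sub_additive_on n I (psd_rank n k I) (g 1)"
  unfolding sub_additive_on_iff[OF psd_rank_psd]
proof (intro ballI impI)
  fix A B assume A: "A \<in> psd_rank n k I" and B: "B \<in> psd_rank n k I"
    and AB: "\<forall>i<n. \<forall>j<n. A $$ (i,j) + B $$ (i,j) \<in> I"
  note A = psd_D(3)[OF subsetD[OF psd_rank_psd A]] and B = psd_D(3)[OF subsetD[OF psd_rank_psd B]]
  show "PSD n (\<lambda>i j. g 1 (A $$ (i,j)) + g 1 (B $$ (i,j)) - g 1 (A $$ (i,j) + B $$ (i,j)))"
    by (rule PSD_cong[OF PSD_zero]) (use A B AB assms in auto)
qed

end

text \<open>On nonnegative entries the sign is invisible, so the derivative family has the same
  polynomial exponents.\<close>

interpretation f: power_family "{0..}" f_pow False pos_ints pos_ints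
proof
  show "1 \<in> pos_ints" unfolding pos_ints_def by (auto intro!: exI[of _ 1])
qed (use pos_ints_power superG_exponent pos_ints_Suc spow_f in
    \<open>auto simp: agree_def semiring_set_nonneg convex_real_interval\<close>)

text \<open>Here 1 is not in \<open>E\<close>; \<open>convG_1\<close> holds because
  \<open>convG_phi_1_False\<close> refutes its premise.\<close>

interpretation phi: power_family UNIV phi_pow False pos_evens pos_odds
  by standard (use pos_evens_power superG_phi_exponent superG_psi_exponent pos_odds_Suc convG_phi_1_False in
    \<open>auto simp: agree_def semiring_set_UNIV spow_phi\<close>)

interpretation psi: power_family UNIV psi_pow True pos_odds pos_evens
proof
  show "1 \<in> pos_odds" unfolding pos_odds_def by (auto intro!: exI[of _ 1])
qed (use pos_odds_power superG_phi_exponent superG_psi_exponent pos_evens_Suc in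
    \<open>auto simp: agree_def semiring_set_UNIV spow_psi\<close>)

section \<open>Sub-additive exponents of each family\<close>

lemma f_sub_necessary:
  assumes "\<alpha> \<in> H_f sub_additive_on n k" "2 \<le> n" "1 \<le> k"
  shows "\<alpha> \<in> {..0} \<union> {1}" "3 \<le> n \<Longrightarrow> 0 \<le> \<alpha>" "n = 2 \<Longrightarrow> 2 \<le> k \<Longrightarrow> 0 \<le> \<alpha>"
    "3 \<le> n \<Longrightarrow> 2 \<le> k \<Longrightarrow> \<alpha> \<noteq> 0"
proof -
  have p: "sub_additive_on n {0..} (psd_rank n k {0..}) (f_pow \<alpha>)" using assms(1) by (simp add: H_f_def)
  have G: "subG {0..} n (spow False \<alpha>)"
    using p by (rule sub_additive_on_subG[OF _ f.agree f.I(1) assms(3)])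
  have "subG {0..} 2 (spow False \<alpha>)" using subG_antimono[OF G assms(2)] .
  from subG_le_1[OF this] subG_not_between_0_1[OF this] show "\<alpha> \<in> {..0} \<union> {1}" by force
  show "0 \<le> \<alpha>" if "3 \<le> n" using subG_3_nonneg[OF subG_antimono[OF G that]] .
  show "0 \<le> \<alpha>" if "n = 2" "2 \<le> k"
    using sub_additive_on_rank2_nonneg[OF _ f.agree that(2)] p that(1) by simp
  show "\<alpha> \<noteq> 0" if "3 \<le> n" "2 \<le> k"
    using sub_additive_on_rank2_nonzero[OF _ f.agree that(2,1)] p by blast
qed

lemma f_sub_rank1:
  assumes "n = 2 \<and> \<alpha> \<le> 0 \<or> \<alpha> = 0"
  shows "\<alpha> \<in> H_f sub_additive_on n 1"
  unfolding H_f_def mem_Collect_eq sub_additive_on_iff[OF psd_rank_psd]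
proof (intro ballI impI)
  fix A B assume A1: "A \<in> psd_rank n 1 {0..}" and B1: "B \<in> psd_rank n 1 {0..}"
  note A = psd_D(3)[OF subsetD[OF psd_rank_psd A1]] and B = psd_D(3)[OF subsetD[OF psd_rank_psd B1]]
  obtain x where x: "\<And>i j. i < n \<Longrightarrow> j < n \<Longrightarrow> A $$ (i,j) = x i * x j" by (rule psd_rank_1E[OF A1]) blast
  obtain y where y: "\<And>i j. i < n \<Longrightarrow> j < n \<Longrightarrow> B $$ (i,j) = y i * y j" by (rule psd_rank_1E[OF B1]) blast
  \<comment> \<open>\<open>psd_rank_1E\<close> does not fix the signs of \<open>x\<close>; as the
    entries are nonnegative, absolute values give the same matrix and meet the sign conditions of
    the gap lemmas.\<close>
  have x': "A $$ (i,j) = \<bar>x i\<bar> * \<bar>x j\<bar>" if "i < n" "j < n" for i j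
    using A[OF that] x[OF that] by (simp add: abs_mult[symmetric])
  have y': "B $$ (i,j) = \<bar>y i\<bar> * \<bar>y j\<bar>" if "i < n" "j < n" for i j
    using B[OF that] y[OF that] by (simp add: abs_mult[symmetric])
  have "PSD n (\<lambda>i j. spow False \<alpha> (\<bar>x i\<bar> * \<bar>x j\<bar>) + spow False \<alpha> (\<bar>y i\<bar> * \<bar>y j\<bar>)
     - spow False \<alpha> (\<bar>x i\<bar> * \<bar>x j\<bar> + \<bar>y i\<bar> * \<bar>y j\<bar>))"
    using assms sub_additive_2_nonpos[of \<alpha> "\<lambda>i. \<bar>x i\<bar>" "\<lambda>i. \<bar>y i\<bar>"]
      sub_additive_0_rank1[of "\<lambda>i. \<bar>x i\<bar>" "\<lambda>i. \<bar>y i\<bar>" n] by auto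
  then show "PSD n (\<lambda>i j. f_pow \<alpha> (A $$ (i,j)) + f_pow \<alpha> (B $$ (i,j)) - f_pow \<alpha> (A $$ (i,j) + B $$ (i,j)))"
    by (rule PSD_cong) (simp add: x' y' spow_f[of _ _ False])
qed

lemma f_sub_1: "1 \<in> H_f sub_additive_on n k"
  unfolding H_f_def mem_Collect_eq by (rule f.sub_additive_1) (simp add: f_pow_def)

lemma phi_sub_empty:
  assumes "2 \<le> n" "1 \<le> k" shows "H_phi sub_additive_on n k = {}"
proof -
  have "subG UNIV n (spow False \<alpha>)" if "\<alpha> \<in> H_phi sub_additive_on n k" for \<alpha>
    using that unfolding H_phi_def mem_Collect_eq
    by (rule sub_additive_on_subG[OF _ phi.agree phi.I(1) assms(2)])
  then show ?thesis using subG_antimono[OF _ assms(1)] subG_phi_False by blast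
qed

lemma psi_sub_necessary:
  assumes "\<alpha> \<in> H_psi sub_additive_on n k" "2 \<le> n" "1 \<le> k"
  shows "\<alpha> \<in> {0, 1}" "3 \<le> n \<Longrightarrow> \<alpha> = 1"
proof -
  have p: "sub_additive_on n UNIV (psd_rank n k UNIV) (psi_pow \<alpha>)" using assms(1) by (simp add: H_psi_def)
  have G: "subG UNIV n (spow True \<alpha>)"
    using p by (rule sub_additive_on_subG[OF _ psi.agree psi.I(1) assms(3)])
  have 2: "subG UNIV 2 (spow True \<alpha>)" using subG_antimono[OF G assms(2)] .
  note 3 = subG_UNIV[OF 2, of "{0..}"]
  from subG_le_1[OF 3] subG_not_between_0_1[OF 3] subG_psi_nonneg[OF 2]
  show *: "\<alpha> \<in> {0, 1}" by force
  show "\<alpha> = 1" if "3 \<le> n"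
    using * subG_psi_0_False subG_antimono[OF G that] by auto
qed

lemma psi_sub_1: "1 \<in> H_psi sub_additive_on n k"
  unfolding H_psi_def mem_Collect_eq by (rule psi.sub_additive_1) (simp add: psi_pow_def sgn_mult_abs)

theorem theorem1p2:
  fixes n k :: nat
  assumes "2 \<le> n" and "1 \<le> k" and "k \<le> n"
  shows
    "(k = 1 \<longrightarrow>
        H_f positive_on n k = UNIV \<and>
        H_phi positive_on n k = UNIV \<and>
        H_psi positive_on n k = UNIV) \<and>
     (2 \<le> k \<longrightarrow>
        H_f positive_on n k = pos_ints \<union> {real n - 2..} \<and>
        H_phi positive_on n k = pos_evens \<union> {real n - 2..} \<and>
        H_psi positive_on n k = pos_odds \<union> {real n - 2..}) \<and>

    (k = 1 \<longrightarrow>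
        H_f monotone_loewner_on n k = {0..} \<and>
        H_phi monotone_loewner_on n k = {0..} \<and>
        H_psi monotone_loewner_on n k = {0..}) \<and>
     (2 \<le> k \<longrightarrow>
        H_f monotone_loewner_on n k = pos_ints \<union> {real n - 1..} \<and>
        H_phi monotone_loewner_on n k = pos_evens \<union> {real n - 1..} \<and>
        H_psi monotone_loewner_on n k = pos_odds \<union> {real n - 1..}) \<and>

    (k = 1 \<longrightarrow>
        H_f convex_loewner_on n k = {1..} \<and>
        H_phi convex_loewner_on n k = {1..} \<and>
        H_psi convex_loewner_on n k = {1..}) \<and>
     (2 \<le> k \<longrightarrow>
        H_f convex_loewner_on n k = pos_ints \<union> {real n..} \<and>
        H_phi convex_loewner_on n k = pos_evens \<union> {real n..} \<and>
        H_psi convex_loewner_on n k = pos_odds \<union> {real n..}) \<and>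

    H_f super_additive_on n k = pos_ints \<union> {real n..} \<and>
     H_phi super_additive_on n k = pos_evens \<union> {real n..} \<and>
     H_psi super_additive_on n k = pos_odds \<union> {real n..} \<and>

    (k = 1 \<longrightarrow>
        (n = 2 \<longrightarrow> H_f sub_additive_on n k = {..0} \<union> {1}) \<and>
        (n > 2 \<longrightarrow> H_f sub_additive_on n k = {0, 1}) \<and>
        H_phi sub_additive_on n k = {} \<and>
        (n = 2 \<longrightarrow> H_psi sub_additive_on n k = {0, 1}) \<and>
        (n > 2 \<longrightarrow> H_psi sub_additive_on n k = {1})) \<and>
     (2 \<le> k \<longrightarrow>
        (n = 2 \<longrightarrow> H_f sub_additive_on n k = {0, 1}) \<and>
        (n > 2 \<longrightarrow> H_f sub_additive_on n k = {1}) \<and>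
        H_phi sub_additive_on n k = {} \<and>
        (n = 2 \<longrightarrow> H_psi sub_additive_on n k = {0, 1}) \<and>
        (n > 2 \<longrightarrow> H_psi sub_additive_on n k = {1}))"
proof -
  note n = assms(1) and k = assms(2)
  note chars = H_f_def H_phi_def H_psi_def
  have 1: "H_f positive_on n 1 = UNIV" "H_phi positive_on n 1 = UNIV" "H_psi positive_on n 1 = UNIV"
    "H_f monotone_loewner_on n 1 = {0..}" "H_phi monotone_loewner_on n 1 = {0..}" "H_psi monotone_loewner_on n 1 = {0..}"
    "H_f convex_loewner_on n 1 = {1..}" "H_phi convex_loewner_on n 1 = {1..}" "H_psi convex_loewner_on n 1 = {1..}"
    unfolding chars by (rule f.rank1_chars[OF n] phi.rank1_chars[OF n] psi.rank1_chars[OF n])+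
  have 2: "H_f positive_on n k = pos_ints \<union> {real n - 2..}"
    "H_phi positive_on n k = pos_evens \<union> {real n - 2..}"
    "H_psi positive_on n k = pos_odds \<union> {real n - 2..}"
    "H_f monotone_loewner_on n k = pos_ints \<union> {real n - 1..}"
    "H_phi monotone_loewner_on n k = pos_evens \<union> {real n - 1..}"
    "H_psi monotone_loewner_on n k = pos_odds \<union> {real n - 1..}"
    "H_f convex_loewner_on n k = pos_ints \<union> {real n..}"
    "H_phi convex_loewner_on n k = pos_evens \<union> {real n..}"
    "H_psi convex_loewner_on n k = pos_odds \<union> {real n..}" if k2: "2 \<le> k"
    unfolding chars
    by (rule f.positive_char[OF n k2] phi.positive_char[OF n k2] psi.positive_char[OF n k2]
        f.monotone_char[OF n k2] phi.monotone_char[OF n k2] psi.monotone_char[OF n k2]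
        f.convex_char[OF n k2] phi.convex_char[OF n k2] psi.convex_char[OF n k2])+
  have 3: "H_f super_additive_on n k = pos_ints \<union> {real n..}"
    "H_phi super_additive_on n k = pos_evens \<union> {real n..}"
    "H_psi super_additive_on n k = pos_odds \<union> {real n..}"
    unfolding chars
    by (rule f.super_additive_char[OF n k] phi.super_additive_char[OF n k] psi.super_additive_char[OF n k])+
  have f1: "H_f sub_additive_on n 1 = {..0} \<union> {1}" if "n = 2"
  proof
    show "H_f sub_additive_on n 1 \<subseteq> {..0} \<union> {1}"
      by (rule subsetI, rule f_sub_necessary(1)[OF _ n order.refl])
    show "{..0} \<union> {1} \<subseteq> H_f sub_additive_on n 1"
      using f_sub_1 f_sub_rank1[of n] that by blast
  qed
  have f1': "H_f sub_additive_on n 1 = {0, 1}" if "n > 2"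
  proof (intro subset_antisym subsetI)
    fix \<alpha> assume "\<alpha> \<in> H_f sub_additive_on n 1"
    then have "\<alpha> \<in> {..0} \<union> {1}" "0 \<le> \<alpha>" using f_sub_necessary(1,2)[OF _ n] that by auto
    then show "\<alpha> \<in> {0, 1}" by auto
  next
    fix \<alpha> :: real assume "\<alpha> \<in> {0, 1}"
    then show "\<alpha> \<in> H_f sub_additive_on n 1" using f_sub_1 f_sub_rank1[of n \<alpha>] by blast
  qed
  have f2: "H_f sub_additive_on n k = {0, 1}" if "2 \<le> k" "n = 2"
  proof (intro subset_antisym subsetI)
    fix \<alpha> assume "\<alpha> \<in> H_f sub_additive_on n k"
    then have "\<alpha> \<in> {..0} \<union> {1}" "0 \<le> \<alpha>" using f_sub_necessary(1,3)[OF _ n k] that by auto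
    then show "\<alpha> \<in> {0, 1}" by auto
  next
    fix \<alpha> :: real assume "\<alpha> \<in> {0, 1}"
    then show "\<alpha> \<in> H_f sub_additive_on n k" using f_sub_1 zero_in_H_f_sub that(2) by blast
  qed
  have f2': "H_f sub_additive_on n k = {1}" if "2 \<le> k" "n > 2"
  proof (intro subset_antisym subsetI)
    fix \<alpha> assume "\<alpha> \<in> H_f sub_additive_on n k"
    then have "\<alpha> \<in> {..0} \<union> {1}" "0 \<le> \<alpha>" "\<alpha> \<noteq> 0" using f_sub_necessary(1,2,4)[OF _ n k] that by auto
    then show "\<alpha> \<in> {1}" by auto
  qed (use f_sub_1 in blast)
  have psi: "H_psi sub_additive_on n k = {0, 1}" if "n = 2"
  proof (intro subset_antisym subsetI)
    fix \<alpha> :: real assume "\<alpha> \<in> {0, 1}"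
    then show "\<alpha> \<in> H_psi sub_additive_on n k" using psi_sub_1 zero_in_H_psi_sub that by blast
  qed (rule psi_sub_necessary(1)[OF _ n k])
  have psi': "H_psi sub_additive_on n k = {1}" if "n > 2"
  proof (intro subset_antisym subsetI)
    fix \<alpha> assume "\<alpha> \<in> H_psi sub_additive_on n k"
    then show "\<alpha> \<in> {1}" using psi_sub_necessary(2)[OF _ n k] that by simp
  qed (use psi_sub_1 in blast)
  note phi = phi_sub_empty[OF n k]
  show ?thesis
    by (intro conjI impI) (use 1 2 3 f1 f1' f2 f2' phi psi psi' in simp_all)
qed

end
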